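(* Let $\mathcal E,\mathcal G$ be Hilbert spaces and let $F,\Theta,\Gamma$ be free holomorphic functions on $[B(\mathcal H)^n]_1$ with coefficients in $B(\mathcal E)$, $B(\mathcal G,\mathcal E)$, and $B(\mathcal E,\mathcal G)$, respectively. If (i) $\Re F(X)\le I$ for any $X\in[B(\mathcal H)^n]_1$, (ii) $\Theta$ has the radial infimum property, $\|\Theta\|_\infty=1$, and $\|\Theta(0)\|<1$, (iii) $F=\Theta\Gamma$, then $$\|F(X)\|\le\frac{2\|\Theta(X)\|}{1-\|\Theta(X)\|},\qquad X\in[B(\mathcal H)^n]_1.$$
   Context: $\mathcal H$ is a separable infinite dimensional Hilbert space and $n\in\{1,2,\dots\}\cup\{\infty\}$. For $X=(X_1,\dots,X_n)\in B(\mathcal H)^n$, $\|X\|=\|\sum_iX_iX_i^*\|^{1/2}$, and $[B(\mathcal H)^n]_1=\{X:\|X\|<1\}$. $\mathbb F_n^+$ is the unital free semigroup on $g_1,\dots,g_n$; for $\alpha=g_{i_1}\cdots g_{i_k}$ put $|\alpha|=k$, $X_\alpha=X_{i_1}\cdots X_{i_k}$ ($X_\alpha=I$ for the neutral element, of length $0$). A free holomorphic function on $[B(\mathcal H)^n]_1$ with coefficients in $B(\mathcal E,\mathcal G)$ is a map $F(X)=\sum_{k=0}^\infty\sum_{|\alpha|=k}X_\alpha\otimes A_{(\alpha)}$ with $A_{(\alpha)}\in B(\mathcal E,\mathcal G)$, the series in $k$ converging in operator norm for all $X\in[B(\mathcal H)^n]_1$. The same series evaluates $F$ at strict row contractions on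 any Hilbert space. $\|F\|_\infty=\sup_{\|X\|<1}\|F(X)\|$; $F$ is bounded if this is finite. $\Re F(X)=\frac12(F(X)+F(X)^* )$. $S_i\varphi=e_i\otimes\varphi$ ($i=1,\dots,n$) are the left creation operators on the full Fock space $F^2(H_n)=\mathbb C1\oplus\bigoplus_{k\ge1}H_n^{\otimes k}$, where $H_n$ is an $n$-dimensional Hilbert space with orthonormal basis $e_1,\dots,e_n$. A bounded free holomorphic function $\Theta$ has the radial infimum property if $\liminf_{r\to1}\inf_{\|x\|=1}\|\Theta(rS_1,\dots,rS_n)x\|=\|\Theta\|_\infty$ (infimum over unit vectors of the domain). *)

theory Defs
  imports "HOL-Analysis.Analysis"
begin

section \<open>Complex Hilbert spaces\<close>

text \<open>The distribution only has real inner product spaces. A complex Hilbert space is a complete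
  real inner product space together with a complex scalar multiplication and a complex inner
  product (linear in the first argument) whose real part is the given real inner product.\<close>

class complex_hilbert_space = real_inner + complete_space +
  fixes scaleC :: "complex \<Rightarrow> 'a \<Rightarrow> 'a" (infixr "*\<^sub>C" 75)
    and cinner :: "'a \<Rightarrow> 'a \<Rightarrow> complex"
  assumes scaleC_add_right: "c *\<^sub>C (x + y) = c *\<^sub>C x + c *\<^sub>C y"
    and scaleC_add_left: "(c + d) *\<^sub>C x = c *\<^sub>C x + d *\<^sub>C x"
    and scaleC_scaleC: "c *\<^sub>C d *\<^sub>C x = (c * d) *\<^sub>C x"
    and scaleR_scaleC: "r *\<^sub>R x = complex_of_real r *\<^sub>C x"
    and cinner_commute: "cinner x y = cnj (cinner y x)"
    and cinner_add_left: "cinner (x + y) z = cinner x z + cinner y z"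
    and cinner_scaleC_left: "cinner (c *\<^sub>C x) y = c * cinner x y"
    and inner_eq_Re_cinner: "inner x y = Re (cinner x y)"

subclass (in complex_hilbert_space) banach ..

lemma scaleC_one: "1 *\<^sub>C x = (x :: 'a::complex_hilbert_space)"
  by (metis of_real_1 scaleR_one scaleR_scaleC)

lemma module_scaleC: "module (scaleC :: complex \<Rightarrow> 'a \<Rightarrow> 'a::complex_hilbert_space)"
  by unfold_locales (simp_all add: scaleC_add_right scaleC_add_left scaleC_scaleC scaleC_one)

lemma cinner_add_right: "cinner x (y + z) = cinner x y + cinner x (z :: 'a::complex_hilbert_space)"
  by (metis cinner_add_left cinner_commute complex_cnj_add)

lemma cinner_scaleC_right: "cinner x (c *\<^sub>C y) = cnj c * cinner x (y :: 'a::complex_hilbert_space)"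
  by (metis cinner_scaleC_left cinner_commute complex_cnj_mult)

lemma scaleC_zero_left [simp]: "0 *\<^sub>C x = (0 :: 'a::complex_hilbert_space)"
  by (metis of_real_0 scaleR_zero_left scaleR_scaleC)

lemma scaleC_zero_right [simp]: "c *\<^sub>C 0 = (0 :: 'a::complex_hilbert_space)"
  by (metis add_cancel_right_right scaleC_add_right)

lemma cinner_zero_left [simp]: "cinner 0 (y :: 'a::complex_hilbert_space) = 0"
  by (metis cinner_scaleC_left mult_zero_left scaleC_zero_left)

lemma cinner_zero_right [simp]: "cinner (y :: 'a::complex_hilbert_space) 0 = 0"
  by (metis cinner_commute cinner_zero_left complex_cnj_zero)

lemma cinner_minus_left: "cinner (- x) (y :: 'a::complex_hilbert_space) = - cinner x y"
  by (metis add.right_inverse cinner_add_left cinner_zero_left neg_eq_iff_add_eq_0)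

lemma cinner_diff_left: "cinner (x - z) (y :: 'a::complex_hilbert_space) = cinner x y - cinner z y"
  using cinner_add_left[of x "- z" y] by (simp add: cinner_minus_left)

lemma cinner_diff_right: "cinner y (x - z :: 'a::complex_hilbert_space) = cinner y x - cinner y z"
  by (metis cinner_diff_left cinner_commute complex_cnj_diff)

lemma cinner_sum_left:
  "cinner (\<Sum>i\<in>A. f i) (y :: 'a::complex_hilbert_space) = (\<Sum>i\<in>A. cinner (f i) y)"
  by (induction A rule: infinite_finite_induct) (auto simp: cinner_add_left)

lemma cinner_sum_right:
  "cinner (y :: 'a::complex_hilbert_space) (\<Sum>i\<in>A. f i) = (\<Sum>i\<in>A. cinner y (f i))"
  by (induction A rule: infinite_finite_induct) (auto simp: cinner_add_right)

lemma cinner_self: "cinner x x = complex_of_real ((norm (x :: 'a::complex_hilbert_space))\<^sup>2)"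
proof -
  have "Im (cinner x x) = 0"
    using cinner_commute[of x x] by (metis complex_cnj complex.collapse complex.sel(2) neg_equal_zero)
  then show ?thesis
    by (simp add: complex_eq_iff power2_norm_eq_inner inner_eq_Re_cinner)
qed

lemma norm_scaleC: "norm (c *\<^sub>C x) = cmod c * norm (x :: 'a::complex_hilbert_space)"
proof -
  have "complex_of_real ((norm (c *\<^sub>C x))\<^sup>2) = complex_of_real ((cmod c * norm x)\<^sup>2)"
    by (simp only: cinner_self[symmetric] cinner_scaleC_left cinner_scaleC_right)
      (use complex_norm_square[of c] in \<open>simp add: cinner_self power_mult_distrib mult_ac\<close>)
  then have "(norm (c *\<^sub>C x))\<^sup>2 = (cmod c * norm x)\<^sup>2"
    by (simp only: of_real_eq_iff)
  then show ?thesis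
    by (simp add: power2_eq_iff_nonneg)
qed

lemma norm_cinner_le: "cmod (cinner x y) \<le> norm x * norm (y :: 'a::complex_hilbert_space)"
proof (cases "cinner x y = 0")
  case False
  define c where "c = cnj (cinner x y) / complex_of_real (cmod (cinner x y))"
  have c: "cmod c = 1" using False by (simp add: c_def norm_divide)
  have "c * cinner x y = complex_of_real (cmod (cinner x y))"
    using False by (simp add: c_def complex_norm_square[symmetric] power2_eq_square mult.commute)
  then have "cmod (cinner x y) = inner (c *\<^sub>C x) y"
    by (simp add: inner_eq_Re_cinner cinner_scaleC_left)
  also have "\<dots> \<le> norm (c *\<^sub>C x) * norm y" by (rule norm_cauchy_schwarz)
  finally show ?thesis by (simp add: norm_scaleC c)
qed simp

instantiation complex :: complex_hilbert_space
begin
definition scaleC_complex :: "complex \<Rightarrow> complex \<Rightarrow> complex" where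
  "scaleC_complex c x = c * x"
definition cinner_complex :: "complex \<Rightarrow> complex \<Rightarrow> complex" where
  "cinner_complex x y = x * cnj y"
instance
  by standard (auto simp: scaleC_complex_def cinner_complex_def algebra_simps scaleR_conv_of_real
      inner_complex_def)
end


section \<open>Square summable families\<close>

lemma square_summable_add:
  fixes f g :: "'i \<Rightarrow> 'e::real_inner"
  assumes "(\<lambda>i. (norm (f i))\<^sup>2) summable_on UNIV" "(\<lambda>i. (norm (g i))\<^sup>2) summable_on UNIV"
  shows "(\<lambda>i. (norm (f i + g i))\<^sup>2) summable_on UNIV"
proof (rule summable_on_comparison_test)
  show "(\<lambda>i. 2 * (norm (f i))\<^sup>2 + 2 * (norm (g i))\<^sup>2) summable_on UNIV"
    by (intro summable_on_add summable_on_cmult_right assms)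
  show "(norm (f i + g i))\<^sup>2 \<le> 2 * (norm (f i))\<^sup>2 + 2 * (norm (g i))\<^sup>2" for i
    using zero_le_power2[of "norm (f i - g i)"]
    by (simp add: power2_norm_eq_inner inner_add_left inner_add_right inner_diff_left inner_diff_right)
qed simp

typedef (overloaded) ('i, 'e) l2 =
  "{f :: 'i \<Rightarrow> 'e::complex_hilbert_space. (\<lambda>i. (norm (f i))\<^sup>2) summable_on UNIV}"
  morphisms l2_coord Abs_l2
  by (rule exI[of _ "\<lambda>_. 0"]) simp

setup_lifting type_definition_l2

lemma l2_summable: "(\<lambda>i. (norm (l2_coord x i))\<^sup>2) summable_on UNIV"
  using l2_coord by blast

lemma l2_abs_summable_cinner:
  "(\<lambda>i. norm (cinner (l2_coord x i) (l2_coord y i))) summable_on UNIV"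
proof (rule summable_on_comparison_test)
  show "(\<lambda>i. (norm (l2_coord x i))\<^sup>2 + (norm (l2_coord y i))\<^sup>2) summable_on UNIV"
    by (intro summable_on_add l2_summable)
  show "cmod (cinner (l2_coord x i) (l2_coord y i)) \<le> (norm (l2_coord x i))\<^sup>2 + (norm (l2_coord y i))\<^sup>2" for i
    using norm_cinner_le[of "l2_coord x i" "l2_coord y i"]
      sum_squares_bound[of "norm (l2_coord x i)" "norm (l2_coord y i)"]
      mult_nonneg_nonneg[OF norm_ge_zero norm_ge_zero, of "l2_coord x i" "l2_coord y i"] by linarith
qed simp

lemma l2_summable_cinner:
  "(\<lambda>i. cinner (l2_coord x i) (l2_coord y i)) summable_on UNIV"
  by (rule abs_summable_summable[OF l2_abs_summable_cinner])

lemma l2_summable_inner: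
  "(\<lambda>i. inner (l2_coord x i) (l2_coord y i)) summable_on UNIV"
  unfolding inner_eq_Re_cinner by (rule summable_on_Re[OF l2_summable_cinner])

instantiation l2 :: (type, complex_hilbert_space) real_inner
begin
lift_definition zero_l2 :: "('a, 'b) l2" is "\<lambda>_. 0" by simp
lift_definition plus_l2 :: "('a, 'b) l2 \<Rightarrow> ('a, 'b) l2 \<Rightarrow> ('a, 'b) l2" is "\<lambda>f g i. f i + g i"
  using square_summable_add by blast
lift_definition uminus_l2 :: "('a, 'b) l2 \<Rightarrow> ('a, 'b) l2" is "\<lambda>f i. - f i" by simp
lift_definition minus_l2 :: "('a, 'b) l2 \<Rightarrow> ('a, 'b) l2 \<Rightarrow> ('a, 'b) l2" is "\<lambda>f g i. f i - g i"
proof -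
  fix f g :: "'a \<Rightarrow> 'b"
  assume "(\<lambda>i. (norm (f i))\<^sup>2) summable_on UNIV" "(\<lambda>i. (norm (g i))\<^sup>2) summable_on UNIV"
  then show "(\<lambda>i. (norm (f i - g i))\<^sup>2) summable_on UNIV"
    using square_summable_add[of f "\<lambda>i. - g i"] by simp
qed
lift_definition scaleR_l2 :: "real \<Rightarrow> ('a, 'b) l2 \<Rightarrow> ('a, 'b) l2" is "\<lambda>r f i. r *\<^sub>R f i"
  by (simp add: power_mult_distrib summable_on_cmult_right)
definition inner_l2 :: "('a, 'b) l2 \<Rightarrow> ('a, 'b) l2 \<Rightarrow> real" where
  "inner_l2 x y = (\<Sum>\<^sub>\<infinity>i. inner (l2_coord x i) (l2_coord y i))"
definition norm_l2 :: "('a, 'b) l2 \<Rightarrow> real" where "norm_l2 x = sqrt (inner x x)"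
definition sgn_l2 :: "('a, 'b) l2 \<Rightarrow> ('a, 'b) l2" where
  "sgn_l2 x = inverse (norm x) *\<^sub>R x"
definition dist_l2 :: "('a, 'b) l2 \<Rightarrow> ('a, 'b) l2 \<Rightarrow> real" where "dist_l2 x y = norm (x - y)"
definition uniformity_l2 :: "(('a, 'b) l2 \<times> ('a, 'b) l2) filter" where
  "uniformity_l2 = (INF e\<in>{0<..}. principal {(x, y). dist x y < e})"
definition open_l2 :: "('a, 'b) l2 set \<Rightarrow> bool" where
  "open_l2 U = (\<forall>x\<in>U. eventually (\<lambda>(x', y). x' = x \<longrightarrow> y \<in> U) uniformity)"

instance
proof
  fix x y z :: "('a, 'b) l2" and r s :: real
  note [simp] = plus_l2.rep_eq scaleR_l2.rep_eq
  show "x + y + z = x + (y + z)" "x + y = y + x" "0 + x = x" "- x + x = 0" "x - y = x + - y"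
    by (transfer, simp add: algebra_simps)+
  show "r *\<^sub>R (x + y) = r *\<^sub>R x + r *\<^sub>R y" "(r + s) *\<^sub>R x = r *\<^sub>R x + s *\<^sub>R x"
    "r *\<^sub>R s *\<^sub>R x = (r * s) *\<^sub>R x" "1 *\<^sub>R x = x"
    by (transfer, simp add: algebra_simps)+
  show "sgn x = inverse (norm x) *\<^sub>R x" by (rule sgn_l2_def)
  show "dist x y = norm (x - y)" by (rule dist_l2_def)
  show "uniformity = (INF e\<in>{0<..}. principal {(x :: ('a, 'b) l2, y). dist x y < e})"
    by (rule uniformity_l2_def)
  show "open U = (\<forall>x\<in>U. eventually (\<lambda>(x', y). x' = x \<longrightarrow> y \<in> U) uniformity)" for U :: "('a, 'b) l2 set"
    by (rule open_l2_def)
  show "inner x y = inner y x" by (simp add: inner_l2_def inner_commute)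
  show "inner (x + y) z = inner x z + inner y z"
    unfolding inner_l2_def by (simp add: inner_add_left infsum_add l2_summable_inner)
  show "inner (r *\<^sub>R x) y = r * inner x y"
    unfolding inner_l2_def by (simp add: infsum_cmult_right l2_summable_inner)
  show "0 \<le> inner x x" unfolding inner_l2_def by (simp add: infsum_nonneg)
  show "inner x x = 0 \<longleftrightarrow> x = 0"
  proof
    assume *: "inner x x = 0"
    have "inner (l2_coord x i) (l2_coord x i) = 0" for i
      by (rule nonneg_infsum_le_0D[where A = UNIV]) (use * l2_summable_inner[of x x] in \<open>auto simp: inner_l2_def\<close>)
    then show "x = 0" by (simp add: l2_coord_inject[symmetric] zero_l2.rep_eq fun_eq_iff)
  qed (simp add: inner_l2_def zero_l2.rep_eq)
  show "norm x = sqrt (inner x x)" by (rule norm_l2_def)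
qed
end

lemma l2_norm_eq: "(norm x)\<^sup>2 = (\<Sum>\<^sub>\<infinity>i. (norm (l2_coord x i))\<^sup>2)"
  by (simp add: power2_norm_eq_inner inner_l2_def)

lemma l2_sum_le_norm:
  assumes "finite S"
  shows "(\<Sum>i\<in>S. (norm (l2_coord x i))\<^sup>2) \<le> (norm x)\<^sup>2"
  unfolding l2_norm_eq by (rule finite_sum_le_infsum) (use assms l2_summable in auto)

lemma l2_coord_le_norm: "norm (l2_coord x i) \<le> norm x"
  using l2_sum_le_norm[of "{i}" x] by (simp add: power2_le_iff_abs_le)

instance l2 :: (type, complex_hilbert_space) complete_space
proof
  fix X :: "nat \<Rightarrow> ('a, 'b) l2"
  assume "Cauchy X"
  have "Cauchy (\<lambda>n. l2_coord (X n) i)" for i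
    unfolding Cauchy_def
  proof (intro allI impI)
    fix e :: real assume "0 < e"
    then obtain M where M: "\<And>m n. m \<ge> M \<Longrightarrow> n \<ge> M \<Longrightarrow> dist (X m) (X n) < e"
      using \<open>Cauchy X\<close> unfolding Cauchy_def by blast
    have "dist (l2_coord (X m) i) (l2_coord (X n) i) \<le> dist (X m) (X n)" for m n
      using l2_coord_le_norm[of "X m - X n" i] by (simp add: dist_norm minus_l2.rep_eq)
    then show "\<exists>M. \<forall>m\<ge>M. \<forall>n\<ge>M. dist (l2_coord (X m) i) (l2_coord (X n) i) < e"
      using M by (meson le_less_trans)
  qed
  then have "\<exists>l. (\<lambda>n. l2_coord (X n) i) \<longlonglongrightarrow> l" for i
    by (simp add: Cauchy_convergent convergentD)
  then obtain f where f: "\<And>i. (\<lambda>n. l2_coord (X n) i) \<longlonglongrightarrow> f i" by metis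
  have bound: "\<exists>M. \<forall>n\<ge>M. \<forall>S. finite S \<longrightarrow> (\<Sum>i\<in>S. (norm (l2_coord (X n) i - f i))\<^sup>2) \<le> e\<^sup>2"
    if "0 < e" for e
  proof -
    obtain M where M: "\<And>m n. m \<ge> M \<Longrightarrow> n \<ge> M \<Longrightarrow> dist (X m) (X n) < e"
      using \<open>Cauchy X\<close> \<open>0 < e\<close> unfolding Cauchy_def by blast
    have "(\<Sum>i\<in>S. (norm (l2_coord (X n) i - f i))\<^sup>2) \<le> e\<^sup>2" if "n \<ge> M" "finite S" for n S
    proof (rule tendsto_upperbound)
      show "(\<lambda>m. \<Sum>i\<in>S. (norm (l2_coord (X n) i - l2_coord (X m) i))\<^sup>2)
              \<longlonglongrightarrow> (\<Sum>i\<in>S. (norm (l2_coord (X n) i - f i))\<^sup>2)"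
        by (intro tendsto_sum tendsto_power tendsto_norm tendsto_diff tendsto_const f)
      have "(\<Sum>i\<in>S. (norm (l2_coord (X n) i - l2_coord (X m) i))\<^sup>2) \<le> e\<^sup>2" if "m \<ge> M" for m
      proof -
        have "(\<Sum>i\<in>S. (norm (l2_coord (X n) i - l2_coord (X m) i))\<^sup>2) \<le> (norm (X n - X m))\<^sup>2"
          using l2_sum_le_norm[of S "X n - X m"] \<open>finite S\<close> by (simp add: minus_l2.rep_eq)
        also have "\<dots> \<le> e\<^sup>2"
          using M[OF \<open>n \<ge> M\<close> \<open>m \<ge> M\<close>] by (intro power_mono) (auto simp: dist_norm)
        finally show ?thesis .
      qed
      then show "\<forall>\<^sub>F m in sequentially. (\<Sum>i\<in>S. (norm (l2_coord (X n) i - l2_coord (X m) i))\<^sup>2) \<le> e\<^sup>2"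
        by (auto simp: eventually_sequentially)
    qed simp
    then show ?thesis by blast
  qed
  obtain M where M: "\<And>S. finite S \<Longrightarrow> (\<Sum>i\<in>S. (norm (l2_coord (X M) i - f i))\<^sup>2) \<le> 1"
    using bound[of 1] by auto
  have "(\<lambda>i. (norm (l2_coord (X M) i - f i))\<^sup>2) summable_on UNIV"
    by (rule nonneg_bdd_above_summable_on) (use M in \<open>auto simp: bdd_above_def\<close>)
  then have "(\<lambda>i. (norm (l2_coord (X M) i + - (l2_coord (X M) i - f i)))\<^sup>2) summable_on UNIV"
    by (intro square_summable_add l2_summable) (simp add: norm_minus_commute)
  then have F: "l2_coord (Abs_l2 f) = f" by (simp add: Abs_l2_inverse)
  have "\<exists>M. \<forall>n\<ge>M. norm (X n - Abs_l2 f) \<le> e" if "0 < e" for e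
  proof -
    obtain M where M: "\<And>n S. n \<ge> M \<Longrightarrow> finite S \<Longrightarrow> (\<Sum>i\<in>S. (norm (l2_coord (X n) i - f i))\<^sup>2) \<le> e\<^sup>2"
      using bound[OF \<open>0 < e\<close>] by blast
    have "norm (X n - Abs_l2 f) \<le> e" if "n \<ge> M" for n
    proof -
      have "(norm (X n - Abs_l2 f))\<^sup>2 \<le> e\<^sup>2"
        unfolding l2_norm_eq
        by (rule infsum_le_finite_sums)
          (use M[OF that] l2_summable[of "X n - Abs_l2 f"] in \<open>auto simp: minus_l2.rep_eq F\<close>)
      then show ?thesis using \<open>0 < e\<close> by (simp add: power2_le_iff_abs_le)
    qed
    then show ?thesis by blast
  qed
  then have "X \<longlonglongrightarrow> Abs_l2 f"
    unfolding LIMSEQ_iff by (meson dense le_less_trans)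
  then show "convergent X" by (auto simp: convergent_def)
qed

instantiation l2 :: (type, complex_hilbert_space) complex_hilbert_space
begin
lift_definition scaleC_l2 :: "complex \<Rightarrow> ('a, 'b) l2 \<Rightarrow> ('a, 'b) l2" is "\<lambda>c f i. c *\<^sub>C f i"
  by (simp add: power_mult_distrib norm_scaleC summable_on_cmult_right)
definition cinner_l2 :: "('a, 'b) l2 \<Rightarrow> ('a, 'b) l2 \<Rightarrow> complex" where
  "cinner_l2 x y = (\<Sum>\<^sub>\<infinity>i. cinner (l2_coord x i) (l2_coord y i))"
instance
proof
  fix x y z :: "('a, 'b) l2" and r :: real and c d :: complex
  note [simp] = plus_l2.rep_eq scaleR_l2.rep_eq scaleC_l2.rep_eq
  show "c *\<^sub>C (x + y) = c *\<^sub>C x + c *\<^sub>C y" "(c + d) *\<^sub>C x = c *\<^sub>C x + d *\<^sub>C x"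
    "c *\<^sub>C d *\<^sub>C x = (c * d) *\<^sub>C x" "r *\<^sub>R x = complex_of_real r *\<^sub>C x"
    by (transfer, simp add: scaleC_add_right scaleC_add_left scaleC_scaleC scaleR_scaleC)+
  show "cinner x y = cnj (cinner y x)"
    unfolding cinner_l2_def infsum_cnj[symmetric] by (simp add: cinner_commute[symmetric])
  show "cinner (x + y) z = cinner x z + cinner y z"
    unfolding cinner_l2_def by (simp add: cinner_add_left infsum_add l2_summable_cinner)
  show "cinner (c *\<^sub>C x) y = c * cinner x y"
    unfolding cinner_l2_def by (simp add: cinner_scaleC_left infsum_cmult_right l2_summable_cinner)
  show "inner x y = Re (cinner x y)"
    unfolding cinner_l2_def inner_l2_def
    by (simp add: inner_eq_Re_cinner infsum_Re l2_summable_cinner)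
qed
end


section \<open>Hilbert space tensor products\<close>

text \<open>An orthonormal basis is a maximal orthonormal set.\<close>

definition orthonormal :: "'h::complex_hilbert_space set \<Rightarrow> bool" where
  "orthonormal B \<longleftrightarrow> (\<forall>x\<in>B. \<forall>y\<in>B. cinner x y = (if x = y then 1 else 0))"

definition orthonormal_basis :: "'h::complex_hilbert_space set \<Rightarrow> bool" where
  "orthonormal_basis B \<longleftrightarrow> orthonormal B \<and> (\<forall>x. (\<forall>b\<in>B. cinner x b = 0) \<longrightarrow> x = 0)"

lemma orthonormal_basis_exists: "\<exists>B :: 'h::complex_hilbert_space set. orthonormal_basis B"
proof -
  have "\<exists>M\<in>Collect orthonormal. \<forall>X\<in>Collect orthonormal. M \<subseteq> X \<longrightarrow> X = (M :: 'h set)"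
  proof (rule subset_Zorn')
    fix C :: "'h set set" assume C: "subset.chain (Collect orthonormal) C"
    show "\<Union>C \<in> Collect orthonormal"
      unfolding mem_Collect_eq orthonormal_def
    proof (intro ballI)
      fix x y assume "x \<in> \<Union>C" "y \<in> \<Union>C"
      then obtain Y where "Y \<in> C" "x \<in> Y" "y \<in> Y"
        using C unfolding subset_chain_def by blast
      moreover from \<open>Y \<in> C\<close> have "orthonormal Y"
        using C unfolding subset_chain_def by blast
      ultimately show "cinner x y = (if x = y then 1 else 0)" by (simp add: orthonormal_def)
    qed
  qed
  then obtain M :: "'h set" where M: "orthonormal M"
    and max: "\<And>X. orthonormal X \<Longrightarrow> M \<subseteq> X \<Longrightarrow> X = M" by blast
  have "x = 0" if x: "\<And>b. b \<in> M \<Longrightarrow> cinner x b = 0" for x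
  proof (rule ccontr)
    assume "x \<noteq> 0"
    define u where "u = complex_of_real (inverse (norm x)) *\<^sub>C x"
    have u: "cinner u b = 0" "cinner b u = 0" if "b \<in> M" for b
      using x[OF that] cinner_commute[of b x] by (auto simp: u_def cinner_scaleC_left cinner_scaleC_right)
    have "norm u = 1" using \<open>x \<noteq> 0\<close> by (simp add: u_def norm_scaleC norm_inverse)
    then have uu: "cinner u u = 1" by (simp add: cinner_self)
    have "orthonormal (insert u M)"
      using M u uu by (auto simp: orthonormal_def)
    then have "u \<in> M" using max[of "insert u M"] by blast
    then show False using u(1)[of u] uu by simp
  qed
  then show ?thesis using M unfolding orthonormal_basis_def by blast
qed

definition chosen_basis :: "'h::complex_hilbert_space set" where
  "chosen_basis = (SOME B. orthonormal_basis B)"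

lemma chosen_basis: "orthonormal_basis (chosen_basis :: 'h::complex_hilbert_space set)"
  unfolding chosen_basis_def by (rule someI_ex[OF orthonormal_basis_exists])

lemma orthonormal_sum_norm:
  assumes "orthonormal B" "finite F" "F \<subseteq> B"
  shows "(norm (\<Sum>b\<in>F. c b *\<^sub>C b))\<^sup>2 = (\<Sum>b\<in>F. (cmod (c b))\<^sup>2)"
proof -
  have "cinner (\<Sum>b\<in>F. c b *\<^sub>C b) (\<Sum>b\<in>F. c b *\<^sub>C b)
      = (\<Sum>a\<in>F. \<Sum>b\<in>F. if a = b then c a * cnj (c b) else 0)"
    unfolding cinner_sum_left
  proof (rule sum.cong[OF refl])
    fix a assume "a \<in> F"
    show "cinner (c a *\<^sub>C a) (\<Sum>b\<in>F. c b *\<^sub>C b) = (\<Sum>b\<in>F. if a = b then c a * cnj (c b) else 0)"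
      unfolding cinner_sum_right
      by (rule sum.cong[OF refl])
        (use \<open>a \<in> F\<close> assms in \<open>auto simp: orthonormal_def subset_iff cinner_scaleC_left cinner_scaleC_right\<close>)
  qed
  also have "\<dots> = (\<Sum>a\<in>F. c a * cnj (c a))" using \<open>finite F\<close> by simp
  also have "\<dots> = complex_of_real (\<Sum>a\<in>F. (cmod (c a))\<^sup>2)"
    unfolding of_real_sum complex_norm_square ..
  finally show ?thesis unfolding cinner_self of_real_eq_iff .
qed

lemma bessel_finite:
  assumes "orthonormal B" "finite F" "F \<subseteq> B"
  shows "(\<Sum>b\<in>F. (cmod (cinner h b))\<^sup>2) \<le> (norm h)\<^sup>2"
proof -
  define p where "p = (\<Sum>b\<in>F. cinner h b *\<^sub>C b)"
  have np: "(norm p)\<^sup>2 = (\<Sum>b\<in>F. (cmod (cinner h b))\<^sup>2)"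
    unfolding p_def by (rule orthonormal_sum_norm[OF assms])
  have "cinner h p = (\<Sum>b\<in>F. cnj (cinner h b) * cinner h b)"
    unfolding p_def cinner_sum_right cinner_scaleC_right ..
  also have "\<dots> = complex_of_real ((norm p)\<^sup>2)"
    unfolding np of_real_sum complex_norm_square by (simp add: mult.commute)
  finally have "inner h p = (norm p)\<^sup>2" by (simp add: inner_eq_Re_cinner)
  then have "(norm h)\<^sup>2 - (norm p)\<^sup>2 = (norm (h - p))\<^sup>2"
    by (simp add: power2_norm_eq_inner inner_diff_left inner_diff_right inner_commute)
  then show ?thesis using np zero_le_power2[of "norm (h - p)"] by linarith
qed

lemma bessel_summable:
  assumes "orthonormal B"
  shows "(\<lambda>b. (cmod (cinner h b))\<^sup>2) summable_on B"
  by (rule nonneg_bdd_above_summable_on)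
    (use bessel_finite[OF assms] in \<open>auto simp: bdd_above_def\<close>)

lemma orthonormal_series_summable:
  fixes B :: "'h::complex_hilbert_space set"
  assumes B: "orthonormal B" and c: "(\<lambda>b. (cmod (c b))\<^sup>2) summable_on B"
  shows "(\<lambda>b. c b *\<^sub>C b) summable_on B"
proof -
  obtain L where lim: "(sum (\<lambda>b. (cmod (c b))\<^sup>2) \<longlongrightarrow> L) (finite_subsets_at_top B)"
    using c unfolding has_sum_def summable_on_def by blast
  have "\<exists>P. eventually P (finite_subsets_at_top B) \<and>
      (\<forall>F F'. P F \<and> P F' \<longrightarrow> dist (\<Sum>b\<in>F. c b *\<^sub>C b) (\<Sum>b\<in>F'. c b *\<^sub>C b) < e)" if "e > 0" for e
  proof -
    have "\<forall>\<^sub>F F in finite_subsets_at_top B. dist (\<Sum>b\<in>F. (cmod (c b))\<^sup>2) L < e\<^sup>2 / 8"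
      by (rule tendstoD[OF lim]) (use that in simp)
    then obtain F0 where *: "finite F0 \<and> F0 \<subseteq> B \<and> (\<forall>F. finite F \<and> F0 \<subseteq> F \<and> F \<subseteq> B \<longrightarrow>
        dist (\<Sum>b\<in>F. (cmod (c b))\<^sup>2) L < e\<^sup>2 / 8)"
      unfolding eventually_finite_subsets_at_top ..
    then have F0: "finite F0" "F0 \<subseteq> B" by simp_all
    have close: "dist (\<Sum>b\<in>F. (cmod (c b))\<^sup>2) L < e\<^sup>2 / 8" if "finite F" "F0 \<subseteq> F" "F \<subseteq> B" for F
      using * that by simp
    have near: "dist (\<Sum>b\<in>F. c b *\<^sub>C b) (\<Sum>b\<in>F0. c b *\<^sub>C b) < e / 2"
      if F: "finite F" "F0 \<subseteq> F" "F \<subseteq> B" for F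
    proof -
      have "(\<Sum>b\<in>F. c b *\<^sub>C b) - (\<Sum>b\<in>F0. c b *\<^sub>C b) = (\<Sum>b\<in>F - F0. c b *\<^sub>C b)"
        using F by (simp add: sum_diff)
      then have "(dist (\<Sum>b\<in>F. c b *\<^sub>C b) (\<Sum>b\<in>F0. c b *\<^sub>C b))\<^sup>2 = (\<Sum>b\<in>F - F0. (cmod (c b))\<^sup>2)"
        unfolding dist_norm using F by (simp only:) (rule orthonormal_sum_norm[OF B], auto)
      also have "\<dots> = (\<Sum>b\<in>F. (cmod (c b))\<^sup>2) - (\<Sum>b\<in>F0. (cmod (c b))\<^sup>2)"
        using F by (simp add: sum_diff)
      also have "\<dots> < (e / 2)\<^sup>2"
        using close[OF F] close[OF F0(1) order.refl F0(2)]
        unfolding dist_real_def abs_less_iff power_divide by simp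
      finally show ?thesis
        by (rule power2_less_imp_less) (use \<open>e > 0\<close> in simp)
    qed
    show ?thesis
    proof (intro exI conjI allI impI)
      show "\<forall>\<^sub>F F in finite_subsets_at_top B. finite F \<and> F0 \<subseteq> F \<and> F \<subseteq> B"
        using F0 by (auto simp: eventually_finite_subsets_at_top)
    next
      fix F F' assume "(finite F \<and> F0 \<subseteq> F \<and> F \<subseteq> B) \<and> finite F' \<and> F0 \<subseteq> F' \<and> F' \<subseteq> B"
      then show "dist (\<Sum>b\<in>F. c b *\<^sub>C b) (\<Sum>b\<in>F'. c b *\<^sub>C b) < e"
        by (intro dist_triangle_half_l[OF near near]) auto
    qed
  qed
  then have "cauchy_filter (filtermap (sum (\<lambda>b. c b *\<^sub>C b)) (finite_subsets_at_top B))"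
    by (simp add: cauchy_filter_metric_filtermap)
  moreover have "complete (UNIV :: 'h set)"
    by (meson Cauchy_convergent UNIV_I complete_def convergent_def)
  ultimately obtain L' where "(sum (\<lambda>b. c b *\<^sub>C b) \<longlongrightarrow> L') (finite_subsets_at_top B)"
    using complete_uniform[where S = "UNIV :: 'h set"] by (force simp add: filterlim_def)
  then show ?thesis using summable_on_def has_sum_def by blast
qed

lemma bounded_linear_cinner_left: "bounded_linear (\<lambda>x. cinner x (y :: 'h::complex_hilbert_space))"
  by (rule bounded_linear_intro[where K = "norm y"])
    (auto simp: cinner_add_left scaleR_scaleC cinner_scaleC_left norm_cinner_le scaleC_complex_def)

lemma bounded_linear_cinner_right: "bounded_linear (\<lambda>y. cinner (x :: 'h::complex_hilbert_space) y)"
  by (rule bounded_linear_intro[where K = "norm x"])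
    (auto simp: cinner_add_right scaleR_scaleC cinner_scaleC_right scaleC_complex_def
      mult.commute[of _ "norm x"] norm_cinner_le)

lemma orthonormal_basis_expansion:
  assumes "orthonormal_basis B"
  shows "((\<lambda>b. cinner h b *\<^sub>C b) has_sum h) B"
proof -
  have B: "orthonormal B" using assms by (simp add: orthonormal_basis_def)
  have "(\<lambda>b. cinner h b *\<^sub>C b) summable_on B"
    by (rule orthonormal_series_summable[OF B bessel_summable[OF B]])
  then obtain s where s: "((\<lambda>b. cinner h b *\<^sub>C b) has_sum s) B" by (auto simp: summable_on_def)
  have "cinner s a = cinner h a" if "a \<in> B" for a
  proof -
    have "((\<lambda>b. cinner (cinner h b *\<^sub>C b) a) has_sum cinner s a) B"
      using has_sum_bounded_linear[OF bounded_linear_cinner_left s] by (simp add: o_def)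
    moreover have "((\<lambda>b. cinner (cinner h b *\<^sub>C b) a) has_sum cinner h a) B"
      by (rule has_sum_finite_neutralI[where B = "{a}"])
        (use B that in \<open>auto simp: orthonormal_def cinner_scaleC_left\<close>)
    ultimately show ?thesis by (rule has_sum_unique)
  qed
  then have "h - s = 0"
    using assms unfolding orthonormal_basis_def by (metis cinner_diff_left right_minus_eq)
  with s show ?thesis by simp
qed

lemma parseval:
  assumes "orthonormal_basis B"
  shows "((\<lambda>b. cinner h b * cnj (cinner k b)) has_sum cinner h k) B"
proof -
  have "((\<lambda>b. cinner (cinner h b *\<^sub>C b) k) has_sum cinner h k) B"
    using has_sum_bounded_linear[OF bounded_linear_cinner_left orthonormal_basis_expansion[OF assms]]
    by (simp add: o_def)
  then show ?thesis by (simp add: cinner_scaleC_left cinner_commute[symmetric])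
qed

text \<open>The Hilbert space tensor product of \<open>'h\<close> and \<open>'e\<close> is modelled by the square summable families
  in \<open>'e\<close> indexed by an orthonormal basis of \<open>'h\<close>; the simple tensor of \<open>h\<close> and \<open>e\<close> is the family
  with entries \<open>cinner h b *\<^sub>C e\<close>. The lemmas \<open>cinner_tensor\<close> and \<open>tensor_dense\<close> below are the
  defining properties of the Hilbert space tensor product, which determine it up to a unique
  unitary operator compatible with simple tensors. In particular the choice of the basis is
  irrelevant.\<close>

typedef (overloaded) ('h, 'e) htensor =
  "{f :: ('h::complex_hilbert_space, 'e::complex_hilbert_space) l2.
      \<forall>b. b \<notin> chosen_basis \<longrightarrow> l2_coord f b = 0}"
  morphisms htensor_l2 Abs_htensor
  by (rule exI[of _ 0]) (simp add: zero_l2.rep_eq)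

setup_lifting type_definition_htensor

instantiation htensor :: (complex_hilbert_space, complex_hilbert_space) real_inner
begin
lift_definition zero_htensor :: "('a, 'b) htensor" is 0 by (simp add: zero_l2.rep_eq)
lift_definition plus_htensor :: "('a, 'b) htensor \<Rightarrow> ('a, 'b) htensor \<Rightarrow> ('a, 'b) htensor" is "(+)"
  by (simp add: plus_l2.rep_eq)
lift_definition uminus_htensor :: "('a, 'b) htensor \<Rightarrow> ('a, 'b) htensor" is uminus
  by (simp add: uminus_l2.rep_eq)
lift_definition minus_htensor :: "('a, 'b) htensor \<Rightarrow> ('a, 'b) htensor \<Rightarrow> ('a, 'b) htensor" is "(-)"
  by (simp add: minus_l2.rep_eq)
lift_definition scaleR_htensor :: "real \<Rightarrow> ('a, 'b) htensor \<Rightarrow> ('a, 'b) htensor" is scaleR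
  by (simp add: scaleR_l2.rep_eq)
lift_definition inner_htensor :: "('a, 'b) htensor \<Rightarrow> ('a, 'b) htensor \<Rightarrow> real" is inner .
lift_definition norm_htensor :: "('a, 'b) htensor \<Rightarrow> real" is norm .
lift_definition sgn_htensor :: "('a, 'b) htensor \<Rightarrow> ('a, 'b) htensor" is sgn
  by (simp add: sgn_div_norm scaleR_l2.rep_eq)
lift_definition dist_htensor :: "('a, 'b) htensor \<Rightarrow> ('a, 'b) htensor \<Rightarrow> real" is dist .
definition uniformity_htensor :: "(('a, 'b) htensor \<times> ('a, 'b) htensor) filter" where
  "uniformity_htensor = (INF e\<in>{0<..}. principal {(x, y). dist x y < e})"
definition open_htensor :: "('a, 'b) htensor set \<Rightarrow> bool" where
  "open_htensor U = (\<forall>x\<in>U. eventually (\<lambda>(x', y). x' = x \<longrightarrow> y \<in> U) uniformity)"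
instance
proof
  fix x y z :: "('a, 'b) htensor" and r s :: real
  show "x + y + z = x + (y + z)" "x + y = y + x" "0 + x = x" "- x + x = 0" "x - y = x + - y"
    by (transfer, simp add: algebra_simps)+
  show "r *\<^sub>R (x + y) = r *\<^sub>R x + r *\<^sub>R y" "(r + s) *\<^sub>R x = r *\<^sub>R x + s *\<^sub>R x"
    "r *\<^sub>R s *\<^sub>R x = (r * s) *\<^sub>R x" "1 *\<^sub>R x = x"
    by (transfer, simp add: algebra_simps)+
  show "sgn x = inverse (norm x) *\<^sub>R x" by transfer (rule sgn_div_norm)
  show "dist x y = norm (x - y)" by transfer (rule dist_norm)
  show "uniformity = (INF e\<in>{0<..}. principal {(x :: ('a, 'b) htensor, y). dist x y < e})"
    by (rule uniformity_htensor_def)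
  show "open U = (\<forall>x\<in>U. eventually (\<lambda>(x', y). x' = x \<longrightarrow> y \<in> U) uniformity)" for U :: "('a, 'b) htensor set"
    by (rule open_htensor_def)
  show "inner x y = inner y x" by transfer (rule inner_commute)
  show "inner (x + y) z = inner x z + inner y z" by transfer (rule inner_add_left)
  show "inner (r *\<^sub>R x) y = r * inner x y" by transfer (rule inner_scaleR_left)
  show "0 \<le> inner x x" by transfer (rule inner_ge_zero)
  show "inner x x = 0 \<longleftrightarrow> x = 0" by transfer (rule inner_eq_zero_iff)
  show "norm x = sqrt (inner x x)" by transfer (rule norm_eq_sqrt_inner)
qed
end

instance htensor :: (complex_hilbert_space, complex_hilbert_space) complete_space
proof
  fix X :: "nat \<Rightarrow> ('a, 'b) htensor"
  assume "Cauchy X"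
  then have "Cauchy (\<lambda>n. htensor_l2 (X n))"
    by (simp add: Cauchy_def dist_htensor.rep_eq)
  then obtain f where f: "(\<lambda>n. htensor_l2 (X n)) \<longlonglongrightarrow> f"
    by (auto simp: Cauchy_convergent_iff convergent_def)
  have "l2_coord f b = 0" if "b \<notin> chosen_basis" for b
  proof -
    have "norm (l2_coord f b) \<le> norm (f - htensor_l2 (X n))" for n
      using l2_coord_le_norm[of "f - htensor_l2 (X n)" b] htensor_l2[of "X n"] that
      by (simp add: minus_l2.rep_eq)
    moreover have "(\<lambda>n. norm (f - htensor_l2 (X n))) \<longlonglongrightarrow> norm (f - f)"
      by (intro tendsto_intros f)
    ultimately have "norm (l2_coord f b) \<le> norm (f - f)"
      by (intro tendsto_lowerbound[where F = sequentially]) auto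
    then show ?thesis by simp
  qed
  then have "htensor_l2 (Abs_htensor f) = f" by (simp add: Abs_htensor_inverse)
  then have "X \<longlonglongrightarrow> Abs_htensor f"
    using f by (simp add: lim_sequentially dist_htensor.rep_eq)
  then show "convergent X" by (auto simp: convergent_def)
qed

instantiation htensor :: (complex_hilbert_space, complex_hilbert_space) complex_hilbert_space
begin
lift_definition scaleC_htensor :: "complex \<Rightarrow> ('a, 'b) htensor \<Rightarrow> ('a, 'b) htensor" is scaleC
  by (simp add: scaleC_l2.rep_eq)
lift_definition cinner_htensor :: "('a, 'b) htensor \<Rightarrow> ('a, 'b) htensor \<Rightarrow> complex" is cinner .
instance
proof
  fix x y z :: "('a, 'b) htensor" and r :: real and c d :: complex
  show "c *\<^sub>C (x + y) = c *\<^sub>C x + c *\<^sub>C y" by transfer (rule scaleC_add_right)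
  show "(c + d) *\<^sub>C x = c *\<^sub>C x + d *\<^sub>C x" by transfer (rule scaleC_add_left)
  show "c *\<^sub>C d *\<^sub>C x = (c * d) *\<^sub>C x" by transfer (rule scaleC_scaleC)
  show "r *\<^sub>R x = complex_of_real r *\<^sub>C x" by transfer (rule scaleR_scaleC)
  show "cinner x y = cnj (cinner y x)" by transfer (rule cinner_commute)
  show "cinner (x + y) z = cinner x z + cinner y z" by transfer (rule cinner_add_left)
  show "cinner (c *\<^sub>C x) y = c * cinner x y" by transfer (rule cinner_scaleC_left)
  show "inner x y = Re (cinner x y)" by transfer (rule inner_eq_Re_cinner)
qed
end

lemma tensor_square_summable:
  "(\<lambda>b. (norm (if b \<in> chosen_basis then cinner h b *\<^sub>C e else 0))\<^sup>2) summable_on UNIV"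
proof -
  have "(\<lambda>b. (cmod (cinner h b))\<^sup>2 * (norm e)\<^sup>2) summable_on chosen_basis"
    by (intro summable_on_cmult_left bessel_summable)
      (use chosen_basis in \<open>unfold orthonormal_basis_def, blast\<close>)
  then show ?thesis
    by (rule summable_on_cong_neutral[THEN iffD1, rotated -1]) (auto simp: norm_scaleC power_mult_distrib)
qed

lift_definition tensor :: "'h \<Rightarrow> 'e \<Rightarrow> ('h::complex_hilbert_space, 'e::complex_hilbert_space) htensor"
  is "\<lambda>h e. Abs_l2 (\<lambda>b. if b \<in> chosen_basis then cinner h b *\<^sub>C e else 0)"
  by (subst Abs_l2_inverse) (use tensor_square_summable in auto)

lemma tensor_coord:
  "l2_coord (htensor_l2 (tensor h e)) b = (if b \<in> chosen_basis then cinner h b *\<^sub>C e else 0)"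
  unfolding tensor.rep_eq by (subst Abs_l2_inverse) (use tensor_square_summable in auto)

lemma cinner_tensor: "cinner (tensor h e) (tensor h' e') = cinner h h' * cinner e e'"
proof -
  have "((\<lambda>b. cinner h b * cnj (cinner h' b) * cinner e e') has_sum cinner h h' * cinner e e') chosen_basis"
    by (intro has_sum_cmult_left parseval chosen_basis)
  then have "((\<lambda>b. cinner (l2_coord (htensor_l2 (tensor h e)) b) (l2_coord (htensor_l2 (tensor h' e')) b))
      has_sum cinner h h' * cinner e e') UNIV"
    by (rule has_sum_cong_neutral[THEN iffD1, rotated -1])
      (auto simp: tensor_coord cinner_scaleC_left cinner_scaleC_right)
  then show ?thesis
    unfolding cinner_htensor.rep_eq cinner_l2_def by (rule infsumI)
qed

lemma htensor_coord_eq_cinner: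
  assumes "b \<in> chosen_basis"
  shows "cinner x (tensor b e) = cinner (l2_coord (htensor_l2 x) b) e"
proof -
  have "((\<lambda>a. cinner (l2_coord (htensor_l2 x) a) (l2_coord (htensor_l2 (tensor b e)) a))
      has_sum cinner (l2_coord (htensor_l2 x) b) e) UNIV"
    by (rule has_sum_finite_neutralI[where B = "{b}"])
      (use assms chosen_basis in \<open>auto simp: tensor_coord orthonormal_basis_def orthonormal_def
        cinner_scaleC_right\<close>)
  then show ?thesis unfolding cinner_htensor.rep_eq cinner_l2_def by (rule infsumI)
qed

lemma cinner_tensor_expansion:
  assumes "finite S" "S \<subseteq> chosen_basis"
  shows "cinner x (\<Sum>b\<in>S. tensor b (l2_coord (htensor_l2 x) b))
    = complex_of_real (\<Sum>b\<in>S. (norm (l2_coord (htensor_l2 x) b))\<^sup>2)"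
  unfolding cinner_sum_right of_real_sum
  by (rule sum.cong) (use assms in \<open>auto simp: htensor_coord_eq_cinner cinner_self subset_iff\<close>)

lemma norm_tensor_expansion:
  fixes x :: "('h::complex_hilbert_space, 'e::complex_hilbert_space) htensor"
  assumes S: "finite S" "S \<subseteq> chosen_basis"
  shows "(norm (\<Sum>b\<in>S. tensor b (l2_coord (htensor_l2 x) b)))\<^sup>2
    = (\<Sum>b\<in>S. (norm (l2_coord (htensor_l2 x) b))\<^sup>2)"
proof -
  have "cinner (\<Sum>a\<in>S. tensor a (l2_coord (htensor_l2 x) a)) (\<Sum>b\<in>S. tensor b (l2_coord (htensor_l2 x) b))
      = (\<Sum>a\<in>S. \<Sum>b\<in>S. if a = b then complex_of_real ((norm (l2_coord (htensor_l2 x) a))\<^sup>2) else 0)"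
    unfolding cinner_sum_left
  proof (rule sum.cong[OF refl])
    fix a assume "a \<in> S"
    show "cinner (tensor a (l2_coord (htensor_l2 x) a)) (\<Sum>b\<in>S. tensor b (l2_coord (htensor_l2 x) b))
      = (\<Sum>b\<in>S. if a = b then complex_of_real ((norm (l2_coord (htensor_l2 x) a))\<^sup>2) else 0)"
      unfolding cinner_sum_right
    proof (rule sum.cong[OF refl])
      fix b assume "b \<in> S"
      have "cinner a b = (if a = b then 1 else 0)"
        using chosen_basis[where 'h = 'h, unfolded orthonormal_basis_def orthonormal_def, THEN conjunct1]
          subsetD[OF S(2) \<open>a \<in> S\<close>] subsetD[OF S(2) \<open>b \<in> S\<close>] by simp
      then show "cinner (tensor a (l2_coord (htensor_l2 x) a)) (tensor b (l2_coord (htensor_l2 x) b))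
          = (if a = b then complex_of_real ((norm (l2_coord (htensor_l2 x) a))\<^sup>2) else 0)"
        by (simp add: cinner_tensor cinner_self)
    qed
  qed
  also have "\<dots> = complex_of_real (\<Sum>a\<in>S. (norm (l2_coord (htensor_l2 x) a))\<^sup>2)"
    using S by simp
  finally show ?thesis unfolding cinner_self of_real_eq_iff .
qed

lemma tensor_dense:
  "closure (module.span scaleC {tensor h e | h e. True}) =
    (UNIV :: ('h::complex_hilbert_space, 'e::complex_hilbert_space) htensor set)"
proof (intro equalityI subsetI UNIV_I)
  fix x :: "('h, 'e) htensor"
  interpret module "scaleC :: complex \<Rightarrow> ('h, 'e) htensor \<Rightarrow> ('h, 'e) htensor" by (rule module_scaleC)
  let ?c = "l2_coord (htensor_l2 x)"
  have "((\<lambda>b. (norm (?c b))\<^sup>2) has_sum (norm x)\<^sup>2) UNIV"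
    unfolding norm_htensor.rep_eq l2_norm_eq by (rule has_sum_infsum[OF l2_summable])
  then have sum: "((\<lambda>b. (norm (?c b))\<^sup>2) has_sum (norm x)\<^sup>2) chosen_basis"
    by (rule has_sum_cong_neutral[THEN iffD1, rotated -1]) (use htensor_l2[of x] in auto)
  show "x \<in> closure (span {tensor h e | h e. True})"
    unfolding closure_approachable
  proof (intro allI impI)
    fix e :: real assume "0 < e"
    have "\<forall>\<^sub>F S in finite_subsets_at_top chosen_basis. dist (\<Sum>b\<in>S. (norm (?c b))\<^sup>2) ((norm x)\<^sup>2) < e\<^sup>2"
      by (rule tendstoD[OF sum[unfolded has_sum_def]]) (use \<open>0 < e\<close> in simp)
    then obtain S where *: "finite S \<and> S \<subseteq> chosen_basis \<and> (\<forall>T. finite T \<and> S \<subseteq> T \<and> T \<subseteq> chosen_basis \<longrightarrow>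
        dist (\<Sum>b\<in>T. (norm (?c b))\<^sup>2) ((norm x)\<^sup>2) < e\<^sup>2)"
      unfolding eventually_finite_subsets_at_top ..
    then have S: "finite S" "S \<subseteq> chosen_basis"
      and close: "dist (\<Sum>b\<in>S. (norm (?c b))\<^sup>2) ((norm x)\<^sup>2) < e\<^sup>2" by simp_all
    define y where "y = (\<Sum>b\<in>S. tensor b (?c b))"
    have "y \<in> span {tensor h e | h e. True}"
      unfolding y_def by (intro span_sum span_base) blast
    moreover have "dist y x < e"
    proof -
      have "inner x y = (\<Sum>b\<in>S. (norm (?c b))\<^sup>2)"
        unfolding inner_eq_Re_cinner y_def cinner_tensor_expansion[OF S] by simp
      moreover have "(norm y)\<^sup>2 = (\<Sum>b\<in>S. (norm (?c b))\<^sup>2)"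
        unfolding y_def by (rule norm_tensor_expansion[OF S])
      ultimately have "(norm (y - x))\<^sup>2 = (norm x)\<^sup>2 - (\<Sum>b\<in>S. (norm (?c b))\<^sup>2)"
        by (simp add: power2_norm_eq_inner inner_diff_left inner_diff_right inner_commute)
      also have "\<dots> < e\<^sup>2" using close by (simp add: dist_real_def abs_less_iff)
      finally show ?thesis unfolding dist_norm by (rule power2_less_imp_less) (use \<open>0 < e\<close> in simp)
    qed
    ultimately show "\<exists>y\<in>span {tensor h e | h e. True}. dist y x < e" by blast
  qed
qed


section \<open>Bounded operators\<close>

text \<open>The library type of bounded operators consists of the real linear ones; \<open>bounded_ops\<close> singles
  out the complex linear ones. Addition, composition, operator norm and norm convergence are those of
  the library type.\<close>

definition bounded_ops :: "('a::complex_hilbert_space \<Rightarrow>\<^sub>L 'b::complex_hilbert_space) set" where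
  "bounded_ops = {T :: 'a \<Rightarrow>\<^sub>L 'b. \<forall>c x. T (c *\<^sub>C x) = c *\<^sub>C T x}"

definition adj :: "('a::complex_hilbert_space \<Rightarrow>\<^sub>L 'b::complex_hilbert_space) \<Rightarrow> 'b \<Rightarrow>\<^sub>L 'a" where
  "adj T = (THE S :: 'b \<Rightarrow>\<^sub>L 'a. \<forall>x y. cinner (T x) y = cinner x (S y))"

definition re_op :: "('a::complex_hilbert_space \<Rightarrow>\<^sub>L 'a) \<Rightarrow> 'a \<Rightarrow>\<^sub>L 'a" where
  "re_op T = (1/2) *\<^sub>R (T + adj T)"

definition op_le :: "('a::complex_hilbert_space \<Rightarrow>\<^sub>L 'a) \<Rightarrow> ('a \<Rightarrow>\<^sub>L 'a) \<Rightarrow> bool" where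
  "op_le S T \<longleftrightarrow> (\<forall>x. Im (cinner ((T - S) x) x) = 0 \<and> 0 \<le> Re (cinner ((T - S) x) x))"

text \<open>By \<open>tensor_dense\<close> at most one operator acts in this way on simple tensors; for complex linear \<open>X\<close> and \<open>A\<close> it is
  the usual tensor product of operators.\<close>

definition op_tensor ::
  "('h::complex_hilbert_space \<Rightarrow>\<^sub>L 'k::complex_hilbert_space) \<Rightarrow>
   ('e::complex_hilbert_space \<Rightarrow>\<^sub>L 'g::complex_hilbert_space) \<Rightarrow>
   ('h, 'e) htensor \<Rightarrow>\<^sub>L ('k, 'g) htensor" where
  "op_tensor X A = (THE T :: ('h, 'e) htensor \<Rightarrow>\<^sub>L ('k, 'g) htensor.
    \<forall>h e. T (tensor h e) = tensor (X h) (A e))"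

text \<open>Families of operators are summed unconditionally in the strong operator topology; for a finite
  index set this is the ordinary sum.\<close>

definition strongly_summable ::
  "('i \<Rightarrow> 'a::complex_hilbert_space \<Rightarrow>\<^sub>L 'b::complex_hilbert_space) \<Rightarrow> 'i set \<Rightarrow> bool" where
  "strongly_summable f I \<longleftrightarrow> (\<exists>T :: 'a \<Rightarrow>\<^sub>L 'b. \<forall>x. ((\<lambda>i. f i x) has_sum T x) I)"

definition strong_sum ::
  "('i \<Rightarrow> 'a::complex_hilbert_space \<Rightarrow>\<^sub>L 'b::complex_hilbert_space) \<Rightarrow> 'i set \<Rightarrow> 'a \<Rightarrow>\<^sub>L 'b" where
  "strong_sum f I = (THE T :: 'a \<Rightarrow>\<^sub>L 'b. \<forall>x. ((\<lambda>i. f i x) has_sum T x) I)"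

definition infinite_dimensional :: "'a::complex_hilbert_space itself \<Rightarrow> bool" where
  "infinite_dimensional _ \<longleftrightarrow> \<not> (\<exists>B :: 'a set. finite B \<and> module.span scaleC B = UNIV)"


section \<open>Free holomorphic functions\<close>

text \<open>The generators of the free semigroup are indexed by a countable type \<open>'n\<close>, finite or infinite,
  so that \<open>n\<close> is its cardinality; elements of the free semigroup are lists over \<open>'n\<close>. For infinite
  \<open>'n\<close>, the tuples considered are those whose row operator is bounded, that is, for which the sum of
  \<open>X i o\<^sub>L adj (X i)\<close> converges strongly.\<close>

definition row_norm :: "('n::countable \<Rightarrow> 'h::complex_hilbert_space \<Rightarrow>\<^sub>L 'h) \<Rightarrow> real" where
  "row_norm X = sqrt (norm (strong_sum (\<lambda>i. X i o\<^sub>L adj (X i)) UNIV))"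

definition row_ball :: "('n::countable \<Rightarrow> 'h::complex_hilbert_space \<Rightarrow>\<^sub>L 'h) set" where
  "row_ball = {X. (\<forall>i. X i \<in> bounded_ops) \<and> strongly_summable (\<lambda>i. X i o\<^sub>L adj (X i)) UNIV
    \<and> row_norm X < 1}"

primrec word_op :: "('n \<Rightarrow> 'h::complex_hilbert_space \<Rightarrow>\<^sub>L 'h) \<Rightarrow> 'n list \<Rightarrow> 'h \<Rightarrow>\<^sub>L 'h" where
  "word_op X [] = id_blinfun"
| "word_op X (i # \<alpha>) = X i o\<^sub>L word_op X \<alpha>"

text \<open>A free holomorphic function is represented by its family of coefficients \<open>A\<close>, and
  \<open>fh_eval A X\<close> is its value at \<open>X\<close>, for \<open>X\<close> acting on any Hilbert space. The type argument of
  \<open>free_holomorphic\<close>, \<open>fh_bounded\<close>, \<open>fh_norm\<close> and \<open>radial_infimum_property\<close> is the Hilbert space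
  on which the tuples of the ball act.\<close>

definition fh_summand ::
  "('n list \<Rightarrow> 'e::complex_hilbert_space \<Rightarrow>\<^sub>L 'g::complex_hilbert_space) \<Rightarrow>
   ('n \<Rightarrow> 'h::complex_hilbert_space \<Rightarrow>\<^sub>L 'h) \<Rightarrow> 'n list \<Rightarrow> ('h, 'e) htensor \<Rightarrow>\<^sub>L ('h, 'g) htensor" where
  "fh_summand A X \<alpha> = op_tensor (word_op X \<alpha>) (A \<alpha>)"

definition fh_homogeneous ::
  "('n list \<Rightarrow> 'e::complex_hilbert_space \<Rightarrow>\<^sub>L 'g::complex_hilbert_space) \<Rightarrow>
   ('n \<Rightarrow> 'h::complex_hilbert_space \<Rightarrow>\<^sub>L 'h) \<Rightarrow> nat \<Rightarrow> ('h, 'e) htensor \<Rightarrow>\<^sub>L ('h, 'g) htensor" where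
  "fh_homogeneous A X k = strong_sum (fh_summand A X) {\<alpha>. length \<alpha> = k}"

definition fh_eval ::
  "('n list \<Rightarrow> 'e::complex_hilbert_space \<Rightarrow>\<^sub>L 'g::complex_hilbert_space) \<Rightarrow>
   ('n \<Rightarrow> 'h::complex_hilbert_space \<Rightarrow>\<^sub>L 'h) \<Rightarrow> ('h, 'e) htensor \<Rightarrow>\<^sub>L ('h, 'g) htensor" where
  "fh_eval A X = (\<Sum>k. fh_homogeneous A X k)"

definition free_holomorphic ::
  "'h::complex_hilbert_space itself \<Rightarrow>
   ('n::countable list \<Rightarrow> 'e::complex_hilbert_space \<Rightarrow>\<^sub>L 'g::complex_hilbert_space) \<Rightarrow> bool" where
  "free_holomorphic _ A \<longleftrightarrow> (\<forall>\<alpha>. A \<alpha> \<in> bounded_ops) \<and>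
    (\<forall>X \<in> (row_ball :: ('n \<Rightarrow> 'h \<Rightarrow>\<^sub>L 'h) set).
      (\<forall>k. strongly_summable (fh_summand A X) {\<alpha>. length \<alpha> = k}) \<and> summable (fh_homogeneous A X))"

definition fh_bounded ::
  "'h::complex_hilbert_space itself \<Rightarrow>
   ('n::countable list \<Rightarrow> 'e::complex_hilbert_space \<Rightarrow>\<^sub>L 'g::complex_hilbert_space) \<Rightarrow> bool" where
  "fh_bounded _ A \<longleftrightarrow> bdd_above ((\<lambda>X. norm (fh_eval A X)) ` (row_ball :: ('n \<Rightarrow> 'h \<Rightarrow>\<^sub>L 'h) set))"

definition fh_norm ::
  "'h::complex_hilbert_space itself \<Rightarrow>
   ('n::countable list \<Rightarrow> 'e::complex_hilbert_space \<Rightarrow>\<^sub>L 'g::complex_hilbert_space) \<Rightarrow> real" where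
  "fh_norm _ A = (SUP X \<in> (row_ball :: ('n \<Rightarrow> 'h \<Rightarrow>\<^sub>L 'h) set). norm (fh_eval A X))"


section \<open>The full Fock space\<close>

text \<open>The full Fock space is identified with the square summable families over the free semigroup by
  means of its orthonormal basis of the vectors \<open>e\<^sub>i\<^sub>1 \<otimes> \<dots> \<otimes> e\<^sub>i\<^sub>k\<close>. In these coordinates
  tensoring with \<open>e\<^sub>i\<close> on the left moves the coordinate of a word \<open>v\<close> to the word \<open>i # v\<close>.\<close>

type_synonym 'n fock = "('n list, complex) l2"

definition shift_coord :: "'n \<Rightarrow> ('n list \<Rightarrow> complex) \<Rightarrow> 'n list \<Rightarrow> complex" where
  "shift_coord i f w = (case w of [] \<Rightarrow> 0 | j # v \<Rightarrow> if j = i then f v else 0)"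

lemma shift_coord_has_sum:
  assumes "((\<lambda>v. (norm (f v))\<^sup>2) has_sum s) UNIV"
  shows "((\<lambda>w. (norm (shift_coord i f w))\<^sup>2) has_sum s) UNIV"
proof -
  have "((\<lambda>w. (norm (shift_coord i f w))\<^sup>2) has_sum s) ((#) i ` UNIV)"
    by (subst has_sum_reindex) (use assms in \<open>auto simp: o_def shift_coord_def\<close>)
  then show ?thesis
    by (rule has_sum_cong_neutral[THEN iffD1, rotated -1])
      (auto simp: shift_coord_def split: list.splits if_splits)
qed

lift_definition creation_map :: "'n \<Rightarrow> 'n fock \<Rightarrow> 'n fock" is shift_coord
  unfolding summable_on_def mem_Collect_eq by (elim exE) (rule exI, erule shift_coord_has_sum)

lemma norm_creation_map: "norm (creation_map i \<phi>) = norm \<phi>"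
proof -
  have "((\<lambda>w. (norm (l2_coord (creation_map i \<phi>) w))\<^sup>2) has_sum (norm \<phi>)\<^sup>2) UNIV"
    unfolding creation_map.rep_eq l2_norm_eq
    by (intro shift_coord_has_sum has_sum_infsum l2_summable)
  then have "(norm (creation_map i \<phi>))\<^sup>2 = (norm \<phi>)\<^sup>2"
    unfolding l2_norm_eq[of "creation_map i \<phi>"] by (rule infsumI)
  then show ?thesis by (simp add: power2_eq_iff_nonneg)
qed

lift_definition creation :: "'n \<Rightarrow> 'n fock \<Rightarrow>\<^sub>L 'n fock" is creation_map
proof (rule bounded_linear_intro[where K = 1])
  fix i and \<phi> \<psi> :: "'n fock" and r :: real
  show "creation_map i (\<phi> + \<psi>) = creation_map i \<phi> + creation_map i \<psi>"
    by transfer (auto simp: shift_coord_def fun_eq_iff split: list.splits)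
  show "creation_map i (r *\<^sub>R \<phi>) = r *\<^sub>R creation_map i \<phi>"
    by transfer (auto simp: shift_coord_def fun_eq_iff split: list.splits)
  show "norm (creation_map i \<phi>) \<le> norm \<phi> * 1" by (simp add: norm_creation_map)
qed

text \<open>The infimum and the lower limit are taken in the extended reals.\<close>

definition radial_infimum_property ::
  "'h::complex_hilbert_space itself \<Rightarrow>
   ('n::countable list \<Rightarrow> 'e::complex_hilbert_space \<Rightarrow>\<^sub>L 'g::complex_hilbert_space) \<Rightarrow> bool" where
  "radial_infimum_property H A \<longleftrightarrow> fh_bounded H A \<and>
    Liminf (at_left (1::real))
      (\<lambda>r. INF x \<in> {x :: ('n fock, 'e) htensor. norm x = 1}.
         ereal (norm (fh_eval A (\<lambda>i. r *\<^sub>R creation i) x)))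
    = ereal (fh_norm H A)"

end

theory Submission
  imports Defs "HOL-Complex_Analysis.Conformal_Mappings"
begin

text \<open>Put \<open>N = 2 - F\<close>. Since the real part of \<open>F\<close> is at most \<open>1\<close>, \<open>norm (F(X) y) \<le> norm (N(X) y)\<close>
  for every vector \<open>y\<close>, and \<open>N(X)\<close> is bounded below by \<open>1\<close> and onto. The heart of the matter is the
  estimate \<open>norm (\<Gamma>(X) y) \<le> norm (N(X) y)\<close>, that is, the contractivity of \<open>\<Gamma> N\<^sup>-\<^sup>1\<close>. It gives
  \<open>norm (F y) = norm (\<Theta> (\<Gamma> y)) \<le> norm \<Theta> * norm (2 y - F y) \<le> norm \<Theta> * (2 norm y + norm (F y))\<close>
  at \<open>X\<close>, and the claim follows by solving for \<open>norm (F y)\<close>, provided that \<open>norm (\<Theta>(X)) < 1\<close>.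

  At the scaled left creation operators \<open>rS\<close> the estimate for \<open>\<Gamma> N\<^sup>-\<^sup>1\<close> is almost immediate: by the
  radial infimum property \<open>\<Theta>(rS)\<close> is bounded below by some \<open>c\<close> close to \<open>1\<close>, hence
  \<open>c * norm (\<Gamma>(rS) w) \<le> norm (\<Theta>(rS) (\<Gamma>(rS) w)) = norm (F(rS) w) \<le> norm (N(rS) w)\<close>. The
  properties of \<open>F\<close>, \<open>\<Theta>\<close> and \<open>\<Gamma>\<close> used here hold on the Fock space because that space is unitarily
  equivalent to the given one (\<open>fock_unitary\<close>, \<open>fh_eval_creation\<close>).

  The passage from \<open>rS\<close> to a tuple \<open>X\<close> with \<open>row_norm X < r\<close> is von Neumann's inequality for row
  contractions, proved with the Poisson kernel (\<open>poisson_kernel\<close>): there are operators \<open>k b\<close> from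
  the Fock space with \<open>X i o k b = k b o (r S i)\<close> and \<open>\<Sum>b. k b o adj (k b) = 1\<close>. Amplified to the
  coefficient spaces they intertwine the values of all free holomorphic functions
  (\<open>fh_eval_intertwine\<close>), and therefore also the values of \<open>\<Gamma> N\<^sup>-\<^sup>1\<close>, although no power series of
  this function is ever considered (\<open>quotient_norm_transfer\<close>).

  Finally \<open>norm (\<Theta>(X)) < 1\<close> holds because \<open>\<Theta>\<close> is bounded by \<open>1\<close> and \<open>norm (\<Theta>(0)) < 1\<close>: the
  Schwarz-Pick estimate along the complex line through \<open>X\<close> excludes that the bound is attained in
  the interior (\<open>fh_eval_norm_less\<close>).\<close>


section \<open>Complex linear operators and their adjoints\<close>

lemma bounded_opsI: "(\<And>c x. blinfun_apply T (c *\<^sub>C x) = c *\<^sub>C T x) \<Longrightarrow> T \<in> bounded_ops"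
  by (simp add: bounded_ops_def)

lemma bounded_opsD: "T \<in> bounded_ops \<Longrightarrow> blinfun_apply T (c *\<^sub>C x) = c *\<^sub>C T x"
  by (simp add: bounded_ops_def)

lemma bounded_ops_compose: "S \<in> bounded_ops \<Longrightarrow> T \<in> bounded_ops \<Longrightarrow> S o\<^sub>L T \<in> bounded_ops"
  by (simp add: bounded_ops_def)

lemma bounded_ops_id: "id_blinfun \<in> bounded_ops"
  by (simp add: bounded_ops_def)

lemma bounded_ops_scaleR: "T \<in> bounded_ops \<Longrightarrow> r *\<^sub>R T \<in> bounded_ops"
  by (simp add: bounded_ops_def blinfun.scaleR_left scaleR_scaleC scaleC_scaleC mult.commute)

lemma cinner_eqI:
  assumes "\<And>x. cinner x y = cinner x (z :: 'a::complex_hilbert_space)"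
  shows "y = z"
proof -
  have "cinner (y - z) (y - z) = 0" by (simp only: cinner_diff_right assms) simp
  then show ?thesis by (simp add: cinner_self)
qed

lemma bounded_linear_scaleC_right: "bounded_linear (\<lambda>x :: 'a::complex_hilbert_space. c *\<^sub>C x)"
  by (rule bounded_linear_intro[where K = "cmod c"])
    (auto simp: scaleC_add_right scaleR_scaleC scaleC_scaleC norm_scaleC mult.commute)

lemma norm_le_of_square: "(norm x)\<^sup>2 \<le> k * norm x \<Longrightarrow> 0 \<le> k \<Longrightarrow> norm x \<le> k"
  by (cases "norm x = 0") (simp_all add: power2_eq_square mult_le_cancel_right)

text \<open>The representing vector of a functional has the conjugates of its values on an orthonormal
  basis as coordinates; testing the functional on the finite partial sums of that very vector shows
  that these coordinates are square summable.\<close>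

lemma riesz_representation:
  fixes \<phi> :: "'a::complex_hilbert_space \<Rightarrow> complex"
  assumes "bounded_linear \<phi>" and lin: "\<And>c x. \<phi> (c *\<^sub>C x) = c * \<phi> x"
  shows "\<exists>y. \<forall>x. \<phi> x = cinner x y"
proof -
  let ?B = "chosen_basis :: 'a set"
  have B: "orthonormal ?B" using chosen_basis by (auto simp: orthonormal_basis_def)
  interpret \<phi>: bounded_linear \<phi> by fact
  obtain K where K: "\<And>x. norm (\<phi> x) \<le> norm x * K" "0 < K" using \<phi>.pos_bounded by blast
  have bound: "(\<Sum>b\<in>S. (cmod (cnj (\<phi> b)))\<^sup>2) \<le> K\<^sup>2" if S: "finite S" "S \<subseteq> ?B" for S
  proof -
    define p where "p = (\<Sum>b\<in>S. cnj (\<phi> b) *\<^sub>C b)"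
    have np: "(norm p)\<^sup>2 = (\<Sum>b\<in>S. (cmod (cnj (\<phi> b)))\<^sup>2)"
      unfolding p_def by (rule orthonormal_sum_norm[OF B S])
    have "\<phi> p = (\<Sum>b\<in>S. cnj (\<phi> b) * \<phi> b)" unfolding p_def by (simp add: \<phi>.sum lin)
    also have "\<dots> = complex_of_real ((norm p)\<^sup>2)"
      unfolding np of_real_sum complex_norm_square by (simp add: mult.commute)
    finally have "(norm p)\<^sup>2 = norm (\<phi> p)" by (simp add: norm_power)
    also have "\<dots> \<le> K * norm p" using K(1)[of p] by (simp add: mult.commute)
    finally have "norm p \<le> K" by (rule norm_le_of_square) (use K in simp)
    then show ?thesis unfolding np[symmetric] by (rule power_mono) simp
  qed
  have "(\<lambda>b. (cmod (cnj (\<phi> b)))\<^sup>2) summable_on ?B"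
    by (rule nonneg_bdd_above_summable_on) (use bound in \<open>auto simp: bdd_above_def\<close>)
  then have "(\<lambda>b. cnj (\<phi> b) *\<^sub>C b) summable_on ?B" by (rule orthonormal_series_summable[OF B])
  then obtain y where y: "((\<lambda>b. cnj (\<phi> b) *\<^sub>C b) has_sum y) ?B" by (auto simp: summable_on_def)
  have "\<phi> x = cinner x y" for x
  proof -
    have "((\<lambda>b. \<phi> (cinner x b *\<^sub>C b)) has_sum \<phi> x) ?B"
      using has_sum_bounded_linear[OF assms(1) orthonormal_basis_expansion[OF chosen_basis, of x]]
      by (simp add: o_def)
    moreover have "((\<lambda>b. cinner x (cnj (\<phi> b) *\<^sub>C b)) has_sum cinner x y) ?B"
      using has_sum_bounded_linear[OF bounded_linear_cinner_right y] by (simp add: o_def)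
    ultimately show ?thesis
      by (simp add: lin cinner_scaleC_right mult.commute has_sum_unique)
  qed
  then show ?thesis by blast
qed

lemma adj_eqI:
  assumes "\<And>x y. cinner (blinfun_apply T x) y = cinner x (blinfun_apply S y)"
  shows "adj T = S"
  unfolding adj_def
proof (rule the_equality)
  fix S' :: "'b \<Rightarrow>\<^sub>L 'a" assume "\<forall>x y. cinner (T x) y = cinner x (S' y)"
  then have "cinner x (S' y) = cinner x (S y)" for x y by (simp add: assms[symmetric])
  then show "S' = S" by (intro blinfun_eqI) (rule cinner_eqI)
qed (use assms in simp)

lemma cinner_adj:
  fixes T :: "'a::complex_hilbert_space \<Rightarrow>\<^sub>L 'b::complex_hilbert_space"
  assumes "T \<in> bounded_ops"
  shows "cinner (T x) y = cinner x (adj T y)"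
proof -
  have "\<exists>z. \<forall>x. cinner (T x) y = cinner x z" for y
    by (rule riesz_representation)
      (auto intro: bounded_linear_compose[OF bounded_linear_cinner_left blinfun.bounded_linear_right]
        simp: bounded_opsD[OF assms] cinner_scaleC_left)
  then obtain s where s: "\<And>x y. cinner (T x) y = cinner x (s y)" by metis
  have "bounded_linear s"
  proof (rule bounded_linear_intro[where K = "norm T"])
    show "s (x + y) = s x + s y" for x y
      by (rule cinner_eqI) (simp add: s[symmetric] cinner_add_right)
    show "s (r *\<^sub>R x) = r *\<^sub>R s x" for r x
      by (rule cinner_eqI) (simp add: s[symmetric] cinner_scaleC_right scaleR_scaleC)
    show "norm (s y) \<le> norm y * norm T" for y
    proof (rule norm_le_of_square)
      have "(norm (s y))\<^sup>2 = cmod (cinner (T (s y)) y)" by (simp add: s cinner_self norm_power)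
      also have "\<dots> \<le> norm (T (s y)) * norm y" by (rule norm_cinner_le)
      also have "\<dots> \<le> norm T * norm (s y) * norm y" by (intro mult_right_mono norm_blinfun) simp
      finally show "(norm (s y))\<^sup>2 \<le> (norm y * norm T) * norm (s y)" by (simp add: mult_ac)
    qed simp
  qed
  then have "adj T = Blinfun s" by (intro adj_eqI) (simp add: s bounded_linear_Blinfun_apply)
  then show ?thesis using s \<open>bounded_linear s\<close> by (simp add: bounded_linear_Blinfun_apply)
qed

lemma cinner_adj_left: "T \<in> bounded_ops \<Longrightarrow> cinner (adj T x) y = cinner x (blinfun_apply T y)"
  by (metis cinner_adj cinner_commute)

lemma adj_bounded_ops: "T \<in> bounded_ops \<Longrightarrow> adj T \<in> bounded_ops"
  by (rule bounded_opsI, rule cinner_eqI) (simp add: cinner_adj[symmetric] cinner_scaleC_right)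

lemma adj_adj: "T \<in> bounded_ops \<Longrightarrow> adj (adj T) = T"
  by (rule adj_eqI) (rule cinner_adj_left)

lemma adj_compose:
  "S \<in> bounded_ops \<Longrightarrow> T \<in> bounded_ops \<Longrightarrow> adj (S o\<^sub>L T) = adj T o\<^sub>L adj S"
  by (rule adj_eqI) (simp add: cinner_adj)

lemma adj_scaleR: "T \<in> bounded_ops \<Longrightarrow> adj (r *\<^sub>R T) = r *\<^sub>R adj T"
  by (rule adj_eqI)
    (simp add: blinfun.scaleR_left scaleR_scaleC cinner_scaleC_left cinner_scaleC_right cinner_adj)

lemma square_norm_adj:
  assumes "T \<in> bounded_ops"
  shows "cinner (blinfun_apply T (adj T h)) h = complex_of_real ((norm (adj T h))\<^sup>2)"
  using assms by (simp add: cinner_adj cinner_self)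


section \<open>Orthogonal series\<close>

text \<open>The normalized nonzero members of the family are an orthonormal set, whose coefficients in the
  series are the norms of the members.\<close>

lemma orthogonal_summable:
  fixes v :: "'i \<Rightarrow> 'a::complex_hilbert_space"
  assumes orth: "\<And>i j. i \<in> I \<Longrightarrow> j \<in> I \<Longrightarrow> i \<noteq> j \<Longrightarrow> cinner (v i) (v j) = 0"
    and sq: "(\<lambda>i. (norm (v i))\<^sup>2) summable_on I"
  shows "v summable_on I"
proof -
  define I' where "I' = {i\<in>I. v i \<noteq> 0}"
  define u where "u i = complex_of_real (inverse (norm (v i))) *\<^sub>C v i" for i
  have "norm (u i) = 1" if "i \<in> I'" for i
    using that by (simp add: u_def I'_def norm_scaleC norm_inverse)
  then have nu: "cinner (u i) (u i) = 1" if "i \<in> I'" for i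
    using that by (simp add: cinner_self)
  have ou: "cinner (u i) (u j) = 0" if "i \<in> I'" "j \<in> I'" "i \<noteq> j" for i j
    using that orth by (simp add: u_def I'_def cinner_scaleC_left cinner_scaleC_right)
  have inj: "inj_on u I'" by (rule inj_onI) (metis nu ou zero_neq_one)
  define c where "c b = complex_of_real (norm (v (the_inv_into I' u b)))" for b
  have cu: "c (u i) = complex_of_real (norm (v i))" if "i \<in> I'" for i
    by (simp add: c_def the_inv_into_f_f[OF inj that])
  have "(\<lambda>b. (cmod (c b))\<^sup>2) summable_on u ` I'"
    unfolding summable_on_reindex[OF inj]
    by (rule summable_on_cong[THEN iffD1, OF _ summable_on_subset_banach[OF sq, of I']])
      (auto simp: cu, auto simp: I'_def)
  then have "(\<lambda>b. c b *\<^sub>C b) summable_on u ` I'"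
    by (rule orthonormal_series_summable[rotated]) (auto simp: orthonormal_def nu intro: ou)
  then have "(\<lambda>i. c (u i) *\<^sub>C u i) summable_on I'"
    unfolding summable_on_reindex[OF inj] by (simp add: o_def)
  then show ?thesis
    by (rule summable_on_cong_neutral[THEN iffD1, rotated -1])
      (auto simp: cu, auto simp: I'_def u_def scaleC_scaleC scaleC_one)
qed

lemma orthogonal_has_sum_norm:
  fixes v :: "'i \<Rightarrow> 'a::complex_hilbert_space"
  assumes orth: "\<And>i j. i \<in> I \<Longrightarrow> j \<in> I \<Longrightarrow> i \<noteq> j \<Longrightarrow> cinner (v i) (v j) = 0"
    and s: "(v has_sum s) I"
  shows "((\<lambda>i. (norm (v i))\<^sup>2) has_sum (norm s)\<^sup>2) I"
proof -
  have vs: "cinner (v i) s = complex_of_real ((norm (v i))\<^sup>2)" if "i \<in> I" for i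
  proof (rule has_sum_unique)
    show "((\<lambda>j. cinner (v i) (v j)) has_sum cinner (v i) s) I"
      using has_sum_bounded_linear[OF bounded_linear_cinner_right s] by (simp add: o_def)
    show "((\<lambda>j. cinner (v i) (v j)) has_sum complex_of_real ((norm (v i))\<^sup>2)) I"
      by (rule has_sum_finite_neutralI[where B = "{i}"]) (use that orth in \<open>auto simp: cinner_self\<close>)
  qed
  have "((\<lambda>i. cinner (v i) s) has_sum cinner s s) I"
    using has_sum_bounded_linear[OF bounded_linear_cinner_left s] by (simp add: o_def)
  then have "((\<lambda>i. complex_of_real ((norm (v i))\<^sup>2)) has_sum complex_of_real ((norm s)\<^sup>2)) I"
    unfolding cinner_self[of s] by (rule has_sum_cong[THEN iffD1, rotated]) (rule vs)
  then show ?thesis by (simp only: has_sum_of_real_iff)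
qed

text \<open>A block diagonal operator: the pieces \<open>R i z\<close> of a vector are all moved by the same operator
  and reassembled in orthogonal copies of the target space. Both factors of a tensor product of
  operators arise in this way.\<close>

lemma orthogonal_sum_operator:
  fixes R :: "'i \<Rightarrow> 'z::complex_hilbert_space \<Rightarrow>\<^sub>L 'a::complex_hilbert_space"
    and X :: "'a \<Rightarrow>\<^sub>L 'b::complex_hilbert_space"
    and J :: "'i \<Rightarrow> 'b \<Rightarrow>\<^sub>L 'y::complex_hilbert_space"
  assumes ops: "X \<in> bounded_ops" "\<And>i. i \<in> I \<Longrightarrow> R i \<in> bounded_ops" "\<And>i. i \<in> I \<Longrightarrow> J i \<in> bounded_ops"
    and R: "\<And>z. ((\<lambda>i. (norm (R i z))\<^sup>2) has_sum s z) I" and s_le: "\<And>z. s z \<le> (norm z)\<^sup>2"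
    and J: "\<And>i j x y. i \<in> I \<Longrightarrow> j \<in> I \<Longrightarrow> cinner (J i x) (J j y) = (if i = j then cinner x y else 0)"
  shows "\<exists>T \<in> bounded_ops. norm T \<le> norm X \<and> (\<forall>z. ((\<lambda>i. J i (X (R i z))) has_sum blinfun_apply T z) I)"
proof -
  have nJ: "norm (J i x) = norm x" if "i \<in> I" for i x
  proof -
    have "complex_of_real ((norm (J i x))\<^sup>2) = complex_of_real ((norm x)\<^sup>2)"
      using J[OF that that, of x x] by (simp only: cinner_self) simp
    then show ?thesis by (simp only: of_real_eq_iff) (simp add: power2_eq_iff_nonneg)
  qed
  have le: "(norm (J i (X (R i z))))\<^sup>2 \<le> (norm X)\<^sup>2 * (norm (R i z))\<^sup>2" if "i \<in> I" for i z
    using power_mono[OF norm_blinfun[of X "R i z"] norm_ge_zero, of 2] that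
    by (simp add: nJ power_mult_distrib)
  have sq: "((\<lambda>i. (norm X)\<^sup>2 * (norm (R i z))\<^sup>2) has_sum (norm X)\<^sup>2 * s z) I" for z
    by (intro has_sum_cmult_right R)
  have "(\<lambda>i. J i (X (R i z))) summable_on I" for z
  proof (rule orthogonal_summable)
    show "(\<lambda>i. (norm (J i (X (R i z))))\<^sup>2) summable_on I"
      by (rule summable_on_comparison_test[OF has_sum_imp_summable[OF sq]]) (use le in auto)
  qed (simp add: J)
  then have "\<exists>t. \<forall>z. ((\<lambda>i. J i (X (R i z))) has_sum t z) I" unfolding summable_on_def by metis
  then obtain t where t: "\<And>z. ((\<lambda>i. J i (X (R i z))) has_sum t z) I" by blast
  have bound: "norm (t z) \<le> norm z * norm X" for z
  proof -
    have "((\<lambda>i. (norm (J i (X (R i z))))\<^sup>2) has_sum (norm (t z))\<^sup>2) I"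
      by (rule orthogonal_has_sum_norm[OF _ t]) (simp add: J)
    then have "(norm (t z))\<^sup>2 \<le> (norm X)\<^sup>2 * s z"
      using sq by (rule has_sum_mono) (rule le)
    also have "\<dots> \<le> (norm X)\<^sup>2 * (norm z)\<^sup>2" by (intro mult_left_mono s_le) simp
    finally have "(norm (t z))\<^sup>2 \<le> (norm X)\<^sup>2 * (norm z)\<^sup>2" .
    then have "(norm (t z))\<^sup>2 \<le> (norm z * norm X)\<^sup>2"
      by (simp add: power_mult_distrib mult.commute)
    then show ?thesis by (rule power2_le_imp_le) simp
  qed
  have "bounded_linear t"
  proof (rule bounded_linear_intro[where K = "norm X"])
    show "t (x + y) = t x + t y" for x y
      by (rule has_sum_unique[OF t]) (simp add: blinfun.add_right has_sum_add t)
    show "t (r *\<^sub>R x) = r *\<^sub>R t x" for r x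
      by (rule has_sum_unique[OF t]) (simp add: blinfun.scaleR_right has_sum_scaleR t)
    show "norm (t z) \<le> norm z * norm X" for z by (rule bound)
  qed
  moreover have "t (c *\<^sub>C x) = c *\<^sub>C t x" for c x
  proof (rule has_sum_unique[OF t])
    have "((\<lambda>i. c *\<^sub>C J i (X (R i x))) has_sum c *\<^sub>C t x) I"
      using has_sum_bounded_linear[OF bounded_linear_scaleC_right t] by (simp add: o_def)
    then show "((\<lambda>i. J i (X (R i (c *\<^sub>C x)))) has_sum c *\<^sub>C t x) I"
      by (rule has_sum_cong[THEN iffD1, rotated]) (simp add: ops bounded_opsD)
  qed
  moreover have "norm (Blinfun t) \<le> norm X"
    by (rule norm_blinfun_bound)
      (use bound \<open>bounded_linear t\<close> in \<open>simp_all add: bounded_linear_Blinfun_apply mult.commute\<close>)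
  ultimately show ?thesis
    by (intro bexI[of _ "Blinfun t"] conjI bounded_opsI) (simp_all add: bounded_linear_Blinfun_apply t)
qed

section \<open>Tensor products of operators\<close>

lemma has_sum_exchange_nonneg:
  fixes f :: "'a \<Rightarrow> 'b \<Rightarrow> real"
  assumes f: "\<And>x. x \<in> A \<Longrightarrow> (f x has_sum g x) B" and g: "(g has_sum s) A"
    and nonneg: "\<And>x y. x \<in> A \<Longrightarrow> y \<in> B \<Longrightarrow> 0 \<le> f x y"
    and h: "\<And>y. y \<in> B \<Longrightarrow> ((\<lambda>x. f x y) has_sum h y) A"
  shows "(h has_sum s) B"
proof -
  have "((\<lambda>(x, y). f x y) has_sum s) (A \<times> B)"
  proof (rule has_sum_SigmaI[OF _ g])
    show "(\<lambda>(x, y). f x y) summable_on A \<times> B"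
      by (rule summable_on_SigmaI[OF _ has_sum_imp_summable[OF g]]) (use f nonneg in auto)
  qed (use f in simp)
  then have "((\<lambda>(y, x). f x y) has_sum s) (B \<times> A)"
    by (subst (asm) has_sum_swap) simp
  then show ?thesis by (rule has_sum_SigmaD) (use h in simp)
qed

lemma parseval_norm:
  assumes "orthonormal_basis B"
  shows "((\<lambda>b. (cmod (cinner h b))\<^sup>2) has_sum (norm h)\<^sup>2) B"
proof -
  have "((\<lambda>b. complex_of_real ((cmod (cinner h b))\<^sup>2)) has_sum complex_of_real ((norm h)\<^sup>2)) B"
    using parseval[OF assms, of h h] unfolding complex_norm_square cinner_self .
  then show ?thesis by (simp only: has_sum_of_real_iff)
qed

lemma chosen_basis_cinner:
  "a \<in> chosen_basis \<Longrightarrow> b \<in> chosen_basis \<Longrightarrow> cinner a b = (if a = b then 1 else 0)"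
  using chosen_basis by (auto simp: orthonormal_basis_def orthonormal_def)

lemma htensor_eqI:
  assumes "\<And>b. b \<in> chosen_basis \<Longrightarrow> l2_coord (htensor_l2 x) b = l2_coord (htensor_l2 y) b"
  shows "x = y"
proof -
  have "l2_coord (htensor_l2 x) b = l2_coord (htensor_l2 y) b" for b
    using assms[of b] htensor_l2[of x] htensor_l2[of y] by (cases "b \<in> chosen_basis") auto
  then show ?thesis by (metis ext htensor_l2_inject l2_coord_inject)
qed

lemma tensor_add_left: "tensor (h + h') e = tensor h e + tensor h' e"
  by (rule htensor_eqI)
    (simp add: tensor_coord plus_htensor.rep_eq plus_l2.rep_eq cinner_add_left scaleC_add_left)

lemma tensor_add_right: "tensor h (e + e') = tensor h e + tensor h e'"
  by (rule htensor_eqI)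
    (simp add: tensor_coord plus_htensor.rep_eq plus_l2.rep_eq scaleC_add_right)

lemma tensor_scaleC_left: "tensor (c *\<^sub>C h) e = c *\<^sub>C tensor h e"
  by (rule htensor_eqI)
    (simp add: tensor_coord scaleC_htensor.rep_eq scaleC_l2.rep_eq cinner_scaleC_left scaleC_scaleC)

lemma tensor_scaleC_right: "tensor h (c *\<^sub>C e) = c *\<^sub>C tensor h e"
  by (rule htensor_eqI)
    (simp add: tensor_coord scaleC_htensor.rep_eq scaleC_l2.rep_eq scaleC_scaleC mult.commute)

lemma norm_tensor: "norm (tensor h e) = norm h * norm e"
proof -
  have "complex_of_real ((norm (tensor h e))\<^sup>2) = complex_of_real ((norm h * norm e)\<^sup>2)"
    using cinner_tensor[of h e h e] by (simp add: cinner_self power_mult_distrib)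
  then show ?thesis by (simp only: of_real_eq_iff) (simp add: power2_eq_iff_nonneg)
qed

lift_definition tensor_left ::
  "'h::complex_hilbert_space \<Rightarrow> 'e::complex_hilbert_space \<Rightarrow>\<^sub>L ('h, 'e) htensor" is tensor
  by (rule bounded_linear_intro)
    (auto simp: tensor_add_right tensor_scaleC_right scaleR_scaleC norm_tensor
      intro: eq_refl[OF mult.commute])

lift_definition tensor_right ::
  "'e::complex_hilbert_space \<Rightarrow> 'h::complex_hilbert_space \<Rightarrow>\<^sub>L ('h, 'e) htensor" is "\<lambda>e h. tensor h e"
  by (rule bounded_linear_intro)
    (auto simp: tensor_add_left tensor_scaleC_left scaleR_scaleC norm_tensor)

lemma tensor_left_ops: "tensor_left h \<in> bounded_ops"
  by (rule bounded_opsI) (simp add: tensor_left.rep_eq tensor_scaleC_right)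

lemma tensor_right_ops: "tensor_right e \<in> bounded_ops"
  by (rule bounded_opsI) (simp add: tensor_right.rep_eq tensor_scaleC_left)

text \<open>The slices of a vector of a tensor product are its coordinates with respect to a unit vector
  of one of the two factors.\<close>

definition left_slice ::
  "'h::complex_hilbert_space \<Rightarrow> ('h, 'e::complex_hilbert_space) htensor \<Rightarrow>\<^sub>L 'e" where
  "left_slice h = adj (tensor_left h)"

definition right_slice ::
  "'e::complex_hilbert_space \<Rightarrow> ('h::complex_hilbert_space, 'e) htensor \<Rightarrow>\<^sub>L 'h" where
  "right_slice e = adj (tensor_right e)"

lemma left_slice_ops: "left_slice h \<in> bounded_ops"
  unfolding left_slice_def by (rule adj_bounded_ops[OF tensor_left_ops])

lemma right_slice_ops: "right_slice e \<in> bounded_ops"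
  unfolding right_slice_def by (rule adj_bounded_ops[OF tensor_right_ops])

lemma cinner_left_slice: "cinner (left_slice h z) e = cinner z (tensor h e)"
  unfolding left_slice_def by (simp add: cinner_adj_left tensor_left_ops tensor_left.rep_eq)

lemma cinner_right_slice: "cinner (right_slice e z) h = cinner z (tensor h e)"
  unfolding right_slice_def by (simp add: cinner_adj_left tensor_right_ops tensor_right.rep_eq)

lemma cinner_eqI_left:
  assumes "\<And>y. cinner x y = cinner (z :: 'a::complex_hilbert_space) y"
  shows "x = z"
  by (rule cinner_eqI) (metis assms cinner_commute)

lemma left_slice_tensor: "left_slice h (tensor k e) = cinner k h *\<^sub>C e"
  by (rule cinner_eqI_left) (simp add: cinner_left_slice cinner_tensor cinner_scaleC_left)

lemma right_slice_tensor: "right_slice e (tensor h f) = cinner f e *\<^sub>C h"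
  by (rule cinner_eqI_left) (simp add: cinner_right_slice cinner_tensor cinner_scaleC_left)

lemma left_slice_norm:
  "((\<lambda>b. (norm (left_slice b z))\<^sup>2) has_sum (norm z)\<^sup>2) chosen_basis"
proof -
  have eq: "left_slice b z = l2_coord (htensor_l2 z) b" if "b \<in> chosen_basis" for b
    by (rule cinner_eqI_left) (simp add: cinner_left_slice htensor_coord_eq_cinner that)
  have "((\<lambda>b. (norm (l2_coord (htensor_l2 z) b))\<^sup>2) has_sum (norm z)\<^sup>2) UNIV"
    unfolding norm_htensor.rep_eq l2_norm_eq by (rule has_sum_infsum[OF l2_summable])
  then show ?thesis
    by (rule has_sum_cong_neutral[THEN iffD1, rotated -1]) (use htensor_l2[of z] eq in auto)
qed

text \<open>Summing \<open>cmod (cinner z (tensor b f)) ^ 2\<close> over the basis vectors \<open>f\<close> first gives the norms of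
  the left slices of \<open>z\<close>, summing over \<open>b\<close> first those of its right slices.\<close>

lemma right_slice_norm:
  "((\<lambda>f. (norm (right_slice f z))\<^sup>2) has_sum (norm z)\<^sup>2) chosen_basis"
proof (rule has_sum_exchange_nonneg[OF _ left_slice_norm])
  show "((\<lambda>f. (cmod (cinner z (tensor b f)))\<^sup>2) has_sum (norm (left_slice b z))\<^sup>2) chosen_basis" for b
    unfolding cinner_left_slice[symmetric] by (rule parseval_norm[OF chosen_basis])
  show "((\<lambda>b. (cmod (cinner z (tensor b f)))\<^sup>2) has_sum (norm (right_slice f z))\<^sup>2) chosen_basis" for f
    unfolding cinner_right_slice[symmetric] by (rule parseval_norm[OF chosen_basis])
qed simp

text \<open>Multiples of simple tensors are simple tensors, so that closure under addition and limits
  suffices, and the principle also applies to operators that are only known to be real linear.\<close>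

lemma tensor_closure_induct:
  assumes "\<And>h e. tensor h e \<in> C" and "closed C" and "0 \<in> C"
    and "\<And>x y. x \<in> C \<Longrightarrow> y \<in> C \<Longrightarrow> x + y \<in> C"
  shows "z \<in> C"
proof -
  interpret module "scaleC :: complex \<Rightarrow> ('a, 'b) htensor \<Rightarrow> ('a, 'b) htensor" by (rule module_scaleC)
  have "x \<in> C" if "x \<in> span {tensor h e | h e. True}" for x
    using that
  proof (induction rule: span_induct_alt)
    case (step c x y)
    then obtain h e where "c *\<^sub>C x = tensor (c *\<^sub>C h) e" by (auto simp: tensor_scaleC_left)
    then show ?case using step assms by simp
  qed (use assms in simp)
  then have "closure (span {tensor h e | h e. True}) \<subseteq> C"
    by (intro closure_minimal assms) auto
  then show ?thesis using tensor_dense by blast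
qed

lemma tensor_blinfun_eqI:
  fixes T T' :: "('h::complex_hilbert_space, 'e::complex_hilbert_space) htensor \<Rightarrow>\<^sub>L 'z::real_normed_vector"
  assumes "\<And>h e. T (tensor h e) = T' (tensor h e)"
  shows "T = T'"
proof (rule blinfun_eqI)
  fix z
  have "z \<in> {z. T z = T' z}"
  proof (rule tensor_closure_induct)
    show "closed {z. T z = T' z}"
      by (intro closed_Collect_eq continuous_intros)
  qed (use assms in \<open>auto simp: blinfun.add_right\<close>)
  then show "T z = T' z" by simp
qed

lemma tensor_cinner_eqI:
  assumes "\<And>h e. cinner (tensor h e) x = cinner (tensor h e) y"
  shows "x = y"
proof (rule cinner_eqI)
  fix z
  have "z \<in> {z. cinner z x = cinner z y}"
  proof (rule tensor_closure_induct)
    show "closed {z. cinner z x = cinner z y}"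
      by (intro closed_Collect_eq linear_continuous_on bounded_linear_cinner_left)
  qed (use assms in \<open>auto simp: cinner_add_left\<close>)
  then show "cinner z x = cinner z y" by simp
qed

text \<open>An operator on one factor acts slicewise on the tensor product, hence is bounded; the general
  tensor product of two operators is the composition of one operator on each factor.\<close>

lemma op_tensor_exists:
  fixes X :: "'h::complex_hilbert_space \<Rightarrow>\<^sub>L 'k::complex_hilbert_space"
    and A :: "'e::complex_hilbert_space \<Rightarrow>\<^sub>L 'g::complex_hilbert_space"
  assumes X: "X \<in> bounded_ops" and A: "A \<in> bounded_ops"
  shows "\<exists>T \<in> bounded_ops. \<forall>h e. T (tensor h e) = tensor (X h) (A e)"
proof -
  have "\<exists>T \<in> bounded_ops. norm T \<le> norm X \<and> (\<forall>z :: ('h, 'e) htensor.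
      ((\<lambda>f. tensor_right f (X (right_slice f z))) has_sum blinfun_apply T z) chosen_basis)"
    by (rule orthogonal_sum_operator[OF X right_slice_ops tensor_right_ops right_slice_norm order.refl])
      (auto simp: tensor_right.rep_eq cinner_tensor chosen_basis_cinner)
  then obtain T1 :: "('h, 'e) htensor \<Rightarrow>\<^sub>L ('k, 'e) htensor" where T1: "T1 \<in> bounded_ops"
    and s1: "\<And>z. ((\<lambda>f. tensor_right f (X (right_slice f z))) has_sum T1 z) chosen_basis" by blast
  have "\<exists>T \<in> bounded_ops. norm T \<le> norm A \<and> (\<forall>z :: ('k, 'e) htensor.
      ((\<lambda>b. tensor_left b (A (left_slice b z))) has_sum blinfun_apply T z) chosen_basis)"
    by (rule orthogonal_sum_operator[OF A left_slice_ops tensor_left_ops left_slice_norm order.refl])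
      (auto simp: tensor_left.rep_eq cinner_tensor chosen_basis_cinner)
  then obtain T2 :: "('k, 'e) htensor \<Rightarrow>\<^sub>L ('k, 'g) htensor" where T2: "T2 \<in> bounded_ops"
    and s2: "\<And>z. ((\<lambda>b. tensor_left b (A (left_slice b z))) has_sum T2 z) chosen_basis" by blast
  have "T1 (tensor h e) = tensor (X h) e" for h e
  proof (rule has_sum_unique[OF s1])
    have "((\<lambda>f. tensor_left (X h) (cinner e f *\<^sub>C f)) has_sum tensor_left (X h) e) chosen_basis"
      using has_sum_bounded_linear[OF blinfun.bounded_linear_right[of "tensor_left (X h)"]
          orthonormal_basis_expansion[OF chosen_basis, of e]] by (simp add: o_def)
    then show "((\<lambda>f. tensor_right f (X (right_slice f (tensor h e)))) has_sum tensor (X h) e) chosen_basis"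
      by (simp add: right_slice_tensor bounded_opsD[OF X] tensor_left.rep_eq tensor_right.rep_eq
          tensor_scaleC_left tensor_scaleC_right)
  qed
  moreover have "T2 (tensor h e) = tensor h (A e)" for h e
  proof (rule has_sum_unique[OF s2])
    have "((\<lambda>b. tensor_right (A e) (cinner h b *\<^sub>C b)) has_sum tensor_right (A e) h) chosen_basis"
      using has_sum_bounded_linear[OF blinfun.bounded_linear_right[of "tensor_right (A e)"]
          orthonormal_basis_expansion[OF chosen_basis, of h]] by (simp add: o_def)
    then show "((\<lambda>b. tensor_left b (A (left_slice b (tensor h e)))) has_sum tensor h (A e)) chosen_basis"
      by (simp add: left_slice_tensor bounded_opsD[OF A] tensor_left.rep_eq tensor_right.rep_eq
          tensor_scaleC_left tensor_scaleC_right)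
  qed
  ultimately show ?thesis
    by (intro bexI[of _ "T2 o\<^sub>L T1"] bounded_ops_compose T1 T2) simp
qed

lemma op_tensor_eqI:
  assumes "\<And>h e. blinfun_apply T (tensor h e) = tensor (blinfun_apply X h) (blinfun_apply A e)"
  shows "op_tensor X A = T"
  unfolding op_tensor_def by (rule the_equality) (auto simp: assms intro: tensor_blinfun_eqI)

lemma op_tensor_ops:
  assumes "X \<in> bounded_ops" "A \<in> bounded_ops"
  shows "op_tensor X A \<in> bounded_ops"
  using op_tensor_exists[OF assms] op_tensor_eqI by blast

lemma op_tensor_tensor:
  assumes "X \<in> bounded_ops" "A \<in> bounded_ops"
  shows "op_tensor X A (tensor h e) = tensor (X h) (A e)"
  using op_tensor_exists[OF assms] op_tensor_eqI by blast

lemma op_tensor_compose: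
  assumes "X \<in> bounded_ops" "A \<in> bounded_ops" "Y \<in> bounded_ops" "B \<in> bounded_ops"
  shows "op_tensor X A o\<^sub>L op_tensor Y B = op_tensor (X o\<^sub>L Y) (A o\<^sub>L B)"
  by (rule op_tensor_eqI[symmetric]) (simp add: op_tensor_tensor assms)

lemma op_tensor_id: "op_tensor id_blinfun id_blinfun = id_blinfun"
  by (rule op_tensor_eqI) simp

lemma adj_op_tensor:
  assumes "X \<in> bounded_ops" "A \<in> bounded_ops"
  shows "adj (op_tensor X A) = op_tensor (adj X) (adj A)"
proof (rule op_tensor_eqI[symmetric])
  show "adj (op_tensor X A) (tensor k g) = tensor (adj X k) (adj A g)" for k g
    by (rule tensor_cinner_eqI)
      (simp add: cinner_adj[symmetric] op_tensor_ops assms op_tensor_tensor cinner_tensor)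
qed

lemma adj_id: "adj id_blinfun = id_blinfun"
  by (rule adj_eqI) simp

lemma right_slice_op_tensor:
  assumes "X \<in> bounded_ops"
  shows "right_slice f (op_tensor X id_blinfun z) = X (right_slice f z)"
proof -
  have "right_slice f o\<^sub>L op_tensor X id_blinfun = X o\<^sub>L right_slice f"
    by (rule tensor_blinfun_eqI)
      (simp add: op_tensor_tensor assms bounded_ops_id right_slice_tensor bounded_opsD)
  then show ?thesis by (metis blinfun_apply_blinfun_compose)
qed

section \<open>Evaluation of free holomorphic functions\<close>

lemma strong_sum_eqI:
  assumes "\<And>x. ((\<lambda>i. blinfun_apply (f i) x) has_sum blinfun_apply T x) I"
  shows "strong_sum f I = T"
  unfolding strong_sum_def
  by (rule the_equality) (auto intro!: blinfun_eqI has_sum_unique[OF _ assms] simp: assms)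

lemma strong_sum_has_sum:
  assumes "strongly_summable f I"
  shows "((\<lambda>i. blinfun_apply (f i) x) has_sum blinfun_apply (strong_sum f I) x) I"
proof -
  obtain T where T: "\<And>x. ((\<lambda>i. f i x) has_sum blinfun_apply T x) I"
    using assms unfolding strongly_summable_def by blast
  show ?thesis using T by (simp add: strong_sum_eqI[OF T])
qed

lemma has_sum_blinfun:
  "(f has_sum s) I \<Longrightarrow> ((\<lambda>i. blinfun_apply T (f i)) has_sum blinfun_apply T s) I"
  using has_sum_bounded_linear[OF blinfun.bounded_linear_right, of f I s T] by (simp add: o_def)

lemma blinfun_compose_id: "T o\<^sub>L id_blinfun = T" "id_blinfun o\<^sub>L T = T"
  by (auto intro: blinfun_eqI)

text \<open>Convergence at a single tuple, which may act on a space other than the one whose ball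
  \<open>free_holomorphic\<close> refers to.\<close>

definition fh_converges ::
  "('n list \<Rightarrow> 'e::complex_hilbert_space \<Rightarrow>\<^sub>L 'g::complex_hilbert_space) \<Rightarrow>
   ('n \<Rightarrow> 'h::complex_hilbert_space \<Rightarrow>\<^sub>L 'h) \<Rightarrow> bool" where
  "fh_converges A X \<longleftrightarrow> (\<forall>k. strongly_summable (fh_summand A X) {\<alpha>. length \<alpha> = k})
    \<and> summable (fh_homogeneous A X)"

lemma free_holomorphic_converges:
  fixes X :: "'n::countable \<Rightarrow> 'h::complex_hilbert_space \<Rightarrow>\<^sub>L 'h"
  shows "free_holomorphic TYPE('h) A \<Longrightarrow> X \<in> row_ball \<Longrightarrow> fh_converges A X"
  unfolding free_holomorphic_def fh_converges_def by blast

lemma fh_homogeneous_has_sum: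
  "fh_converges A X \<Longrightarrow>
    ((\<lambda>\<alpha>. fh_summand A X \<alpha> z) has_sum fh_homogeneous A X k z) {\<alpha>. length \<alpha> = k}"
  unfolding fh_homogeneous_def fh_converges_def by (intro strong_sum_has_sum) simp

lemma fh_eval_sums: "fh_converges A X \<Longrightarrow> fh_homogeneous A X sums fh_eval A X"
  unfolding fh_eval_def fh_converges_def by (intro summable_sums) simp

lemma fh_eval_apply_sums:
  "fh_converges A X \<Longrightarrow> (\<lambda>k. fh_homogeneous A X k z) sums fh_eval A X z"
  by (rule bounded_linear.sums[OF blinfun.bounded_linear_left fh_eval_sums])

lemma word_op_ops: "(\<And>i. X i \<in> bounded_ops) \<Longrightarrow> word_op X \<alpha> \<in> bounded_ops"
  by (induction \<alpha>) (auto intro: bounded_ops_id bounded_ops_compose)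

lemma fh_summand_ops:
  "(\<And>i. X i \<in> bounded_ops) \<Longrightarrow> A \<alpha> \<in> bounded_ops \<Longrightarrow> fh_summand A X \<alpha> \<in> bounded_ops"
  unfolding fh_summand_def by (intro op_tensor_ops word_op_ops)

lemma fh_eval_ops:
  assumes X: "\<And>i. X i \<in> bounded_ops" and A: "\<And>\<alpha>. A \<alpha> \<in> bounded_ops" and conv: "fh_converges A X"
  shows "fh_eval A X \<in> bounded_ops"
proof (rule bounded_opsI)
  fix c z
  have "fh_homogeneous A X k (c *\<^sub>C z) = c *\<^sub>C fh_homogeneous A X k z" for k
  proof (rule has_sum_unique[OF fh_homogeneous_has_sum[OF conv]])
    have "((\<lambda>\<alpha>. c *\<^sub>C fh_summand A X \<alpha> z) has_sum c *\<^sub>C fh_homogeneous A X k z) {\<alpha>. length \<alpha> = k}"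
      using has_sum_bounded_linear[OF bounded_linear_scaleC_right fh_homogeneous_has_sum[OF conv]]
      by (simp add: o_def)
    then show "((\<lambda>\<alpha>. fh_summand A X \<alpha> (c *\<^sub>C z)) has_sum c *\<^sub>C fh_homogeneous A X k z)
        {\<alpha>. length \<alpha> = k}"
      by (simp add: bounded_opsD[OF fh_summand_ops[OF X A]])
  qed
  then have "(\<lambda>k. c *\<^sub>C fh_homogeneous A X k z) sums fh_eval A X (c *\<^sub>C z)"
    using fh_eval_apply_sums[OF conv, of "c *\<^sub>C z"] by simp
  moreover have "(\<lambda>k. c *\<^sub>C fh_homogeneous A X k z) sums (c *\<^sub>C fh_eval A X z)"
    by (rule bounded_linear.sums[OF bounded_linear_scaleC_right fh_eval_apply_sums[OF conv]])
  ultimately show "fh_eval A X (c *\<^sub>C z) = c *\<^sub>C fh_eval A X z" by (rule sums_unique2)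
qed

text \<open>Functional calculus respects intertwiners: an operator that carries a tuple \<open>Y\<close> to a tuple
  \<open>X\<close> carries each monomial in \<open>Y\<close> to the same monomial in \<open>X\<close>, and its amplification therefore
  carries the values of every free holomorphic function to each other.\<close>

lemma fh_eval_intertwine:
  fixes X :: "'n \<Rightarrow> 'h::complex_hilbert_space \<Rightarrow>\<^sub>L 'h" and Y :: "'n \<Rightarrow> 'k::complex_hilbert_space \<Rightarrow>\<^sub>L 'k"
    and K :: "'k \<Rightarrow>\<^sub>L 'h"
    and A :: "'n list \<Rightarrow> 'e::complex_hilbert_space \<Rightarrow>\<^sub>L 'g::complex_hilbert_space"
  assumes X: "\<And>i. X i \<in> bounded_ops" and Y: "\<And>i. Y i \<in> bounded_ops" and A: "\<And>\<alpha>. A \<alpha> \<in> bounded_ops"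
    and K: "K \<in> bounded_ops" and conv: "fh_converges A X" "fh_converges A Y"
    and int: "\<And>i. X i o\<^sub>L K = K o\<^sub>L Y i"
  shows "fh_eval A X (op_tensor K id_blinfun z) = op_tensor K id_blinfun (fh_eval A Y z)"
proof -
  have "X i (K x) = K (Y i x)" for i x
    using int by (metis blinfun_apply_blinfun_compose)
  then have "word_op X \<alpha> (K x) = K (word_op Y \<alpha> x)" for \<alpha> x
    by (induction \<alpha>) auto
  then have word: "word_op X \<alpha> o\<^sub>L K = K o\<^sub>L word_op Y \<alpha>" for \<alpha>
    by (intro blinfun_eqI) simp
  have summand: "fh_summand A X \<alpha> (op_tensor K id_blinfun z) = op_tensor K id_blinfun (fh_summand A Y \<alpha> z)" for \<alpha>
  proof -
    have "fh_summand A X \<alpha> o\<^sub>L op_tensor K id_blinfun = op_tensor K id_blinfun o\<^sub>L fh_summand A Y \<alpha>"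
      unfolding fh_summand_def
      by (simp add: op_tensor_compose word_op_ops X Y A K bounded_ops_id word blinfun_compose_id)
    then show ?thesis by (metis blinfun_apply_blinfun_compose)
  qed
  have "fh_homogeneous A X k (op_tensor K id_blinfun z)
      = op_tensor K id_blinfun (fh_homogeneous A Y k z)" for k
    by (rule has_sum_unique[OF fh_homogeneous_has_sum[OF conv(1)]])
      (simp add: summand has_sum_blinfun fh_homogeneous_has_sum conv)
  then have "(\<lambda>k. op_tensor K id_blinfun (fh_homogeneous A Y k z)) sums
      fh_eval A X (op_tensor K id_blinfun z)"
    using fh_eval_apply_sums[OF conv(1)] by (metis (no_types, lifting) sums_cong)
  moreover have "(\<lambda>k. op_tensor K id_blinfun (fh_homogeneous A Y k z)) sums
      op_tensor K id_blinfun (fh_eval A Y z)"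
    by (rule bounded_linear.sums[OF blinfun.bounded_linear_right fh_eval_apply_sums[OF conv(2)]])
  ultimately show ?thesis by (rule sums_unique2)
qed

text \<open>The hypothesis \<open>free_holomorphic\<close> concerns tuples on a single space; this lemma carries it over
  to equivalent tuples on the Fock space.\<close>

lemma fh_converges_similar:
  fixes X :: "'n \<Rightarrow> 'h::complex_hilbert_space \<Rightarrow>\<^sub>L 'h" and V :: "'h \<Rightarrow>\<^sub>L 'k::complex_hilbert_space"
    and W :: "'k \<Rightarrow>\<^sub>L 'h"
    and A :: "'n list \<Rightarrow> 'e::complex_hilbert_space \<Rightarrow>\<^sub>L 'g::complex_hilbert_space"
  assumes X: "\<And>i. X i \<in> bounded_ops" and A: "\<And>\<alpha>. A \<alpha> \<in> bounded_ops"
    and V: "V \<in> bounded_ops" and W: "W \<in> bounded_ops"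
    and inverse: "W o\<^sub>L V = id_blinfun" "V o\<^sub>L W = id_blinfun" and conv: "fh_converges A X"
  shows "fh_converges A (\<lambda>i. V o\<^sub>L X i o\<^sub>L W)"
proof -
  let ?Y = "\<lambda>i. V o\<^sub>L X i o\<^sub>L W"
  define E :: "('k, 'e) htensor \<Rightarrow>\<^sub>L ('h, 'e) htensor" where "E = op_tensor W id_blinfun"
  define G :: "('h, 'g) htensor \<Rightarrow>\<^sub>L ('k, 'g) htensor" where "G = op_tensor V id_blinfun"
  have wv: "W (V x) = x" for x
    using inverse(1) by (metis blinfun_apply_blinfun_compose blinfun_apply_id_blinfun id_apply)
  have vw: "V (W x) = x" for x
    using inverse(2) by (metis blinfun_apply_blinfun_compose blinfun_apply_id_blinfun id_apply)
  have word: "word_op ?Y \<alpha> = V o\<^sub>L word_op X \<alpha> o\<^sub>L W" for \<alpha>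
    by (induction \<alpha>) (auto intro!: blinfun_eqI simp: wv vw)
  have summand: "fh_summand A ?Y \<alpha> = G o\<^sub>L fh_summand A X \<alpha> o\<^sub>L E" for \<alpha>
    unfolding fh_summand_def word E_def G_def
    by (simp add: op_tensor_compose word_op_ops bounded_ops_compose bounded_ops_id X A V W blinfun_compose_id)
  have homogeneous: "((\<lambda>\<alpha>. fh_summand A ?Y \<alpha> z) has_sum (G o\<^sub>L fh_homogeneous A X k o\<^sub>L E) z)
      {\<alpha>. length \<alpha> = k}" for z k
    by (simp add: summand has_sum_blinfun fh_homogeneous_has_sum[OF conv])
  then have eq: "fh_homogeneous A ?Y k = G o\<^sub>L fh_homogeneous A X k o\<^sub>L E" for k
    unfolding fh_homogeneous_def by (rule strong_sum_eqI)
  have "summable (\<lambda>k. G o\<^sub>L fh_homogeneous A X k o\<^sub>L E)"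
    using conv unfolding fh_converges_def
    by (intro bounded_linear.summable[OF bounded_bilinear.bounded_linear_left[OF bounded_bilinear_blinfun_compose]]
        bounded_linear.summable[OF bounded_bilinear.bounded_linear_right[OF bounded_bilinear_blinfun_compose]]) simp
  then show ?thesis
    unfolding fh_converges_def strongly_summable_def using homogeneous by (simp only: eq[abs_def]) blast
qed

lift_definition scalar_op :: "complex \<Rightarrow> 'a::complex_hilbert_space \<Rightarrow>\<^sub>L 'a" is "\<lambda>c x. c *\<^sub>C x"
  by (rule bounded_linear_scaleC_right)

lemma scalar_op_ops: "scalar_op c \<in> bounded_ops"
  by (rule bounded_opsI) (simp add: scalar_op.rep_eq scaleC_scaleC mult.commute)

lemma adj_scalar_op: "adj (scalar_op c) = scalar_op (cnj c)"
  by (rule adj_eqI) (simp add: scalar_op.rep_eq cinner_scaleC_left cinner_scaleC_right)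

text \<open>Along a complex line the homogeneous parts become the terms of a power series in the
  parameter.\<close>

lemma fh_homogeneous_scalar:
  fixes X :: "'n \<Rightarrow> 'h::complex_hilbert_space \<Rightarrow>\<^sub>L 'h"
    and A :: "'n list \<Rightarrow> 'e::complex_hilbert_space \<Rightarrow>\<^sub>L 'g::complex_hilbert_space"
  assumes X: "\<And>i. X i \<in> bounded_ops" and A: "\<And>\<alpha>. A \<alpha> \<in> bounded_ops" and conv: "fh_converges A X"
  shows "fh_homogeneous A (\<lambda>i. scalar_op c o\<^sub>L X i) k = scalar_op (c ^ k) o\<^sub>L fh_homogeneous A X k"
proof -
  let ?Y = "\<lambda>i. scalar_op c o\<^sub>L X i"
  have word: "word_op ?Y \<alpha> z = c ^ length \<alpha> *\<^sub>C word_op X \<alpha> z" for \<alpha> z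
    by (induction \<alpha>) (simp_all add: scalar_op.rep_eq scaleC_one scaleC_scaleC bounded_opsD[OF X])
  have "fh_summand A ?Y \<alpha> = scalar_op (c ^ length \<alpha>) o\<^sub>L fh_summand A X \<alpha>" for \<alpha>
    unfolding fh_summand_def
    by (rule op_tensor_eqI)
      (simp add: word op_tensor_tensor word_op_ops X A scalar_op.rep_eq tensor_scaleC_left)
  then have eq: "fh_summand A ?Y \<alpha> z = scalar_op (c ^ k) (fh_summand A X \<alpha> z)"
    if "length \<alpha> = k" for \<alpha> z using that by simp
  have "((\<lambda>\<alpha>. fh_summand A ?Y \<alpha> z) has_sum (scalar_op (c ^ k) o\<^sub>L fh_homogeneous A X k) z)
      {\<alpha>. length \<alpha> = k}" for z
    using has_sum_blinfun[OF fh_homogeneous_has_sum[OF conv], of "scalar_op (c ^ k)" z k]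
    by (subst has_sum_cong[OF eq]) auto
  then show ?thesis unfolding fh_homogeneous_def[of A ?Y] by (rule strong_sum_eqI)
qed

section \<open>Strict row contractions\<close>

lemma row_ball_square:
  fixes X :: "'n::countable \<Rightarrow> 'h::complex_hilbert_space \<Rightarrow>\<^sub>L 'h"
  assumes "X \<in> row_ball"
  shows "\<exists>C. norm C = (row_norm X)\<^sup>2 \<and> (\<forall>h. ((\<lambda>i. X i (adj (X i) h)) has_sum blinfun_apply C h) UNIV)"
proof (intro exI conjI allI)
  let ?C = "strong_sum (\<lambda>i. X i o\<^sub>L adj (X i)) UNIV"
  show "norm ?C = (row_norm X)\<^sup>2" by (simp add: row_norm_def)
  have "strongly_summable (\<lambda>i. X i o\<^sub>L adj (X i)) UNIV" using assms by (simp add: row_ball_def)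
  then show "((\<lambda>i. X i (adj (X i) h)) has_sum ?C h) UNIV" for h
    using strong_sum_has_sum by fastforce
qed

lemma row_ball_ops: "X \<in> row_ball \<Longrightarrow> X i \<in> bounded_ops"
  by (simp add: row_ball_def)

lemma row_square_norm:
  assumes ops: "\<And>i. X i \<in> bounded_ops"
    and C: "\<And>h. ((\<lambda>i. X i (adj (X i) h)) has_sum blinfun_apply C h) UNIV"
  shows "((\<lambda>i. norm (adj (X i) h) ^ 2) has_sum Re (cinner (C h) h)) UNIV"
proof -
  have "((\<lambda>i. cinner (X i (adj (X i) h)) h) has_sum cinner (C h) h) UNIV"
    using has_sum_bounded_linear[OF bounded_linear_cinner_left C] by (simp add: o_def)
  then have "((\<lambda>i. Re (cinner (X i (adj (X i) h)) h)) has_sum Re (cinner (C h) h)) UNIV"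
    by (rule has_sum_Re)
  then show ?thesis by (simp only: square_norm_adj[OF ops] Re_complex_of_real)
qed

lemma row_square_selfadjoint:
  assumes ops: "\<And>i. X i \<in> bounded_ops"
    and C: "\<And>h. ((\<lambda>i. X i (adj (X i) h)) has_sum blinfun_apply C h) UNIV"
  shows "cinner (C h) k = cinner h (C k)"
proof (rule has_sum_unique)
  show "((\<lambda>i. cinner (X i (adj (X i) h)) k) has_sum cinner (C h) k) UNIV"
    using has_sum_bounded_linear[OF bounded_linear_cinner_left C] by (simp add: o_def)
  have "((\<lambda>i. cinner h (X i (adj (X i) k))) has_sum cinner h (C k)) UNIV"
    using has_sum_bounded_linear[OF bounded_linear_cinner_right C] by (simp add: o_def)
  then show "((\<lambda>i. cinner (X i (adj (X i) h)) k) has_sum cinner h (C k)) UNIV"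
    by (simp add: cinner_adj[OF ops] cinner_adj_left[OF ops, symmetric])
qed

lemma row_ballI:
  assumes ops: "\<And>i. X i \<in> bounded_ops"
    and C: "\<And>h. ((\<lambda>i. X i (adj (X i) h)) has_sum blinfun_apply C h) UNIV" and "norm C < 1"
  shows "X \<in> row_ball"
proof -
  have C': "((\<lambda>i. (X i o\<^sub>L adj (X i)) h) has_sum C h) UNIV" for h using C by simp
  have "row_norm X = sqrt (norm C)" unfolding row_norm_def by (simp only: strong_sum_eqI[OF C'])
  then show ?thesis
    unfolding row_ball_def strongly_summable_def using ops C' \<open>norm C < 1\<close>
    by (auto simp: real_sqrt_lt_1_iff)
qed

lemma row_ball_scalar:
  fixes X :: "'n::countable \<Rightarrow> 'h::complex_hilbert_space \<Rightarrow>\<^sub>L 'h"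
  assumes X: "X \<in> row_ball" and c: "cmod c * row_norm X < 1"
  shows "(\<lambda>i. scalar_op c o\<^sub>L X i) \<in> row_ball"
proof -
  obtain C where C: "norm C = (row_norm X)\<^sup>2" "\<And>h. ((\<lambda>i. X i (adj (X i) h)) has_sum blinfun_apply C h) UNIV"
    using row_ball_square[OF X] by blast
  note ops = row_ball_ops[OF X]
  show ?thesis
  proof (rule row_ballI)
    show "scalar_op c o\<^sub>L X i \<in> bounded_ops" for i by (intro bounded_ops_compose scalar_op_ops ops)
    have eq: "(scalar_op c o\<^sub>L X i) (adj (scalar_op c o\<^sub>L X i) h) = (cmod c)\<^sup>2 *\<^sub>R X i (adj (X i) h)" for i h
      by (simp add: adj_compose scalar_op_ops ops adj_scalar_op scalar_op.rep_eq scaleR_scaleC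
          bounded_opsD[OF ops] bounded_opsD[OF adj_bounded_ops[OF ops]] scaleC_scaleC complex_norm_square
          del: of_real_power)
    show "((\<lambda>i. (scalar_op c o\<^sub>L X i) (adj (scalar_op c o\<^sub>L X i) h)) has_sum ((cmod c)\<^sup>2 *\<^sub>R C) h) UNIV" for h
      unfolding eq blinfun.scaleR_left by (intro has_sum_scaleR C)
    have "0 \<le> row_norm X" by (simp add: row_norm_def)
    then have "(cmod c * row_norm X)\<^sup>2 < 1\<^sup>2" by (intro power_strict_mono c) auto
    then show "norm ((cmod c)\<^sup>2 *\<^sub>R C) < 1" by (simp add: C power_mult_distrib)
  qed
qed


section \<open>Operators obtained as fixed points\<close>

text \<open>Writing the root as \<open>1 - Z\<close> turns \<open>(1 - Z)\<^sup>2 = 1 - C\<close> into \<open>Z = (C + Z\<^sup>2) / 2\<close>. On the ball of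
  radius \<open>1 - sqrt (1 - norm C)\<close>, the fixed point of the corresponding scalar equation, the right hand
  side is a contraction.\<close>

lemma selfadjoint_sqrt:
  fixes C :: "'h::complex_hilbert_space \<Rightarrow>\<^sub>L 'h"
  assumes C: "\<And>x y. cinner (C x) y = cinner x (C y)" and "norm C < 1"
  shows "\<exists>D :: 'h \<Rightarrow>\<^sub>L 'h. (\<forall>x y. cinner (D x) y = cinner x (D y)) \<and> (\<forall>x. D (D x) = x - C x)"
proof -
  define s where "s = sqrt (1 - norm C)"
  define q where "q = 1 - s"
  have s: "0 < s" "s\<^sup>2 = 1 - norm C" "s \<le> 1" using \<open>norm C < 1\<close> by (auto simp: s_def)
  have q: "0 \<le> q" "q < 1" using s by (auto simp: q_def)
  have qq: "norm C + q * q = 2 * q"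
    using s(2) by (simp add: q_def algebra_simps power2_eq_square)
  define B :: "('h \<Rightarrow>\<^sub>L 'h) set"
    where "B = {Z. norm Z \<le> q \<and> (\<forall>x y. cinner (blinfun_apply Z x) y = cinner x (blinfun_apply Z y))}"
  define f where "f Z = (1/2) *\<^sub>R (C + (Z o\<^sub>L Z))" for Z :: "'h \<Rightarrow>\<^sub>L 'h"
  have "\<exists>!Z \<in> B. f Z = Z"
  proof (rule Banach_fix)
    have "closed {Z :: 'h \<Rightarrow>\<^sub>L 'h. cinner (blinfun_apply Z x) y = cinner x (blinfun_apply Z y)}" for x y
      by (intro closed_Collect_eq linear_continuous_on
          bounded_linear_compose[OF bounded_linear_cinner_left] bounded_linear_compose[OF bounded_linear_cinner_right]
          blinfun.bounded_linear_left)
    moreover have "closed {Z :: 'h \<Rightarrow>\<^sub>L 'h. norm Z \<le> q}" by (intro closed_Collect_le continuous_intros)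
    ultimately have "closed B" unfolding B_def by (intro closed_Collect_conj closed_Collect_all)
    then show "complete B" by (simp add: complete_eq_closed)
    show "B \<noteq> {}" using q by (auto simp: B_def intro!: exI[of _ 0])
    show "0 \<le> q" "q < 1" by fact+
    show "f ` B \<subseteq> B"
    proof (rule image_subsetI)
      fix Z assume Z: "Z \<in> B"
      have "norm (C + (Z o\<^sub>L Z)) \<le> norm C + norm Z * norm Z"
        using norm_triangle_ineq[of C "Z o\<^sub>L Z"] norm_blinfun_compose[of Z Z] by linarith
      also have "\<dots> \<le> norm C + q * q" using Z q by (intro add_left_mono mult_mono) (auto simp: B_def)
      finally have "norm (f Z) \<le> q" unfolding qq by (simp add: f_def)
      moreover have "cinner (f Z x) y = cinner x (f Z y)" for x y
        using Z C by (simp add: f_def B_def blinfun.scaleR_left blinfun.add_left scaleR_scaleC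
            cinner_scaleC_left cinner_scaleC_right cinner_add_left cinner_add_right)
      ultimately show "f Z \<in> B" by (simp add: B_def)
    qed
    show "dist (f Z) (f W) \<le> q * dist Z W" if "Z \<in> B" "W \<in> B" for Z W
    proof -
      have "f Z - f W = (1/2) *\<^sub>R ((Z o\<^sub>L (Z - W)) + ((Z - W) o\<^sub>L W))"
        by (rule blinfun_eqI)
          (simp add: f_def blinfun.scaleR_left blinfun.add_left blinfun.diff_left blinfun.diff_right scaleR_diff_right scaleR_add_right)
      moreover have "norm ((Z o\<^sub>L (Z - W)) + ((Z - W) o\<^sub>L W)) \<le> norm Z * norm (Z - W) + norm (Z - W) * norm W"
        by (intro norm_triangle_mono norm_blinfun_compose)
      moreover have "norm Z * norm (Z - W) + norm (Z - W) * norm W \<le> q * norm (Z - W) + norm (Z - W) * q"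
        using that q by (intro add_mono mult_mono) (auto simp: B_def)
      ultimately show ?thesis by (simp add: dist_norm)
    qed
  qed
  then obtain Z where Z: "Z \<in> B" "f Z = Z" by blast
  show ?thesis
  proof (intro exI conjI allI)
    show "cinner ((id_blinfun - Z) x) y = cinner x ((id_blinfun - Z) y)" for x y
      using Z by (simp add: B_def blinfun.diff_left cinner_diff_left cinner_diff_right)
    fix x
    have "Z x = (1/2) *\<^sub>R (C x + Z (Z x))"
      by (subst Z(2)[symmetric]) (simp add: f_def blinfun.scaleR_left blinfun.add_left)
    then have "2 *\<^sub>R Z x = 2 *\<^sub>R ((1/2) *\<^sub>R (C x + Z (Z x)))" by (rule arg_cong)
    then have "2 *\<^sub>R Z x = C x + Z (Z x)" by simp
    then show "(id_blinfun - Z) ((id_blinfun - Z) x) = x - C x"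
      by (simp add: blinfun.diff_left blinfun.diff_right scaleR_2 algebra_simps)
  qed
qed

text \<open>For small \<open>t > 0\<close> the step \<open>x \<mapsto> x - t (N x - z)\<close>, whose fixed points are the solutions,
  shrinks distances because \<open>N\<close> points outwards.\<close>

lemma coercive_surjective:
  fixes N :: "'a::{real_inner, complete_space} \<Rightarrow>\<^sub>L 'a"
  assumes N: "\<And>x. (norm x)\<^sup>2 \<le> inner (N x) x"
  shows "\<exists>x. N x = z"
proof -
  \<comment> \<open>Any \<open>t\<close> in \<open>{0<..1}\<close> with \<open>t * norm N ^ 2 \<le> 1\<close> gives the Lipschitz constant \<open>sqrt (1 - t)\<close>.\<close>
  define t where "t = 1 / (1 + (norm N)\<^sup>2)"
  have pos: "0 < 1 + (norm N)\<^sup>2" by (simp add: add_pos_nonneg)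
  have "0 < t" "t \<le> 1" "t * (norm N)\<^sup>2 \<le> 1" using pos by (auto simp: t_def)
  then have t: "0 < t" "t \<le> 1" "t\<^sup>2 * (norm N)\<^sup>2 \<le> t"
    using mult_left_mono[of "t * (norm N)\<^sup>2" 1 t] by (auto simp: power2_eq_square mult_ac)
  have "\<exists>!x. x - t *\<^sub>R (N x - z) = x"
  proof (rule banach_fix_type)
    show "0 \<le> sqrt (1 - t)" "sqrt (1 - t) < 1" using t by auto
    show "\<forall>x y. dist (x - t *\<^sub>R (N x - z)) (y - t *\<^sub>R (N y - z)) \<le> sqrt (1 - t) * dist x y"
    proof (intro allI)
      fix x y :: 'a
      let ?u = "x - y"
      have "(norm (?u - t *\<^sub>R N ?u))\<^sup>2 = (norm ?u)\<^sup>2 - 2 * t * inner (N ?u) ?u + t\<^sup>2 * (norm (N ?u))\<^sup>2"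
        unfolding power2_norm_eq_inner
        by (simp add: inner_diff_left inner_diff_right inner_commute power2_eq_square)
      also have "\<dots> \<le> (norm ?u)\<^sup>2 - 2 * t * (norm ?u)\<^sup>2 + t\<^sup>2 * (norm N * norm ?u)\<^sup>2"
        using t N[of ?u] norm_blinfun[of N ?u]
        by (intro add_mono diff_mono mult_left_mono power_mono) auto
      also have "\<dots> = (1 - 2 * t + t\<^sup>2 * (norm N)\<^sup>2) * (norm ?u)\<^sup>2"
        by (simp add: algebra_simps power_mult_distrib)
      also have "\<dots> \<le> (1 - t) * (norm ?u)\<^sup>2" using t by (intro mult_right_mono) auto
      also have "\<dots> = (sqrt (1 - t) * norm ?u)\<^sup>2" using t by (simp add: power_mult_distrib)
      finally have "norm (?u - t *\<^sub>R N ?u) \<le> sqrt (1 - t) * norm ?u"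
        by (rule power2_le_imp_le) (use t in simp)
      moreover have "(x - t *\<^sub>R (N x - z)) - (y - t *\<^sub>R (N y - z)) = ?u - t *\<^sub>R N ?u"
        by (simp add: blinfun.diff_right algebra_simps)
      ultimately show "dist (x - t *\<^sub>R (N x - z)) (y - t *\<^sub>R (N y - z)) \<le> sqrt (1 - t) * dist x y"
        by (simp only: dist_norm)
    qed
  qed
  then obtain x where "x - t *\<^sub>R (N x - z) = x" by blast
  moreover have "v = 0" if "u - v = u" for u v :: 'a using that by simp
  ultimately have "t *\<^sub>R (N x - z) = 0" by blast
  moreover have "t \<noteq> 0" using t(1) by linarith
  ultimately have "N x - z = 0" by (simp only: scaleR_eq_0_iff) blast
  then have "N x = z" by simp
  then show ?thesis ..
qed

section \<open>The Poisson kernel of a strict row contraction\<close>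

text \<open>Iterating the identity \<open>norm h ^ 2 = norm (D h) ^ 2 + (\<Sum>i. norm (a i h) ^ 2)\<close> along words of
  length less than \<open>k\<close> leaves a remainder that decays geometrically in \<open>k\<close>.\<close>

lemma defect_expansion:
  fixes a :: "'n \<Rightarrow> 'h::real_normed_vector \<Rightarrow> 'h" and D :: "'h \<Rightarrow> 'k::real_normed_vector"
  assumes split: "\<And>h. ((\<lambda>i. (norm (a i h))\<^sup>2) has_sum ((norm h)\<^sup>2 - (norm (D h))\<^sup>2)) UNIV"
    and le: "\<And>h. (norm h)\<^sup>2 - (norm (D h))\<^sup>2 \<le> q * (norm h)\<^sup>2" and q: "0 \<le> q" "q < 1"
  shows "((\<lambda>\<alpha>. (norm (D (fold a \<alpha> h)))\<^sup>2) has_sum (norm h)\<^sup>2) UNIV"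
proof -
  define w where "w h \<alpha> = (norm (D (fold a \<alpha> h)))\<^sup>2" for h \<alpha>
  have w_nonneg: "0 \<le> w h \<alpha>" for h \<alpha> by (simp add: w_def)
  have truncated: "\<exists>s. 0 \<le> s \<and> s \<le> q ^ k * (norm h)\<^sup>2 \<and> (w h has_sum ((norm h)\<^sup>2 - s)) {\<alpha>. length \<alpha> < k}" for k h
  proof (induction k arbitrary: h)
    case 0
    show ?case by (intro exI[of _ "(norm h)\<^sup>2"]) simp
  next
    case (Suc k)
    then obtain s where s: "\<And>h. 0 \<le> s h" "\<And>h. s h \<le> q ^ k * (norm h)\<^sup>2"
      "\<And>h. (w h has_sum ((norm h)\<^sup>2 - s h)) {\<alpha>. length \<alpha> < k}" by metis
    let ?d = "(norm h)\<^sup>2 - (norm (D h))\<^sup>2"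
    have bound: "((\<lambda>i. q ^ k * (norm (a i h))\<^sup>2) has_sum q ^ k * ?d) UNIV"
      by (intro has_sum_cmult_right split)
    have "(\<lambda>i. s (a i h)) summable_on UNIV"
      by (rule summable_on_comparison_test[OF has_sum_imp_summable[OF bound]]) (use s in auto)
    then obtain S where S: "((\<lambda>i. s (a i h)) has_sum S) UNIV" by (auto simp: summable_on_def)
    have "0 \<le> S" by (rule has_sum_nonneg[OF S]) (use s in simp)
    have "S \<le> q ^ k * ?d" by (rule has_sum_mono[OF S bound]) (use s in simp)
    also have "\<dots> \<le> q ^ k * (q * (norm h)\<^sup>2)" using q le by (intro mult_left_mono) auto
    finally have "S \<le> q ^ Suc k * (norm h)\<^sup>2" by (simp add: mult_ac)
    moreover have "(w h has_sum ((norm h)\<^sup>2 - S)) {\<alpha>. length \<alpha> < Suc k}"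
    proof -
      let ?g = "\<lambda>(i, \<alpha>). w (a i h) \<alpha>"
      have diff: "((\<lambda>i. (norm (a i h))\<^sup>2 - s (a i h)) has_sum ?d - S) UNIV"
        using has_sum_add[OF split[of h] has_sum_cmult_right[OF S, of "-1"]] by simp
      have "(?g has_sum (?d - S)) (SIGMA i:UNIV. {\<alpha>. length \<alpha> < k})"
      proof (rule has_sum_SigmaI[OF _ diff])
        show "?g summable_on (SIGMA i:UNIV. {\<alpha>. length \<alpha> < k})"
          by (rule summable_on_SigmaI[OF _ has_sum_imp_summable[OF diff]]) (use s w_nonneg in auto)
      qed (use s in simp)
      then have "(w h has_sum (?d - S)) ((\<lambda>(i, \<alpha>). i # \<alpha>) ` (SIGMA i:UNIV. {\<alpha>. length \<alpha> < k}))"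
        by (subst has_sum_reindex) (auto simp: inj_on_def w_def o_def case_prod_unfold)
      then have "(w h has_sum (w h [] + (?d - S))) (insert [] ((\<lambda>(i, \<alpha>). i # \<alpha>) ` (SIGMA i:UNIV. {\<alpha>. length \<alpha> < k})))"
        by (intro has_sum_insert) auto
      moreover have "insert [] ((\<lambda>(i, \<alpha>). i # \<alpha>) ` (SIGMA i:UNIV. {\<alpha>. length \<alpha> < k}))
          = {\<alpha> :: 'n list. length \<alpha> < Suc k}"
      proof (rule set_eqI)
        fix \<alpha> :: "'n list"
        show "(\<alpha> \<in> insert [] ((\<lambda>(i, \<alpha>). i # \<alpha>) ` (SIGMA i:UNIV. {\<alpha>. length \<alpha> < k})))
            = (\<alpha> \<in> {\<alpha>. length \<alpha> < Suc k})"
          by (cases \<alpha>) (auto simp: image_iff)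
      qed
      ultimately show ?thesis by (simp add: w_def)
    qed
    ultimately show ?case using \<open>0 \<le> S\<close> by blast
  qed
  have finite_le: "sum (w h) F \<le> (norm h)\<^sup>2" if "finite F" for F h
  proof -
    define k where "k = Suc (Max (insert 0 (length ` F)))"
    have F: "F \<subseteq> {\<alpha>. length \<alpha> < k}" using that by (auto simp: k_def less_Suc_eq_le)
    obtain s where s: "0 \<le> s" "(w h has_sum ((norm h)\<^sup>2 - s)) {\<alpha>. length \<alpha> < k}" using truncated by blast
    have "sum (w h) F \<le> (norm h)\<^sup>2 - s"
      by (rule finite_sum_le_has_sum[OF s(2) that F]) (simp add: w_def)
    then show ?thesis using s by simp
  qed
  have "w h summable_on UNIV"
    by (rule nonneg_bdd_above_summable_on) (use finite_le in \<open>auto simp: w_def bdd_above_def\<close>)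
  then obtain t where t: "(w h has_sum t) UNIV" by (auto simp: summable_on_def)
  have "t \<le> (norm h)\<^sup>2" by (rule has_sum_le_finite_sums[OF t finite_le])
  moreover have "(norm h)\<^sup>2 \<le> t"
  proof (rule tendsto_upperbound)
    show "(\<lambda>k. (norm h)\<^sup>2 - q ^ k * (norm h)\<^sup>2) \<longlonglongrightarrow> (norm h)\<^sup>2"
      using tendsto_diff[OF tendsto_const[of "(norm h)\<^sup>2"] tendsto_mult_left_zero[OF LIMSEQ_realpow_zero[OF q], of "(norm h)\<^sup>2"]]
      by simp
    show "\<forall>\<^sub>F k in sequentially. (norm h)\<^sup>2 - q ^ k * (norm h)\<^sup>2 \<le> t"
    proof (rule always_eventually, rule allI)
      fix k
      obtain s where s: "s \<le> q ^ k * (norm h)\<^sup>2" "(w h has_sum ((norm h)\<^sup>2 - s)) {\<alpha>. length \<alpha> < k}"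
        using truncated by blast
      have "(norm h)\<^sup>2 - s \<le> t" by (rule has_sum_mono2[OF s(2) t]) (auto simp: w_def)
      then show "(norm h)\<^sup>2 - q ^ k * (norm h)\<^sup>2 \<le> t" using s by simp
    qed
  qed simp
  ultimately show ?thesis using t unfolding w_def by simp
qed

lemma creation_ops: "creation i \<in> bounded_ops"
proof (rule bounded_opsI)
  fix c and \<phi> :: "'a fock"
  have "creation_map i (c *\<^sub>C \<phi>) = c *\<^sub>C creation_map i \<phi>"
    by transfer (auto simp: shift_coord_def fun_eq_iff split: list.splits)
  then show "creation i (c *\<^sub>C \<phi>) = c *\<^sub>C creation i \<phi>" by (simp add: creation.rep_eq)
qed

lemma cinner_creation:
  assumes "\<And>v. l2_coord \<psi>' v = l2_coord \<psi> (i # v)"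
  shows "cinner (creation i \<phi>) \<psi> = cinner \<phi> \<psi>'"
proof -
  have "(\<Sum>\<^sub>\<infinity>w. cinner (l2_coord (creation i \<phi>) w) (l2_coord \<psi> w))
      = (\<Sum>\<^sub>\<infinity>w\<in>range ((#) i). cinner (l2_coord (creation i \<phi>) w) (l2_coord \<psi> w))"
    by (rule infsum_cong_neutral)
      (auto simp: creation.rep_eq creation_map.rep_eq shift_coord_def split: list.splits)
  also have "\<dots> = (\<Sum>\<^sub>\<infinity>v. cinner (l2_coord \<phi> v) (l2_coord \<psi>' v))"
    by (subst infsum_reindex)
      (auto simp: o_def creation.rep_eq creation_map.rep_eq shift_coord_def assms)
  finally show ?thesis unfolding cinner_l2_def .
qed

text \<open>The operators \<open>k b\<close> are the components, along a basis of the defect space, of the adjoint of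
  the Poisson kernel \<open>h \<mapsto> \<Sum>\<alpha>. e\<^sub>\<alpha> \<otimes> \<Delta> Y\<^sub>\<alpha>\<^sup>* h\<close> of \<open>Y = X / r\<close>, where \<open>\<Delta>\<^sup>2 = 1 - \<Sum>i. Y\<^sub>i Y\<^sub>i\<^sup>*\<close>. The
  kernel is an isometry that carries the adjoint of \<open>X\<close> to the adjoint of the scaled left creation
  operators.\<close>

lemma poisson_kernel:
  fixes X :: "'n::countable \<Rightarrow> 'h::complex_hilbert_space \<Rightarrow>\<^sub>L 'h"
  assumes X: "X \<in> row_ball" and r: "row_norm X < r"
  shows "\<exists>k :: 'h \<Rightarrow> 'n fock \<Rightarrow>\<^sub>L 'h. (\<forall>b. k b \<in> bounded_ops)
    \<and> (\<forall>b \<in> chosen_basis. \<forall>i. X i o\<^sub>L k b = k b o\<^sub>L (r *\<^sub>R creation i))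
    \<and> (\<forall>h. ((\<lambda>b. norm (adj (k b) h) ^ 2) has_sum norm h ^ 2) chosen_basis)"
proof -
  obtain C where C: "norm C = (row_norm X)\<^sup>2" "\<And>h. ((\<lambda>i. X i (adj (X i) h)) has_sum blinfun_apply C h) UNIV"
    using row_ball_square[OF X] by blast
  note ops = row_ball_ops[OF X]
  have "0 \<le> row_norm X" by (simp add: row_norm_def)
  then have r0: "0 < r" using r by simp
  \<comment> \<open>\<open>a i\<close> is the adjoint of \<open>Y i = X i / r\<close>; folding over a word applies its first letter first,
    which is the order of the adjoint of the monomial \<open>Y\<^sub>\<alpha>\<close>.\<close>
  define a where "a i = (1 / r) *\<^sub>R adj (X i)" for i
  have a_ops: "a i \<in> bounded_ops" for i
    unfolding a_def by (intro bounded_ops_scaleR adj_bounded_ops ops)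
  define C' where "C' = (1 / r\<^sup>2) *\<^sub>R C"
  have nC': "norm C' < 1"
    using power_strict_mono[OF r \<open>0 \<le> row_norm X\<close>, of 2] r0 by (simp add: C'_def C)
  have "\<exists>D :: 'h \<Rightarrow>\<^sub>L 'h. (\<forall>x y. cinner (D x) y = cinner x (D y)) \<and> (\<forall>x. D (D x) = x - C' x)"
    by (rule selfadjoint_sqrt[OF _ nC'])
      (simp add: C'_def blinfun.scaleR_left scaleR_scaleC cinner_scaleC_left cinner_scaleC_right
        row_square_selfadjoint[OF ops C(2)])
  then obtain D :: "'h \<Rightarrow>\<^sub>L 'h" where D: "\<And>x y. cinner (D x) y = cinner x (D y)"
    and DD: "\<And>x. D (D x) = x - C' x" by blast
  have D_ops: "D \<in> bounded_ops"
    by (rule bounded_opsI, rule cinner_eqI) (simp add: D[symmetric] cinner_scaleC_right)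
  have nD: "(norm h)\<^sup>2 - (norm (D h))\<^sup>2 = Re (cinner (C' h) h)" for h
  proof -
    have "(norm (D h))\<^sup>2 = Re (cinner (D h) (D h))" by (simp add: cinner_self)
    also have "\<dots> = Re (cinner (D (D h)) h)" by (simp add: D)
    also have "\<dots> = (norm h)\<^sup>2 - Re (cinner (C' h) h)" by (simp add: DD cinner_diff_left cinner_self)
    finally show ?thesis by simp
  qed
  have expansion: "((\<lambda>\<alpha>. (norm (D (fold (\<lambda>i. blinfun_apply (a i)) \<alpha> h)))\<^sup>2) has_sum (norm h)\<^sup>2) UNIV" for h
  proof (rule defect_expansion)
    fix h
    have "((\<lambda>i. (1 / r\<^sup>2) * (norm (adj (X i) h))\<^sup>2) has_sum (1 / r\<^sup>2) * Re (cinner (C h) h)) UNIV"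
      by (intro has_sum_cmult_right row_square_norm ops C)
    moreover have "(norm (a i h))\<^sup>2 = (1 / r\<^sup>2) * (norm (adj (X i) h))\<^sup>2" for i
      by (simp add: a_def blinfun.scaleR_left power_divide)
    moreover have "Re (cinner (C' h) h) = (1 / r\<^sup>2) * Re (cinner (C h) h)"
      by (simp add: C'_def blinfun.scaleR_left inner_eq_Re_cinner[symmetric])
    ultimately show "((\<lambda>i. (norm (a i h))\<^sup>2) has_sum ((norm h)\<^sup>2 - (norm (D h))\<^sup>2)) UNIV"
      unfolding nD by simp
    have "Re (cinner (C' h) h) \<le> norm (C' h) * norm h"
      using norm_cinner_le[of "C' h" h] complex_Re_le_cmod order.trans by blast
    also have "\<dots> \<le> norm C' * norm h * norm h" by (intro mult_right_mono norm_blinfun) simp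
    finally show "(norm h)\<^sup>2 - (norm (D h))\<^sup>2 \<le> norm C' * (norm h)\<^sup>2"
      unfolding nD by (simp add: power2_eq_square mult_ac)
  qed (use nC' in auto)
  define p where "p h \<alpha> = D (fold (\<lambda>i. blinfun_apply (a i)) \<alpha> h)" for h \<alpha>
  have p_add: "p (x + y) \<alpha> = p x \<alpha> + p y \<alpha>" for x y \<alpha>
    unfolding p_def by (induction \<alpha> arbitrary: x y) (auto simp: blinfun.add_right)
  have p_scale: "p (c *\<^sub>C x) \<alpha> = c *\<^sub>C p x \<alpha>" for c x \<alpha>
    unfolding p_def by (induction \<alpha> arbitrary: x) (auto simp: bounded_opsD[OF D_ops] bounded_opsD[OF a_ops])
  have p_Cons: "p h (i # \<alpha>) = p (a i h) \<alpha>" for h i \<alpha> by (simp add: p_def)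
  have p_sum: "((\<lambda>\<alpha>. (norm (p h \<alpha>))\<^sup>2) has_sum (norm h)\<^sup>2) UNIV" for h
    unfolding p_def by (rule expansion)
  have sq: "(cmod (cinner (p h \<alpha>) b))\<^sup>2 \<le> (norm (p h \<alpha>))\<^sup>2" if "b \<in> chosen_basis" for h b \<alpha>
  proof -
    have "complex_of_real ((norm b)\<^sup>2) = 1"
      unfolding cinner_self[symmetric] using chosen_basis_cinner[OF that that] by simp
    then have "norm b = 1" by (simp only: of_real_eq_1_iff power2_eq_1_iff) (use norm_ge_zero[of b] in linarith)
    then show ?thesis using norm_cinner_le[of "p h \<alpha>" b] by (intro power_mono) auto
  qed
  have summable: "(\<lambda>\<alpha>. (norm (cinner (p h \<alpha>) b))\<^sup>2) summable_on UNIV" if "b \<in> chosen_basis" for h b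
    by (rule summable_on_comparison_test[OF has_sum_imp_summable[OF p_sum]]) (use sq that in auto)
  define v where "v b h = (Abs_l2 (\<lambda>\<alpha>. cinner (p h \<alpha>) b) :: 'n fock)" for b h
  have v_coord: "l2_coord (v b h) \<alpha> = cinner (p h \<alpha>) b" if "b \<in> chosen_basis" for b h \<alpha>
    unfolding v_def by (subst Abs_l2_inverse) (use summable[OF that] in auto)
  have v_norm: "((\<lambda>\<alpha>. (cmod (cinner (p h \<alpha>) b))\<^sup>2) has_sum (norm (v b h))\<^sup>2) UNIV" if "b \<in> chosen_basis" for b h
    unfolding l2_norm_eq v_coord[OF that] by (rule has_sum_infsum[OF summable[OF that]])
  have v_linear: "bounded_linear (v b)" if b: "b \<in> chosen_basis" for b
  proof (rule bounded_linear_intro[where K = 1])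
    show "v b (x + y) = v b x + v b y" for x y
      by (simp add: l2_coord_inject[symmetric] fun_eq_iff v_coord b plus_l2.rep_eq p_add cinner_add_left)
    show "v b (s *\<^sub>R x) = s *\<^sub>R v b x" for s x
      using p_scale[of "complex_of_real s" x]
      by (simp add: l2_coord_inject[symmetric] fun_eq_iff v_coord b scaleR_l2.rep_eq
          scaleR_scaleC[symmetric])
        (simp add: scaleR_scaleC cinner_scaleC_left scaleC_complex_def)
    have "(norm (v b x))\<^sup>2 \<le> (norm x)\<^sup>2" for x
      by (rule has_sum_mono[OF v_norm[OF b] p_sum]) (rule sq[OF b])
    then show "norm (v b x) \<le> norm x * 1" for x by (simp add: power2_le_iff_abs_le)
  qed
  define V where "V b = (if b \<in> chosen_basis then Blinfun (v b) else 0)" for b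
  have V: "V b h = v b h" if "b \<in> chosen_basis" for b h
    by (simp add: V_def that bounded_linear_Blinfun_apply[OF v_linear])
  have V_ops: "V b \<in> bounded_ops" for b
  proof (cases "b \<in> chosen_basis")
    case True
    show ?thesis
      by (rule bounded_opsI)
        (simp add: V True l2_coord_inject[symmetric] fun_eq_iff v_coord scaleC_l2.rep_eq p_scale
          cinner_scaleC_left scaleC_complex_def)
  qed (simp add: V_def bounded_ops_def)
  have intertwine: "X i o\<^sub>L adj (V b) = adj (V b) o\<^sub>L (r *\<^sub>R creation i)" if b: "b \<in> chosen_basis" for i b
  proof (rule blinfun_eqI, rule cinner_eqI_left)
    fix \<phi> h
    have "cinner (creation i \<phi>) (V b h) = cinner \<phi> (V b (a i h))"
      by (rule cinner_creation) (simp add: V b v_coord p_Cons)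
    also have "\<dots> = complex_of_real (1 / r) * cinner \<phi> (V b (adj (X i) h))"
      using r0 by (simp add: a_def blinfun.scaleR_left blinfun.scaleR_right scaleR_scaleC cinner_scaleC_right
          bounded_opsD[OF V_ops])
    finally show "cinner ((X i o\<^sub>L adj (V b)) \<phi>) h = cinner ((adj (V b) o\<^sub>L (r *\<^sub>R creation i)) \<phi>) h"
      using r0 by (simp add: cinner_adj[OF ops] cinner_adj_left[OF V_ops] blinfun.scaleR_left
          scaleR_scaleC cinner_scaleC_left)
  qed
  have "((\<lambda>b. (norm (adj (adj (V b)) h))\<^sup>2) has_sum (norm h)\<^sup>2) chosen_basis" for h
  proof (rule has_sum_exchange_nonneg[OF _ p_sum])
    show "((\<lambda>b. (cmod (cinner (p h \<alpha>) b))\<^sup>2) has_sum (norm (p h \<alpha>))\<^sup>2) chosen_basis" for \<alpha>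
      by (rule parseval_norm[OF chosen_basis])
    show "((\<lambda>\<alpha>. (cmod (cinner (p h \<alpha>) b))\<^sup>2) has_sum (norm (adj (adj (V b)) h))\<^sup>2) UNIV"
      if "b \<in> chosen_basis" for b
      using v_norm[OF that] by (simp add: adj_adj[OF V_ops] V that)
  qed simp
  then show ?thesis
    using intertwine V_ops adj_bounded_ops by (intro exI[of _ "\<lambda>b. adj (V b)"]) blast
qed

text \<open>The right slices of a vector live in the original space, where the expansion is known; summing
  over the slices transfers it to the tensor product.\<close>

lemma amplified_expansion:
  fixes k :: "'h::complex_hilbert_space \<Rightarrow> 'k::complex_hilbert_space \<Rightarrow>\<^sub>L 'h"
    and z :: "('h, 'e::complex_hilbert_space) htensor"
  assumes ops: "\<And>b. k b \<in> bounded_ops"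
    and sum: "\<And>h. ((\<lambda>b. norm (adj (k b) h) ^ 2) has_sum norm h ^ 2) chosen_basis"
  shows "((\<lambda>b. norm (adj (op_tensor (k b) id_blinfun) z) ^ 2) has_sum norm z ^ 2) chosen_basis"
proof (rule has_sum_exchange_nonneg[OF _ right_slice_norm])
  show "((\<lambda>b. norm (adj (k b) (right_slice f z)) ^ 2) has_sum norm (right_slice f z) ^ 2) chosen_basis" for f
    by (rule sum)
  show "((\<lambda>f. norm (adj (k b) (right_slice f z)) ^ 2)
      has_sum norm (adj (op_tensor (k b) id_blinfun) z) ^ 2) chosen_basis" for b
    using right_slice_norm[of "op_tensor (adj (k b)) id_blinfun z"]
    by (simp add: right_slice_op_tensor adj_op_tensor adj_bounded_ops ops bounded_ops_id adj_id)
qed simp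

text \<open>The column \<open>z \<mapsto> (adj (K b) z)\<^sub>b\<close> is isometric, so its adjoint, the row
  \<open>w \<mapsto> \<Sum>b. K b (w b)\<close>, is contractive.\<close>

lemma parseval_family_row_contraction:
  fixes K :: "'i \<Rightarrow> 'a::complex_hilbert_space \<Rightarrow>\<^sub>L 'b::complex_hilbert_space"
  assumes ops: "\<And>b. K b \<in> bounded_ops"
    and sum: "\<And>z. ((\<lambda>b. norm (adj (K b) z) ^ 2) has_sum norm z ^ 2) I"
    and S: "finite S" "S \<subseteq> I"
  shows "norm (\<Sum>b\<in>S. K b (w b)) ^ 2 \<le> (\<Sum>b\<in>S. norm (w b) ^ 2)"
proof -
  define u where "u = (\<Sum>b\<in>S. K b (w b))"
  have "norm u ^ 2 = (\<Sum>b\<in>S. inner (w b) (adj (K b) u))"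
    by (simp add: power2_norm_eq_inner inner_eq_Re_cinner)
      (simp add: u_def cinner_sum_left cinner_adj[OF ops])
  also have "\<dots> \<le> (\<Sum>b\<in>S. (norm (w b) ^ 2 + norm (adj (K b) u) ^ 2) / 2)"
  proof (rule sum_mono)
    fix b
    have "inner (w b) (adj (K b) u) \<le> norm (w b) * norm (adj (K b) u)" by (rule norm_cauchy_schwarz)
    then show "inner (w b) (adj (K b) u) \<le> (norm (w b) ^ 2 + norm (adj (K b) u) ^ 2) / 2"
      using sum_squares_bound[of "norm (w b)" "norm (adj (K b) u)"] by simp
  qed
  also have "\<dots> = ((\<Sum>b\<in>S. norm (w b) ^ 2) + (\<Sum>b\<in>S. norm (adj (K b) u) ^ 2)) / 2"
    by (simp add: sum_divide_distrib sum.distrib add_divide_distrib)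
  also have "\<dots> \<le> ((\<Sum>b\<in>S. norm (w b) ^ 2) + norm u ^ 2) / 2"
    using finite_sum_le_has_sum[OF sum S, of u] by simp
  finally show ?thesis unfolding u_def by simp
qed

text \<open>The choice \<open>y b = adj (K b) z\<close> works: with \<open>P z = \<Sum>b\<in>S. K b (adj (K b) z)\<close> the contractivity of
  the row gives \<open>norm (P z) ^ 2 \<le> inner (P z) z\<close>, hence
  \<open>norm (z - P z) ^ 2 \<le> norm z ^ 2 - inner (P z) z\<close>, which is the tail of a convergent series.\<close>

lemma parseval_family_approximation:
  fixes K :: "'i \<Rightarrow> 'a::complex_hilbert_space \<Rightarrow>\<^sub>L 'b::complex_hilbert_space"
  assumes ops: "\<And>b. K b \<in> bounded_ops"
    and sum: "\<And>z. ((\<lambda>b. norm (adj (K b) z) ^ 2) has_sum norm z ^ 2) I"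
    and "0 < e"
  shows "\<exists>S y. finite S \<and> S \<subseteq> I \<and> (\<Sum>b\<in>S. norm (y b) ^ 2) \<le> norm z ^ 2 \<and> norm (z - (\<Sum>b\<in>S. K b (y b))) < e"
proof -
  have "\<forall>\<^sub>F S in finite_subsets_at_top I. dist (\<Sum>b\<in>S. norm (adj (K b) z) ^ 2) (norm z ^ 2) < e\<^sup>2"
    by (rule tendstoD[OF sum[unfolded has_sum_def]]) (use \<open>0 < e\<close> in simp)
  then obtain S where S: "finite S" "S \<subseteq> I"
    and close: "dist (\<Sum>b\<in>S. norm (adj (K b) z) ^ 2) (norm z ^ 2) < e\<^sup>2"
    unfolding eventually_finite_subsets_at_top by blast
  let ?s = "\<Sum>b\<in>S. norm (adj (K b) z) ^ 2"
  define p where "p = (\<Sum>b\<in>S. K b (adj (K b) z))"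
  have "inner p z = ?s"
    unfolding p_def inner_eq_Re_cinner cinner_sum_left square_norm_adj[OF ops] by simp
  moreover have "norm p ^ 2 \<le> ?s"
    unfolding p_def by (rule parseval_family_row_contraction[OF ops sum S])
  ultimately have "norm (z - p) ^ 2 \<le> norm z ^ 2 - ?s"
    by (simp add: power2_norm_eq_inner inner_diff_left inner_diff_right inner_commute)
  also have "\<dots> < e\<^sup>2" using close by (simp add: dist_real_def abs_less_iff)
  finally have "norm (z - p) < e" by (rule power2_less_imp_less) (use \<open>0 < e\<close> in simp)
  moreover have "?s \<le> norm z ^ 2" by (rule finite_sum_le_has_sum[OF sum S]) simp
  ultimately show ?thesis using S unfolding p_def by (intro exI[of _ S] exI[of _ "\<lambda>b. adj (K b) z"]) auto
qed

section \<open>The left creation operators as a strict row contraction\<close>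

text \<open>Basis vectors have mutual distance \<open>sqrt 2\<close>, so approximating each of them within \<open>1/2\<close> from a
  countable dense set embeds the basis into that set.\<close>

lemma countable_chosen_basis:
  assumes "separable_space (euclidean :: 'h::complex_hilbert_space topology)"
  shows "countable (chosen_basis :: 'h set)"
proof -
  obtain C :: "'h set" where C: "countable C" "closure C = UNIV"
    using assms by (auto simp: separable_space_def)
  have "\<exists>c\<in>C. dist c b < 1/2" for b :: 'h
  proof -
    have "b \<in> closure C" using C by simp
    then show ?thesis by (rule closure_approachable[THEN iffD1, rule_format]) simp
  qed
  then obtain c where c: "\<And>b. c b \<in> C" "\<And>b :: 'h. dist (c b) b < 1/2" by metis
  have "inj_on c (chosen_basis :: 'h set)"
  proof (rule inj_onI, rule ccontr)
    fix a b :: 'h assume ab: "a \<in> chosen_basis" "b \<in> chosen_basis" "c a = c b" "a \<noteq> b"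
    have "(norm (a - b))\<^sup>2 = 2"
      unfolding power2_norm_eq_inner inner_eq_Re_cinner cinner_diff_left cinner_diff_right
      using ab by (simp add: chosen_basis_cinner)
    moreover have "dist (c a) b < 1/2" using c(2)[of b] ab(3) by simp
    then have "dist a b < 1/2 + 1/2"
      using dist_triangle3[of a b "c a"] c(2)[of a] by linarith
    then have "(norm (a - b))\<^sup>2 < 1\<^sup>2" unfolding dist_norm by (intro power_strict_mono) auto
    ultimately show False by simp
  qed
  then show ?thesis using C(1) c(1) by (metis countable_image_inj_on countable_subset image_subsetI)
qed

lemma infinite_chosen_basis:
  assumes "infinite_dimensional TYPE('h::complex_hilbert_space)"
  shows "infinite (chosen_basis :: 'h set)"
proof
  assume fin: "finite (chosen_basis :: 'h set)"
  interpret module "scaleC :: complex \<Rightarrow> 'h \<Rightarrow> 'h" by (rule module_scaleC)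
  have "x \<in> span chosen_basis" for x :: 'h
  proof -
    have "x = (\<Sum>b\<in>chosen_basis. cinner x b *\<^sub>C b)"
      using orthonormal_basis_expansion[OF chosen_basis, of x] fin by (metis has_sum_finite has_sum_unique)
    then show ?thesis by (metis (no_types, lifting) span_base span_scale span_sum)
  qed
  then show False using assms fin unfolding infinite_dimensional_def by blast
qed

lemma word_indexed_basis:
  assumes "separable_space (euclidean :: 'h::complex_hilbert_space topology)"
    and "infinite_dimensional TYPE('h)"
  shows "\<exists>e :: 'n::countable list \<Rightarrow> 'h. bij_betw e UNIV chosen_basis"
proof -
  have "bij_betw (from_nat_into (chosen_basis :: 'h set)) UNIV chosen_basis"
    by (rule bij_betw_from_nat_into[OF countable_chosen_basis infinite_chosen_basis]) fact+
  moreover have "bij_betw (to_nat_on (UNIV :: 'n list set)) UNIV UNIV"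
    by (rule to_nat_on_infinite) (auto simp: infinite_UNIV_listI)
  ultimately show ?thesis using bij_betw_trans by blast
qed

text \<open>Numbering an orthonormal basis by words identifies the space with the full Fock space.\<close>

lemma fock_unitary:
  assumes "separable_space (euclidean :: 'h::complex_hilbert_space topology)"
    and "infinite_dimensional TYPE('h)"
  shows "\<exists>V :: 'h \<Rightarrow>\<^sub>L 'n::countable fock. V \<in> bounded_ops
    \<and> adj V o\<^sub>L V = id_blinfun \<and> V o\<^sub>L adj V = id_blinfun"
proof -
  obtain e :: "'n list \<Rightarrow> 'h" where e: "bij_betw e UNIV chosen_basis"
    using word_indexed_basis[OF assms] by blast
  have ee: "cinner (e \<alpha>) (e \<beta>) = (if \<alpha> = \<beta> then 1 else 0)" for \<alpha> \<beta>
    using e by (metis UNIV_I bij_betwE bij_betw_inv_into_left chosen_basis_cinner)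
  have sum: "((\<lambda>\<alpha>. (cmod (cinner x (e \<alpha>)))\<^sup>2) has_sum (norm x)\<^sup>2) UNIV" for x
    using has_sum_reindex_bij_betw[OF e, of "\<lambda>b. (cmod (cinner x b))\<^sup>2"] parseval_norm[OF chosen_basis, of x]
    by simp
  define v where "v x = (Abs_l2 (\<lambda>\<alpha>. cinner x (e \<alpha>)) :: 'n fock)" for x
  have v_coord: "l2_coord (v x) \<alpha> = cinner x (e \<alpha>)" for x \<alpha>
    unfolding v_def by (subst Abs_l2_inverse) (use has_sum_imp_summable[OF sum] in auto)
  have "bounded_linear v"
  proof (rule bounded_linear_intro[where K = 1])
    show "v (x + y) = v x + v y" for x y
      by (simp add: l2_coord_inject[symmetric] fun_eq_iff v_coord plus_l2.rep_eq cinner_add_left)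
    show "v (s *\<^sub>R x) = s *\<^sub>R v x" for s x
      by (simp add: l2_coord_inject[symmetric] fun_eq_iff v_coord scaleR_l2.rep_eq)
        (simp add: scaleR_scaleC cinner_scaleC_left scaleC_complex_def)
    have "(norm (v x))\<^sup>2 = (norm x)\<^sup>2" for x
      unfolding l2_norm_eq v_coord by (rule infsumI[OF sum])
    then show "norm (v x) \<le> norm x * 1" for x by (simp add: power2_eq_iff_nonneg)
  qed
  define V where "V = Blinfun v"
  have V: "l2_coord (V x) \<alpha> = cinner x (e \<alpha>)" for x \<alpha>
    by (simp add: V_def bounded_linear_Blinfun_apply \<open>bounded_linear v\<close> v_coord)
  have V_ops: "V \<in> bounded_ops"
    by (rule bounded_opsI)
      (simp add: l2_coord_inject[symmetric] fun_eq_iff V scaleC_l2.rep_eq cinner_scaleC_left scaleC_complex_def)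
  have isometry: "cinner (V x) (V y) = cinner x y" for x y
  proof -
    have "((\<lambda>\<alpha>. cinner x (e \<alpha>) * cnj (cinner y (e \<alpha>))) has_sum cinner x y) UNIV"
      using has_sum_reindex_bij_betw[OF e, of "\<lambda>b. cinner x b * cnj (cinner y b)" "cinner x y"]
        parseval[OF chosen_basis, of x y] by simp
    then show ?thesis unfolding cinner_l2_def V cinner_complex_def by (rule infsumI)
  qed
  have "adj V o\<^sub>L V = id_blinfun"
    by (rule blinfun_eqI, rule cinner_eqI) (simp add: cinner_adj[OF V_ops, symmetric] isometry)
  moreover have "V o\<^sub>L adj V = id_blinfun"
  proof (rule blinfun_eqI)
    fix \<phi>
    have "l2_coord (V (adj V \<phi>)) \<alpha> = l2_coord \<phi> \<alpha>" for \<alpha>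
    proof -
      have "((\<lambda>\<beta>. cinner (l2_coord \<phi> \<beta>) (l2_coord (V (e \<alpha>)) \<beta>)) has_sum l2_coord \<phi> \<alpha>) UNIV"
        by (rule has_sum_finite_neutralI[where B = "{\<alpha>}"]) (auto simp: V ee cinner_complex_def)
      then have "cinner \<phi> (V (e \<alpha>)) = l2_coord \<phi> \<alpha>" unfolding cinner_l2_def by (rule infsumI)
      then show ?thesis by (simp add: V cinner_adj_left[OF V_ops])
    qed
    then show "(V o\<^sub>L adj V) \<phi> = id_blinfun \<phi>" by (simp add: l2_coord_inject[symmetric] fun_eq_iff)
  qed
  ultimately show ?thesis using V_ops by blast
qed

lemma adj_creation_coord: "l2_coord (adj (creation i) \<psi>) v = l2_coord \<psi> (i # v)"
proof -
  have "(\<lambda>w. (norm (l2_coord \<psi> w))\<^sup>2) summable_on range ((#) i)"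
    by (rule summable_on_subset_banach[OF l2_summable]) simp
  then have sum: "(\<lambda>v. (norm (l2_coord \<psi> (i # v)))\<^sup>2) summable_on UNIV"
    by (subst (asm) summable_on_reindex) (auto simp: o_def)
  define \<psi>' where "\<psi>' = (Abs_l2 (\<lambda>v. l2_coord \<psi> (i # v)) :: 'a fock)"
  have coord: "l2_coord \<psi>' v = l2_coord \<psi> (i # v)" for v
    unfolding \<psi>'_def by (subst Abs_l2_inverse) (use sum in auto)
  have "adj (creation i) \<psi> = \<psi>'"
    by (rule cinner_eqI) (simp add: cinner_adj[OF creation_ops, symmetric] cinner_creation[OF coord])
  then show ?thesis by (simp add: coord)
qed

lemma cinner_creation_creation:
  "cinner (creation i \<phi>) (creation j \<psi>) = (if i = j then cinner \<phi> \<psi> else 0)"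
proof -
  have "cinner (creation i \<phi>) (creation j \<psi>) = cinner \<phi> (if i = j then \<psi> else 0)"
    by (rule cinner_creation) (auto simp: creation.rep_eq creation_map.rep_eq shift_coord_def zero_l2.rep_eq)
  then show ?thesis by simp
qed

text \<open>The ranges of the creation operators are orthogonal and together span the vectors without
  vacuum component; \<open>Q\<close> is the projection onto these.\<close>

lemma creation_row:
  "\<exists>Q :: 'n::countable fock \<Rightarrow>\<^sub>L 'n fock. norm Q \<le> 1
    \<and> (\<forall>\<psi>. ((\<lambda>i. creation i (adj (creation i) \<psi>)) has_sum blinfun_apply Q \<psi>) UNIV)"
proof -
  have sum: "((\<lambda>i. (norm (adj (creation i) \<psi>))\<^sup>2) has_sum (norm \<psi>)\<^sup>2 - (cmod (l2_coord \<psi> []))\<^sup>2) UNIV"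
    for \<psi> :: "'n fock"
  proof -
    let ?f = "\<lambda>w. (cmod (l2_coord \<psi> w))\<^sup>2"
    have all: "(?f has_sum (norm \<psi>)\<^sup>2) UNIV"
      unfolding l2_norm_eq by (rule has_sum_infsum[OF l2_summable])
    have "(?f has_sum ((norm \<psi>)\<^sup>2 - ?f [])) (UNIV - {[]})"
      by (rule has_sum_Diff[OF all has_sum_finiteI]) auto
    moreover have bij: "bij_betw (\<lambda>(i, v). i # v) UNIV (UNIV - {[] :: 'n list})"
      by (rule bij_betwI[where g = "\<lambda>w. (hd w, tl w)"]) auto
    ultimately have "((\<lambda>p. ?f (case p of (i, v) \<Rightarrow> i # v)) has_sum ((norm \<psi>)\<^sup>2 - ?f [])) (UNIV \<times> UNIV)"
      using has_sum_reindex_bij_betw[OF bij, of ?f] by simp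
    then show ?thesis
    proof (rule has_sum_SigmaD)
      fix i
      show "((\<lambda>v. ?f (case (i, v) of (i, v) \<Rightarrow> i # v)) has_sum (norm (adj (creation i) \<psi>))\<^sup>2) UNIV"
        unfolding l2_norm_eq adj_creation_coord[symmetric] prod.case by (rule has_sum_infsum[OF l2_summable])
    qed
  qed
  have "\<exists>Q \<in> bounded_ops. norm Q \<le> norm (id_blinfun :: 'n fock \<Rightarrow>\<^sub>L 'n fock)
      \<and> (\<forall>\<psi> :: 'n fock. ((\<lambda>i. creation i (id_blinfun (adj (creation i) \<psi>))) has_sum blinfun_apply Q \<psi>) UNIV)"
    by (rule orthogonal_sum_operator[OF _ _ _ sum])
      (auto simp: bounded_ops_id creation_ops adj_bounded_ops cinner_creation_creation)
  then obtain Q :: "'n fock \<Rightarrow>\<^sub>L 'n fock" where "norm Q \<le> norm (id_blinfun :: 'n fock \<Rightarrow>\<^sub>L 'n fock)"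
    and Q: "\<And>\<psi>. ((\<lambda>i. creation i (adj (creation i) \<psi>)) has_sum Q \<psi>) UNIV" by auto
  then show ?thesis using norm_blinfun_id_le order.trans by blast
qed

lemma norm_unitary_le:
  assumes "V \<in> bounded_ops" "adj V o\<^sub>L V = id_blinfun"
  shows "norm V \<le> 1"
proof (rule norm_blinfun_bound)
  fix x
  have "cinner (V x) (V x) = cinner x x"
    using assms by (simp add: cinner_adj) (metis blinfun_apply_blinfun_compose blinfun_apply_id_blinfun id_apply)
  then have "(norm (V x))\<^sup>2 = (norm x)\<^sup>2" by (simp only: cinner_self of_real_eq_iff)
  then show "norm (V x) \<le> 1 * norm x" by (simp add: power2_eq_iff_nonneg)
qed simp

lemma creation_tuple_row_ball:
  fixes V :: "'h::complex_hilbert_space \<Rightarrow>\<^sub>L 'n::countable fock"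
  assumes V: "V \<in> bounded_ops" "adj V o\<^sub>L V = id_blinfun" "V o\<^sub>L adj V = id_blinfun"
    and r: "0 \<le> r" "r < 1"
  shows "(\<lambda>i. adj V o\<^sub>L (r *\<^sub>R creation i) o\<^sub>L V) \<in> row_ball"
proof -
  obtain Q :: "'n fock \<Rightarrow>\<^sub>L 'n fock" where Q: "norm Q \<le> 1"
    and sum: "\<And>\<psi>. ((\<lambda>i. creation i (adj (creation i) \<psi>)) has_sum blinfun_apply Q \<psi>) UNIV"
    using creation_row by blast
  note V' = adj_bounded_ops[OF V(1)]
  have vv: "V (adj V \<psi>) = \<psi>" for \<psi>
    using V(3) by (metis blinfun_apply_blinfun_compose blinfun_apply_id_blinfun id_apply)
  note S = bounded_ops_scaleR[OF creation_ops, of r]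
  show ?thesis
  proof (rule row_ballI)
    show "adj V o\<^sub>L (r *\<^sub>R creation i) o\<^sub>L V \<in> bounded_ops" for i
      by (intro bounded_ops_compose V V' S)
    have eq: "(adj V o\<^sub>L (r *\<^sub>R creation i) o\<^sub>L V) (adj (adj V o\<^sub>L (r *\<^sub>R creation i) o\<^sub>L V) h)
        = r\<^sup>2 *\<^sub>R adj V (creation i (adj (creation i) (V h)))" for i h
      by (simp add: adj_compose bounded_ops_compose V V' S adj_adj adj_scaleR creation_ops vv
          blinfun.scaleR_left blinfun.scaleR_right power2_eq_square)
    have "((\<lambda>i. r\<^sup>2 *\<^sub>R adj V (creation i (adj (creation i) (V h))))
        has_sum r\<^sup>2 *\<^sub>R adj V (Q (V h))) UNIV" for h
      by (intro has_sum_scaleR has_sum_blinfun sum)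
    then show "((\<lambda>i. (adj V o\<^sub>L (r *\<^sub>R creation i) o\<^sub>L V) (adj (adj V o\<^sub>L (r *\<^sub>R creation i) o\<^sub>L V) h))
        has_sum (r\<^sup>2 *\<^sub>R (adj V o\<^sub>L Q o\<^sub>L V)) h) UNIV" for h
      by (simp only: eq blinfun.scaleR_left) simp
    have "norm (adj V) \<le> 1" by (rule norm_unitary_le) (use V V' in \<open>simp_all add: adj_adj\<close>)
    then have "norm (adj V) * norm Q \<le> 1 * 1" by (intro mult_mono Q) auto
    then have "norm (adj V o\<^sub>L Q) \<le> 1" using norm_blinfun_compose[of "adj V" Q] by linarith
    then have "norm (adj V o\<^sub>L Q) * norm V \<le> 1 * 1"
      by (intro mult_mono norm_unitary_le[OF V(1,2)]) auto
    then have "norm (adj V o\<^sub>L Q o\<^sub>L V) \<le> 1"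
      using norm_blinfun_compose[of "adj V o\<^sub>L Q" V] by linarith
    then have "norm (r\<^sup>2 *\<^sub>R (adj V o\<^sub>L Q o\<^sub>L V)) \<le> r\<^sup>2 * 1"
      unfolding norm_scaleR by (intro mult_mono) auto
    also have "\<dots> < 1" using power_strict_mono[OF r(2,1), of 2] by simp
    finally show "norm (r\<^sup>2 *\<^sub>R (adj V o\<^sub>L Q o\<^sub>L V)) < 1" .
  qed
qed

text \<open>Through the unitary \<open>V\<close>, everything known about free holomorphic functions on the ball of
  one space also holds at the scaled left creation operators.\<close>

lemma fh_eval_creation:
  fixes V :: "'h::complex_hilbert_space \<Rightarrow>\<^sub>L 'n::countable fock"
    and A :: "'n list \<Rightarrow> 'e::complex_hilbert_space \<Rightarrow>\<^sub>L 'g::complex_hilbert_space"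
  assumes V: "V \<in> bounded_ops" "adj V o\<^sub>L V = id_blinfun" "V o\<^sub>L adj V = id_blinfun"
    and r: "0 \<le> r" "r < 1" and A: "free_holomorphic TYPE('h) A"
  shows "fh_converges A (\<lambda>i. r *\<^sub>R creation i)" (is ?conv)
    and "fh_eval A (\<lambda>i. r *\<^sub>R creation i) (op_tensor V id_blinfun z)
      = op_tensor V id_blinfun (fh_eval A (\<lambda>i. adj V o\<^sub>L (r *\<^sub>R creation i) o\<^sub>L V) z)"
proof -
  let ?T = "\<lambda>i. adj V o\<^sub>L (r *\<^sub>R creation i) o\<^sub>L V"
  have T: "?T \<in> row_ball" by (rule creation_tuple_row_ball[OF V r])
  have A_ops: "A \<alpha> \<in> bounded_ops" for \<alpha> using A by (simp add: free_holomorphic_def)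
  note convT = free_holomorphic_converges[OF A T]
  have vv: "V (adj V \<psi>) = \<psi>" for \<psi>
    using V(3) by (metis blinfun_apply_blinfun_compose blinfun_apply_id_blinfun id_apply)
  have eq: "V o\<^sub>L ?T i o\<^sub>L adj V = r *\<^sub>R creation i" for i by (rule blinfun_eqI) (simp add: vv)
  show conv: ?conv
    using fh_converges_similar[OF row_ball_ops[OF T] A_ops V(1) adj_bounded_ops[OF V(1)] V(2,3) convT]
    by (simp only: eq)
  show "fh_eval A (\<lambda>i. r *\<^sub>R creation i) (op_tensor V id_blinfun z)
      = op_tensor V id_blinfun (fh_eval A ?T z)"
  proof (rule fh_eval_intertwine[OF _ row_ball_ops[OF T] A_ops V(1) conv convT])
    show "r *\<^sub>R creation i \<in> bounded_ops" for i :: 'n by (intro bounded_ops_scaleR creation_ops)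
    show "(r *\<^sub>R creation i) o\<^sub>L V = V o\<^sub>L ?T i" for i by (rule blinfun_eqI) (simp add: vv)
  qed
qed

section \<open>Strict contractivity inside the ball\<close>

text \<open>Schwarz's lemma is applied to the composition \<open>h\<close> of \<open>f\<close> with the disc automorphism that moves
  \<open>f 0\<close> to \<open>0\<close>. Rewritten through
  \<open>cmod (1 - cnj p * w) ^ 2 - cmod (w - p) ^ 2 = (1 - cmod p ^ 2) * (1 - cmod w ^ 2)\<close>,
  its conclusion bounds \<open>f z\<close> away from the unit circle, by an amount that depends on \<open>f\<close> only through
  the bound \<open>a\<close> for \<open>f 0\<close>.\<close>

lemma pick_estimate_strict:
  assumes holo: "f holomorphic_on ball 0 1" and less: "\<And>z. cmod z < 1 \<Longrightarrow> cmod (f z) < 1"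
    and a: "cmod (f 0) \<le> a" "a < 1" and z: "cmod z < 1"
  shows "(cmod (f z))\<^sup>2 \<le> 1 - (1 - (cmod z)\<^sup>2) * (1 - a)\<^sup>2"
proof -
  define p where "p = f 0"
  define g where "g w = 1 - cnj p * f w" for w
  define h where "h w = (f w - p) / g w" for w
  have np: "cmod p < 1" unfolding p_def by (rule less) simp
  have pf: "cmod (cnj p * f w) \<le> cmod p * 1" if "cmod w < 1" for w
    unfolding norm_mult complex_mod_cnj using less[OF that] by (intro mult_left_mono) auto
  have g: "1 - cmod p \<le> cmod (g w)" if "cmod w < 1" for w
    using pf[OF that] norm_triangle_ineq2[of 1 "cnj p * f w"] by (simp add: g_def)
  have g0: "g w \<noteq> 0" if "cmod w < 1" for w using g[OF that] np by auto
  have identity: "(cmod (g w))\<^sup>2 - (cmod (f w - p))\<^sup>2 = (1 - (cmod p)\<^sup>2) * (1 - (cmod (f w))\<^sup>2)" for w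
    unfolding g_def cmod_power2 by (simp add: power2_eq_square algebra_simps)
  have "cmod (h z) \<le> cmod z"
  proof (rule Schwarz_Lemma(1))
    show "h holomorphic_on ball 0 1"
      unfolding h_def g_def using g0 by (intro holomorphic_intros holo) (auto simp: g_def)
    show "h 0 = 0" by (simp add: h_def p_def)
    show "cmod (h w) < 1" if "cmod w < 1" for w
    proof -
      have "0 < (1 - (cmod p)\<^sup>2) * (1 - (cmod (f w))\<^sup>2)"
        using np less[OF that] by (intro mult_pos_pos) (auto simp: abs_square_less_1)
      then have "(cmod (f w - p))\<^sup>2 < (cmod (g w))\<^sup>2" using identity[of w] by linarith
      then have "cmod (f w - p) < cmod (g w)" by (rule power2_less_imp_less) simp
      then show ?thesis using g0[OF that] by (simp add: h_def norm_divide)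
    qed
  qed fact
  then have "cmod (f z - p) \<le> cmod z * cmod (g z)"
    using g0[OF z] by (simp add: h_def norm_divide divide_le_eq)
  then have "(cmod (f z - p))\<^sup>2 \<le> (cmod z * cmod (g z))\<^sup>2" by (rule power_mono) simp
  then have "(1 - (cmod z)\<^sup>2) * (cmod (g z))\<^sup>2 \<le> (1 - (cmod p)\<^sup>2) * (1 - (cmod (f z))\<^sup>2)"
    unfolding identity[symmetric] by (simp add: power_mult_distrib algebra_simps)
  also have "\<dots> \<le> 1 * (1 - (cmod (f z))\<^sup>2)"
    using less[OF z] by (intro mult_right_mono) (auto simp: abs_square_le_1)
  finally have "(1 - (cmod z)\<^sup>2) * (cmod (g z))\<^sup>2 \<le> 1 - (cmod (f z))\<^sup>2" by simp
  moreover have "(1 - (cmod z)\<^sup>2) * (1 - a)\<^sup>2 \<le> (1 - (cmod z)\<^sup>2) * (cmod (g z))\<^sup>2"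
    using z a g[OF z] by (intro mult_left_mono power_mono) (auto simp: abs_square_le_1 p_def)
  ultimately show ?thesis by linarith
qed

text \<open>The strict version is applied to \<open>t f\<close> for \<open>t < 1\<close>, and \<open>t\<close> tends to \<open>1\<close>.\<close>

lemma pick_estimate:
  assumes holo: "f holomorphic_on ball 0 1" and le: "\<And>z. cmod z < 1 \<Longrightarrow> cmod (f z) \<le> 1"
    and a: "cmod (f 0) \<le> a" "a < 1" and z: "cmod z < 1"
  shows "(cmod (f z))\<^sup>2 \<le> 1 - (1 - (cmod z)\<^sup>2) * (1 - a)\<^sup>2"
proof (rule tendsto_upperbound)
  show "((\<lambda>t. (t * cmod (f z))\<^sup>2) \<longlongrightarrow> (cmod (f z))\<^sup>2) (at_left (1::real))"
    by (auto intro!: tendsto_eq_intros)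
  have "\<forall>\<^sub>F t in at_left (1::real). t \<in> {0<..<1}" by (rule eventually_at_left_real) simp
  then show "\<forall>\<^sub>F t in at_left (1::real). (t * cmod (f z))\<^sup>2 \<le> 1 - (1 - (cmod z)\<^sup>2) * (1 - a)\<^sup>2"
  proof (rule eventually_mono)
    fix t :: real assume t: "t \<in> {0<..<1}"
    have le': "t * cmod (f w) \<le> t * 1" if "cmod w < 1" for w
      using t le[OF that] by (intro mult_left_mono) auto
    have "(cmod (complex_of_real t * f z))\<^sup>2 \<le> 1 - (1 - (cmod z)\<^sup>2) * (1 - a)\<^sup>2"
    proof (rule pick_estimate_strict[OF _ _ _ a(2) z])
      show "(\<lambda>w. complex_of_real t * f w) holomorphic_on ball 0 1" by (intro holomorphic_intros holo)
      show "cmod (complex_of_real t * f w) < 1" if "cmod w < 1" for w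
      proof -
        have "t * cmod (f w) < 1" using le'[OF that] t unfolding greaterThanLessThan_iff by linarith
        then show ?thesis using t by (simp add: norm_mult)
      qed
      have "t * cmod (f 0) \<le> 1 * cmod (f 0)" using t by (intro mult_right_mono) auto
      then show "cmod (complex_of_real t * f 0) \<le> a" using a t by (simp add: norm_mult)
    qed
    then show "(t * cmod (f z))\<^sup>2 \<le> 1 - (1 - (cmod z)\<^sup>2) * (1 - a)\<^sup>2" using t by (simp add: norm_mult)
  qed
qed simp

lemma cinner_scaleR:
  "cinner (s *\<^sub>R x) (t *\<^sub>R y) = complex_of_real (s * t) * cinner x (y :: 'a::complex_hilbert_space)"
  by (simp add: scaleR_scaleC[where 'a = 'a] cinner_scaleC_left cinner_scaleC_right)

text \<open>The scalar estimate is applied to all matrix coefficients of the function along the complex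
  line through \<open>X\<close>; it is uniform in the vectors, and so survives the supremum over them.\<close>

lemma fh_eval_norm_less:
  fixes X :: "'n::countable \<Rightarrow> 'h::complex_hilbert_space \<Rightarrow>\<^sub>L 'h"
    and A :: "'n list \<Rightarrow> 'e::complex_hilbert_space \<Rightarrow>\<^sub>L 'g::complex_hilbert_space"
  assumes A: "free_holomorphic TYPE('h) A" and X: "X \<in> row_ball"
    and le: "\<And>Y :: 'n \<Rightarrow> 'h \<Rightarrow>\<^sub>L 'h. Y \<in> row_ball \<Longrightarrow> norm (fh_eval A Y) \<le> 1"
    and zero: "norm (fh_eval A (\<lambda>i. 0 :: 'h \<Rightarrow>\<^sub>L 'h)) < 1"
  shows "norm (fh_eval A X) < 1"
proof -
  have \<rho>: "0 \<le> row_norm X" "row_norm X < 1" using X by (auto simp: row_ball_def row_norm_def)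
  \<comment> \<open>A radius for which the disc \<open>R \<mu> X\<close>, \<open>cmod \<mu> < 1\<close>, stays in the ball and has \<open>X\<close> in its interior.\<close>
  define R where "R = 2 / (1 + row_norm X)"
  have R: "1 < R" "R * row_norm X < 1" using \<rho> by (auto simp: R_def field_simps)
  define Y where "Y \<mu> = (\<lambda>i. scalar_op (complex_of_real R * \<mu>) o\<^sub>L X i)" for \<mu>
  have Y: "Y \<mu> \<in> row_ball" if "cmod \<mu> < 1" for \<mu>
  proof -
    have "cmod \<mu> * (R * row_norm X) \<le> 1 * (R * row_norm X)"
      using that \<rho> R by (intro mult_right_mono) auto
    moreover have "cmod (complex_of_real R * \<mu>) * row_norm X = cmod \<mu> * (R * row_norm X)"
      using R by (simp add: norm_mult)
    ultimately have "cmod (complex_of_real R * \<mu>) * row_norm X < 1" using R by linarith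
    then show ?thesis unfolding Y_def by (rule row_ball_scalar[OF X])
  qed
  have Y0: "Y 0 = (\<lambda>i. 0)" by (auto simp: Y_def fun_eq_iff scalar_op.rep_eq intro!: blinfun_eqI)
  have Y1: "Y (1 / complex_of_real R) = X"
    using R by (auto simp: Y_def fun_eq_iff scalar_op.rep_eq scaleC_one intro!: blinfun_eqI)
  define a where "a = norm (fh_eval A (\<lambda>i. 0 :: 'h \<Rightarrow>\<^sub>L 'h))"
  define \<kappa> where "\<kappa> = sqrt (1 - (1 - (1 / R)\<^sup>2) * (1 - a)\<^sup>2)"
  have "(1 / R)\<^sup>2 < 1\<^sup>2" by (rule power_strict_mono) (use R in auto)
  then have "0 < (1 - (1 / R)\<^sup>2) * (1 - a)\<^sup>2" using zero by (intro mult_pos_pos) (auto simp: a_def)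
  then have "\<kappa> < 1" by (simp add: \<kappa>_def)
  have coefficient: "cmod (cinner (fh_eval A X x) y) \<le> \<kappa>" if xy: "norm x \<le> 1" "norm y \<le> 1" for x y
  proof -
    define f where "f \<mu> = cinner (fh_eval A (Y \<mu>) x) y" for \<mu>
    have f_le: "cmod (f \<mu>) \<le> norm (fh_eval A (Y \<mu>))" for \<mu>
    proof -
      have "cmod (f \<mu>) \<le> norm (fh_eval A (Y \<mu>) x) * norm y" unfolding f_def by (rule norm_cinner_le)
      also have "\<dots> \<le> (norm (fh_eval A (Y \<mu>)) * norm x) * norm y" by (intro mult_right_mono norm_blinfun) simp
      also have "\<dots> \<le> (norm (fh_eval A (Y \<mu>)) * 1) * 1" using xy by (intro mult_mono) auto
      finally show ?thesis by simp
    qed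
    have A_ops: "A \<alpha> \<in> bounded_ops" for \<alpha> using A by (simp add: free_holomorphic_def)
    have "(cmod (f (1 / complex_of_real R)))\<^sup>2 \<le> 1 - (1 - (cmod (1 / complex_of_real R))\<^sup>2) * (1 - a)\<^sup>2"
    proof (rule pick_estimate)
      show "f holomorphic_on ball 0 1"
      proof (rule power_series_holomorphic)
        fix \<mu> :: complex assume "\<mu> \<in> ball 0 1"
        then have Y\<mu>: "Y \<mu> \<in> row_ball" by (intro Y) simp
        have "fh_homogeneous A (Y \<mu>) k x = (complex_of_real R * \<mu>) ^ k *\<^sub>C fh_homogeneous A X k x" for k
          unfolding Y_def
          by (simp add: fh_homogeneous_scalar[OF row_ball_ops[OF X] A_ops free_holomorphic_converges[OF A X]]
              scalar_op.rep_eq)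
        then have "(\<lambda>k. cinner ((complex_of_real R * \<mu>) ^ k *\<^sub>C fh_homogeneous A X k x) y) sums f \<mu>"
          unfolding f_def
          using bounded_linear.sums[OF bounded_linear_cinner_left[of y]
              fh_eval_apply_sums[OF free_holomorphic_converges[OF A Y\<mu>], of x]] by simp
        then show "(\<lambda>k. (complex_of_real R ^ k * cinner (fh_homogeneous A X k x) y) * (\<mu> - 0) ^ k) sums f \<mu>"
          by (simp add: cinner_scaleC_left power_mult_distrib mult_ac)
      qed
      show "cmod (f \<mu>) \<le> 1" if "cmod \<mu> < 1" for \<mu> using f_le le[OF Y[OF that]] by (rule order.trans)
      show "cmod (f 0) \<le> a" using f_le[of 0] by (simp add: Y0 a_def)
      show "a < 1" using zero by (simp add: a_def)
      show "cmod (1 / complex_of_real R) < 1" using R by (simp add: norm_divide)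
    qed
    then have "(cmod (f (1 / complex_of_real R)))\<^sup>2 \<le> 1 - (1 - (1 / R)\<^sup>2) * (1 - a)\<^sup>2"
      using R by (simp add: norm_divide)
    then show ?thesis unfolding \<kappa>_def f_def Y1 by (rule real_le_rsqrt)
  qed
  have "0 \<le> \<kappa>" using coefficient[of 0 0] by simp
  have "norm (fh_eval A X) \<le> \<kappa>"
  proof (rule norm_blinfun_bound)
    fix z
    let ?w = "fh_eval A X z"
    show "norm ?w \<le> \<kappa> * norm z"
    proof (cases "z = 0 \<or> ?w = 0")
      case False
      have "cmod (cinner (fh_eval A X ((1 / norm z) *\<^sub>R z)) ((1 / norm ?w) *\<^sub>R ?w)) \<le> \<kappa>"
        using False by (intro coefficient) auto
      also have "cinner (fh_eval A X ((1 / norm z) *\<^sub>R z)) ((1 / norm ?w) *\<^sub>R ?w)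
          = complex_of_real ((1 / norm z) * (1 / norm ?w) * (norm ?w)\<^sup>2)"
        unfolding blinfun.scaleR_right cinner_scaleR cinner_self by simp
      also have "(1 / norm z) * (1 / norm ?w) * (norm ?w)\<^sup>2 = norm ?w / norm z"
        using False by (simp add: power2_eq_square)
      finally show ?thesis using False by (simp add: norm_divide divide_le_eq)
    qed (use \<open>0 \<le> \<kappa>\<close> in auto)
  qed fact
  then show ?thesis using \<open>\<kappa> < 1\<close> by simp
qed


section \<open>Transfer from the creation operators to the ball\<close>

lemma coercive_norm_le:
  fixes w :: "'a::real_inner"
  assumes "(norm w)\<^sup>2 \<le> inner v w"
  shows "norm w \<le> norm v"
proof (rule norm_le_of_square)
  show "(norm w)\<^sup>2 \<le> norm v * norm w" using assms norm_cauchy_schwarz[of v w] by linarith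
qed simp

text \<open>For \<open>c > 0\<close> the estimate says that \<open>norm (G N\<^sup>-\<^sup>1) \<le> 1 / c\<close>, and it follows from the same bound for
  \<open>G' N'\<^sup>-\<^sup>1\<close>: the families \<open>K\<close> and \<open>L\<close> intertwine \<open>G' N'\<^sup>-\<^sup>1\<close> with \<open>G N\<^sup>-\<^sup>1\<close>, every vector is up to a
  small error a sum \<open>\<Sum>b. K b (z b)\<close> with \<open>\<Sum>b. norm (z b) ^ 2\<close> at most the square of its norm, and the
  row formed by \<open>L\<close> is contractive. Only the surjectivity of \<open>N'\<close> and the lower bound of \<open>N\<close>
  enter, so the quotients need not be power series themselves.\<close>

lemma quotient_norm_transfer:
  fixes K :: "'i \<Rightarrow> 'k::complex_hilbert_space \<Rightarrow>\<^sub>L 'a::complex_hilbert_space"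
    and L :: "'i \<Rightarrow> 'l::complex_hilbert_space \<Rightarrow>\<^sub>L 'b::complex_hilbert_space"
    and N :: "'a \<Rightarrow>\<^sub>L 'a" and N' :: "'k \<Rightarrow>\<^sub>L 'k" and G :: "'a \<Rightarrow>\<^sub>L 'b" and G' :: "'k \<Rightarrow>\<^sub>L 'l"
  assumes K: "\<And>b. K b \<in> bounded_ops" "\<And>z. ((\<lambda>b. norm (adj (K b) z) ^ 2) has_sum norm z ^ 2) I"
    and L: "\<And>b. L b \<in> bounded_ops" "\<And>z. ((\<lambda>b. norm (adj (L b) z) ^ 2) has_sum norm z ^ 2) I"
    and NK: "\<And>b w. b \<in> I \<Longrightarrow> N (K b w) = K b (N' w)"
    and GL: "\<And>b w. b \<in> I \<Longrightarrow> G (K b w) = L b (G' w)"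
    and N: "\<And>w. (norm w)\<^sup>2 \<le> inner (N w) w" and N': "\<And>w. (norm w)\<^sup>2 \<le> inner (N' w) w"
    and c: "0 \<le> c" "\<And>w. c * norm (G' w) \<le> norm (N' w)"
  shows "c * norm (G y) \<le> norm (N y)"
proof (rule field_le_epsilon)
  fix e :: real assume "0 < e"
  \<comment> \<open>An error \<open>d\<close> in the approximation of \<open>y\<close> costs at most \<open>c * norm G * d \<le> e\<close>; adding \<open>1\<close> allows for \<open>G = 0\<close>.\<close>
  define d where "d = e / (c * norm G + 1)"
  have pos: "0 < c * norm G + 1" using c by (simp add: add_nonneg_pos)
  have d: "0 < d" using \<open>0 < e\<close> pos by (simp add: d_def)
  have "c * norm G * d \<le> (c * norm G + 1) * d" using d by simp
  also have "\<dots> = e" using pos by (simp add: d_def)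
  finally have de: "c * norm G * d \<le> e" .
  obtain S z where S: "finite S" "S \<subseteq> I" and z: "(\<Sum>b\<in>S. norm (z b) ^ 2) \<le> norm (N y) ^ 2"
    and close: "norm (N y - (\<Sum>b\<in>S. K b (z b))) < d"
    using parseval_family_approximation[OF K d] by blast
  have "\<forall>b. \<exists>x. N' x = z b" using coercive_surjective[OF N'] by blast
  then have "\<exists>w. \<forall>b. N' (w b) = z b" by (rule choice)
  then obtain w where w: "\<And>b. N' (w b) = z b" by blast
  define u where "u = (\<Sum>b\<in>S. K b (w b))"
  have Nu: "N u = (\<Sum>b\<in>S. K b (z b))"
    unfolding u_def blinfun.sum_right using S NK w by (intro sum.cong) auto
  have Gu: "G u = (\<Sum>b\<in>S. L b (G' (w b)))"
    unfolding u_def blinfun.sum_right using S GL by (intro sum.cong) auto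
  have "norm (y - u) \<le> norm (N (y - u))" by (rule coercive_norm_le[OF N])
  also have "\<dots> \<le> d" using close by (simp add: blinfun.diff_right Nu)
  finally have yu: "norm (y - u) \<le> d" .
  have "(c * norm (G u))\<^sup>2 \<le> c\<^sup>2 * (\<Sum>b\<in>S. norm (G' (w b)) ^ 2)"
    unfolding power_mult_distrib Gu
    by (intro mult_left_mono parseval_family_row_contraction[OF L S]) simp
  also have "\<dots> = (\<Sum>b\<in>S. (c * norm (G' (w b))) ^ 2)" by (simp add: power_mult_distrib sum_distrib_left)
  also have "\<dots> \<le> (\<Sum>b\<in>S. norm (z b) ^ 2)"
  proof (rule sum_mono, rule power_mono)
    show "c * norm (G' (w b)) \<le> norm (z b)" for b using c(2)[of "w b"] by (simp add: w)
  qed (use c in simp)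
  also have "\<dots> \<le> norm (N y) ^ 2" by (rule z)
  finally have "c * norm (G u) \<le> norm (N y)" by (rule power2_le_imp_le) simp
  moreover have "c * norm (G y) \<le> c * norm (G u) + c * norm G * d"
  proof -
    have "norm (G y) \<le> norm (G u) + norm (G (y - u))"
      using norm_triangle_ineq[of "G u" "G (y - u)"] by (simp add: blinfun.diff_right)
    also have "norm (G (y - u)) \<le> norm G * d"
      using norm_blinfun[of G "y - u"] mult_left_mono[OF yu, of "norm G"] by simp
    finally have "norm (G y) \<le> norm (G u) + norm G * d" by simp
    then show ?thesis using mult_left_mono[OF _ c(1), of "norm (G y)" "norm (G u) + norm G * d"]
      by (simp add: algebra_simps)
  qed
  ultimately show "c * norm (G y) \<le> norm (N y) + e" using de by linarith
qed

lemma inner_le_of_re_op_le: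
  assumes T: "T \<in> bounded_ops" and le: "op_le (re_op T) id_blinfun"
  shows "inner (blinfun_apply T z) z \<le> (norm z)\<^sup>2"
proof -
  have "0 \<le> inner ((id_blinfun - re_op T) z) z"
    using le unfolding op_le_def inner_eq_Re_cinner by blast
  moreover have "inner (adj T z) z = inner (T z) z"
    unfolding inner_eq_Re_cinner cinner_adj_left[OF T]
    unfolding inner_eq_Re_cinner[symmetric] by (rule inner_commute)
  ultimately show ?thesis
    by (simp add: re_op_def blinfun.diff_left blinfun.scaleR_left blinfun.add_left inner_diff_left
        inner_add_left power2_norm_eq_inner)
qed

text \<open>With \<open>w = T z\<close>: a number of real part at most \<open>1\<close> is at least as close to \<open>0\<close> as to \<open>2\<close>, and in the
  same way an operator \<open>T\<close> of real part at most \<open>1\<close> is dominated by \<open>2 - T\<close>.\<close>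

lemma norm_le_norm_two_minus:
  fixes w z :: "'a::real_inner"
  assumes "inner w z \<le> (norm z)\<^sup>2"
  shows "norm w \<le> norm (2 *\<^sub>R z - w)"
proof (rule power2_le_imp_le)
  have "(norm (2 *\<^sub>R z - w))\<^sup>2 = 4 * (norm z)\<^sup>2 - 4 * inner w z + (norm w)\<^sup>2"
    unfolding power2_norm_eq_inner by (simp add: inner_diff_left inner_diff_right inner_commute)
  then show "(norm w)\<^sup>2 \<le> (norm (2 *\<^sub>R z - w))\<^sup>2" using assms by linarith
qed simp

lemma coercive_two_minus:
  fixes T :: "'a::real_inner \<Rightarrow>\<^sub>L 'a"
  assumes "inner (T z) z \<le> (norm z)\<^sup>2"
  shows "(norm z)\<^sup>2 \<le> inner ((2 *\<^sub>R id_blinfun - T) z) z"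
  using assms by (simp add: blinfun.diff_left blinfun.scaleR_left inner_diff_left power2_norm_eq_inner)

lemma op_tensor_unitary:
  assumes V: "V \<in> bounded_ops" "adj V o\<^sub>L V = id_blinfun" "V o\<^sub>L adj V = id_blinfun"
  shows "op_tensor V id_blinfun (op_tensor (adj V) id_blinfun z) = z"
    and "cinner (op_tensor V id_blinfun x) (op_tensor V id_blinfun y) = cinner x y"
proof -
  note ops = op_tensor_ops[OF V(1) bounded_ops_id] adj_bounded_ops[OF V(1)]
  have "op_tensor V id_blinfun o\<^sub>L op_tensor (adj V) id_blinfun = id_blinfun"
    by (simp add: op_tensor_compose V adj_bounded_ops bounded_ops_id blinfun_compose_id op_tensor_id)
  then show "op_tensor V id_blinfun (op_tensor (adj V) id_blinfun z) = z"
    by (metis blinfun_apply_blinfun_compose blinfun_apply_id_blinfun id_apply)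
  have "op_tensor (adj V) id_blinfun o\<^sub>L op_tensor V id_blinfun = id_blinfun"
    by (simp add: op_tensor_compose V adj_bounded_ops bounded_ops_id blinfun_compose_id op_tensor_id)
  then have "op_tensor (adj V) id_blinfun (op_tensor V id_blinfun y) = y"
    by (metis blinfun_apply_blinfun_compose blinfun_apply_id_blinfun id_apply)
  then show "cinner (op_tensor V id_blinfun x) (op_tensor V id_blinfun y) = cinner x y"
    by (simp add: cinner_adj[OF ops(1)] adj_op_tensor V bounded_ops_id adj_id)
qed

text \<open>At the scaled creation operators \<open>\<Theta>\<close> is almost isometric, so that it can be cancelled from
  \<open>norm (\<Theta> (\<Gamma> w)) \<le> norm ((2 - F) w)\<close> at the cost of a factor close to \<open>1\<close>.\<close>

lemma quotient_contractive:
  fixes F :: "'n::countable list \<Rightarrow> 'e::complex_hilbert_space \<Rightarrow>\<^sub>L 'e"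
    and \<Theta> :: "'n list \<Rightarrow> 'g::complex_hilbert_space \<Rightarrow>\<^sub>L 'e"
    and \<Gamma> :: "'n list \<Rightarrow> 'e \<Rightarrow>\<^sub>L 'g" and X :: "'n \<Rightarrow> 'h::complex_hilbert_space \<Rightarrow>\<^sub>L 'h"
  assumes space: "separable_space (euclidean :: 'h topology)" "infinite_dimensional TYPE('h)"
    and F: "free_holomorphic TYPE('h) F" and \<Theta>: "free_holomorphic TYPE('h) \<Theta>"
    and \<Gamma>: "free_holomorphic TYPE('h) \<Gamma>"
    and re: "\<And>Y :: 'n \<Rightarrow> 'h \<Rightarrow>\<^sub>L 'h. Y \<in> row_ball \<Longrightarrow> op_le (re_op (fh_eval F Y)) id_blinfun"
    and radial: "radial_infimum_property TYPE('h) \<Theta>" "fh_norm TYPE('h) \<Theta> = 1"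
    and factor: "\<And>Y :: 'n \<Rightarrow> 'h \<Rightarrow>\<^sub>L 'h. Y \<in> row_ball \<Longrightarrow> fh_eval F Y = fh_eval \<Theta> Y o\<^sub>L fh_eval \<Gamma> Y"
    and X: "X \<in> row_ball"
  shows "norm (fh_eval \<Gamma> X y) \<le> norm ((2 *\<^sub>R id_blinfun - fh_eval F X) y)"
proof (rule field_le_mult_one_interval)
  fix c :: real assume c: "0 < c" "c < 1"
  have ops: "F \<alpha> \<in> bounded_ops" "\<Theta> \<alpha> \<in> bounded_ops" "\<Gamma> \<alpha> \<in> bounded_ops" for \<alpha>
    using F \<Theta> \<Gamma> by (auto simp: free_holomorphic_def)
  have re_inner: "inner (fh_eval F Y z) z \<le> (norm z)\<^sup>2" if "Y \<in> row_ball" for Y :: "'n \<Rightarrow> 'h \<Rightarrow>\<^sub>L 'h" and z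
    by (rule inner_le_of_re_op_le[OF fh_eval_ops re[OF that]])
      (use ops row_ball_ops[OF that] free_holomorphic_converges[OF F that] in auto)
  let ?inf = "\<lambda>r. INF x \<in> {x :: ('n fock, 'g) htensor. norm x = 1}.
      ereal (norm (fh_eval \<Theta> (\<lambda>i. r *\<^sub>R creation i) x))"
  have "ereal c < Liminf (at_left (1::real)) ?inf"
    using radial c by (simp add: radial_infimum_property_def)
  then have "\<forall>\<^sub>F r in at_left (1::real). ereal c < ?inf r" by (rule less_LiminfD)
  moreover have "\<forall>\<^sub>F r in at_left (1::real). r \<in> {max 0 (row_norm X)<..<1}"
    by (rule eventually_at_left_real) (use X in \<open>auto simp: row_ball_def\<close>)
  ultimately have "\<forall>\<^sub>F r in at_left (1::real). ereal c < ?inf r \<and> r \<in> {max 0 (row_norm X)<..<1}"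
    by (rule eventually_conj)
  then obtain r where inf: "ereal c < ?inf r" and r: "0 \<le> r" "row_norm X < r" "r < 1"
    using eventually_happens'[OF trivial_limit_at_left_real] by fastforce
  let ?S = "\<lambda>i :: 'n. r *\<^sub>R creation i"
  have S_ops: "?S i \<in> bounded_ops" for i by (intro bounded_ops_scaleR creation_ops)
  have lower: "c * norm w \<le> norm (fh_eval \<Theta> ?S w)" for w
  proof (cases "w = 0")
    case False
    have "ereal c < ereal (norm (fh_eval \<Theta> ?S ((1 / norm w) *\<^sub>R w)))"
      using less_INF_D[OF inf, of "(1 / norm w) *\<^sub>R w"] False by simp
    then show ?thesis using False by (simp add: blinfun.scaleR_right less_divide_eq)
  qed simp
  obtain V :: "'h \<Rightarrow>\<^sub>L 'n fock"
    where V: "V \<in> bounded_ops" "adj V o\<^sub>L V = id_blinfun" "V o\<^sub>L adj V = id_blinfun"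
    using fock_unitary[OF space] by blast
  let ?T = "\<lambda>i. adj V o\<^sub>L ?S i o\<^sub>L V"
  have T: "?T \<in> row_ball" by (rule creation_tuple_row_ball[OF V r(1,3)])
  note at_S = fh_eval_creation(2)[OF V r(1,3)]
  have factor_S: "fh_eval F ?S w = fh_eval \<Theta> ?S (fh_eval \<Gamma> ?S w)" for w
  proof -
    define x where "x = op_tensor (adj V) id_blinfun w"
    have w: "w = op_tensor V id_blinfun x" unfolding x_def by (rule op_tensor_unitary(1)[OF V, symmetric])
    show ?thesis unfolding w at_S[OF F] at_S[OF \<Gamma>] at_S[OF \<Theta>] factor[OF T] by simp
  qed
  have re_S: "inner (fh_eval F ?S w) w \<le> (norm w)\<^sup>2" for w
  proof -
    define x where "x = op_tensor (adj V) id_blinfun w"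
    have w: "w = op_tensor V id_blinfun x" unfolding x_def by (rule op_tensor_unitary(1)[OF V, symmetric])
    show ?thesis
      unfolding w at_S[OF F] power2_norm_eq_inner inner_eq_Re_cinner op_tensor_unitary(2)[OF V]
      using re_inner[OF T, of x] unfolding power2_norm_eq_inner inner_eq_Re_cinner .
  qed
  obtain k :: "'h \<Rightarrow> 'n fock \<Rightarrow>\<^sub>L 'h" where k: "\<And>b. k b \<in> bounded_ops"
    and int: "\<And>b i. b \<in> chosen_basis \<Longrightarrow> X i o\<^sub>L k b = k b o\<^sub>L ?S i"
    and sum: "\<And>h. ((\<lambda>b. norm (adj (k b) h) ^ 2) has_sum norm h ^ 2) chosen_basis"
    using poisson_kernel[OF X r(2)] by blast
  have intertwine: "fh_eval A X (op_tensor (k b) id_blinfun w) = op_tensor (k b) id_blinfun (fh_eval A ?S w)"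
    if "free_holomorphic TYPE('h) A" "b \<in> chosen_basis"
    for A :: "'n list \<Rightarrow> 'p::complex_hilbert_space \<Rightarrow>\<^sub>L 'q::complex_hilbert_space" and b w
    using that(1) unfolding free_holomorphic_def
    by (intro fh_eval_intertwine row_ball_ops[OF X] S_ops k int that
        free_holomorphic_converges[OF that(1) X] fh_eval_creation(1)[OF V r(1,3) that(1)]) blast
  show "c * norm (fh_eval \<Gamma> X y) \<le> norm ((2 *\<^sub>R id_blinfun - fh_eval F X) y)"
  proof (rule quotient_norm_transfer[where I = chosen_basis and K = "\<lambda>b. op_tensor (k b) id_blinfun"
        and L = "\<lambda>b. op_tensor (k b) id_blinfun" and N' = "2 *\<^sub>R id_blinfun - fh_eval F ?S"
        and G' = "fh_eval \<Gamma> ?S"])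
    show "(2 *\<^sub>R id_blinfun - fh_eval F X) (op_tensor (k b) id_blinfun w)
        = op_tensor (k b) id_blinfun ((2 *\<^sub>R id_blinfun - fh_eval F ?S) w)" if "b \<in> chosen_basis" for b w
      by (simp add: blinfun.diff_left blinfun.diff_right blinfun.scaleR_left blinfun.scaleR_right
          intertwine[OF F that])
    show "c * norm (fh_eval \<Gamma> ?S w) \<le> norm ((2 *\<^sub>R id_blinfun - fh_eval F ?S) w)" for w
    proof -
      have "c * norm (fh_eval \<Gamma> ?S w) \<le> norm (fh_eval F ?S w)" unfolding factor_S by (rule lower)
      also have "\<dots> \<le> norm (2 *\<^sub>R w - fh_eval F ?S w)" by (rule norm_le_norm_two_minus[OF re_S])
      finally show ?thesis by (simp add: blinfun.diff_left blinfun.scaleR_left)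
    qed
  qed (use c in \<open>auto intro!: op_tensor_ops k bounded_ops_id amplified_expansion sum
      coercive_two_minus re_S re_inner[OF X] intertwine[OF \<Gamma>]\<close>)
qed

theorem theorem5p1:
  fixes F :: "'n::countable list \<Rightarrow> 'e::complex_hilbert_space \<Rightarrow>\<^sub>L 'e"
    and \<Theta> :: "'n list \<Rightarrow> 'g::complex_hilbert_space \<Rightarrow>\<^sub>L 'e"
    and \<Gamma> :: "'n list \<Rightarrow> 'e \<Rightarrow>\<^sub>L 'g"
  assumes "separable_space (euclidean :: 'h::complex_hilbert_space topology)"
    and "infinite_dimensional TYPE('h)"
    and "free_holomorphic TYPE('h) F"
    and "free_holomorphic TYPE('h) \<Theta>"
    and "free_holomorphic TYPE('h) \<Gamma>"
    and "\<forall>X \<in> (row_ball :: ('n \<Rightarrow> 'h \<Rightarrow>\<^sub>L 'h) set). op_le (re_op (fh_eval F X)) id_blinfun"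
    and "radial_infimum_property TYPE('h) \<Theta>"
    and "fh_norm TYPE('h) \<Theta> = 1"
    and "norm (fh_eval \<Theta> (\<lambda>i. 0 :: 'h \<Rightarrow>\<^sub>L 'h)) < 1"
    and "\<forall>X \<in> (row_ball :: ('n \<Rightarrow> 'h \<Rightarrow>\<^sub>L 'h) set). fh_eval F X = fh_eval \<Theta> X o\<^sub>L fh_eval \<Gamma> X"
  shows "\<forall>X \<in> (row_ball :: ('n \<Rightarrow> 'h \<Rightarrow>\<^sub>L 'h) set).
    norm (fh_eval F X) \<le> 2 * norm (fh_eval \<Theta> X) / (1 - norm (fh_eval \<Theta> X))"
proof
  fix X :: "'n \<Rightarrow> 'h \<Rightarrow>\<^sub>L 'h" assume X: "X \<in> row_ball"
  let ?t = "norm (fh_eval \<Theta> X)"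
  have \<Theta>_le: "norm (fh_eval \<Theta> Y) \<le> 1" if "Y \<in> row_ball" for Y :: "'n \<Rightarrow> 'h \<Rightarrow>\<^sub>L 'h"
    using cSUP_upper[OF that, of "\<lambda>Y. norm (fh_eval \<Theta> Y)"] assms(7,8)
    by (simp add: radial_infimum_property_def fh_bounded_def fh_norm_def)
  have t: "?t < 1" by (rule fh_eval_norm_less[OF assms(4) X \<Theta>_le assms(9)])
  show "norm (fh_eval F X) \<le> 2 * ?t / (1 - ?t)"
  proof (rule norm_blinfun_bound)
    show "0 \<le> 2 * ?t / (1 - ?t)" using t by simp
    fix y
    let ?f = "norm (fh_eval F X y)"
    have "?f \<le> ?t * norm (fh_eval \<Gamma> X y)"
      using assms(10) X norm_blinfun[of "fh_eval \<Theta> X"] by simp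
    also have "\<dots> \<le> ?t * norm ((2 *\<^sub>R id_blinfun - fh_eval F X) y)"
      by (intro mult_left_mono quotient_contractive[where \<Theta> = \<Theta>] assms X) (use assms(6,10) in auto)
    also have "\<dots> \<le> ?t * (2 * norm y + ?f)"
      using norm_triangle_ineq4[of "2 *\<^sub>R y" "fh_eval F X y"]
      by (intro mult_left_mono) (auto simp: blinfun.diff_left blinfun.scaleR_left)
    finally have "?f * (1 - ?t) \<le> 2 * ?t * norm y" by (simp add: algebra_simps)
    then show "?f \<le> 2 * ?t / (1 - ?t) * norm y" using t by (simp add: field_simps)
  qed
qed

end
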